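(* Let $\mathbb K$ be a field, $R=\mathbb K[x_1,\dots,x_n]$, and let $I=I(G)\subseteq R$ be the edge ideal of a simple graph $G$ on the vertex set $\{x_1,\dots,x_n\}$. Suppose the neighbors of $x_n$ are $x_1,\dots,x_s$, and that there are no edges of $G$ between these neighbors. Consider the $x_n$-splitting $I=x_nJ+K$ with $J=(x_1,\dots,x_s)$ and $K=I(G\setminus\{x_n\})\subseteq\mathbb K[x_1,\dots,x_{n-1}]$. If $K$ and all the ideals $I(H_{k_1,\dots,k_m})$, $1\le k_1<\cdots<k_m\le s$, admit a minimal pruned resolution, then $I$ admits a minimal pruned resolution.
   Context: The edge ideal $I(G)$ is generated by the monomials $x_ix_j$ with $\{x_i,x_j\}$ an edge of $G$. $N(x_k)$ denotes the set of neighbors of $x_k$ in $G$. For $m\ge 1$ and $1\le k_1<\cdots<k_m\le s$, $I(H_{k_1,\dots,k_m})$ is the squarefree monomial ideal (edge ideal of a hypergraph $H_{k_1,\dots,k_m}$) of $R'=\mathbb K[x_{s+1},\dots,x_{n-1}]$ generated by: the monomials $x_ix_j$ for edges $\{x_i,x_j\}$ of $G$ with $x_i,x_j\in\{x_{s+1},\dots,x_{n-1}\}$ and $x_i,x_j\notin\bigcap_{t=1}^m N(x_{k_t})$; and the monomials $\mathrm{lcm}(x_{\ell_1},\dots,x_{\ell_m})$ for all choices $x_{\ell_t}\in N(x_{k_t})\setminus\{x_n\}$, $t=1,\dots,m$ (a vertex may be repeated, so the degree may be smaller than $m$). $G(I)$ (for a monomial ideal) denotes the set of minimal monomial generators. Pruned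 resolutions. For a monomial ideal $I$ with minimal generators in a fixed order $m_1,\dots,m_q$ and $\sigma\subseteq\{1,\dots,q\}$ put $m_\sigma=\mathrm{lcm}(m_i: i\in\sigma)$, $m_\emptyset=1$. The Taylor resolution of $R/I$ is supported on the full simplex $X_{\mathrm{Taylor}}$ on $q$ vertices; the face $\sigma$ has homological degree $|\sigma|$ and multidegree the exponent of $m_\sigma$. Pruning algorithm: for $j=1,\dots,q$ successively (step $j$), for every $\sigma\not\ni j$ with $m_\sigma=m_{\sigma\cup\{j\}}$ and such that neither $\sigma$ nor $\sigma\cup\{j\}$ belongs to a previously selected edge, select (prune) the edge $\{\sigma,\sigma\cup\{j\}\}$. The selected edges form a homogeneous acyclic matching on $X_{\mathrm{Taylor}}$, and discrete Morse theory (Batzies–Welker) yields a $\mathbb Z^n$-graded CW-complex, with cells corresponding to the faces in no selected edge (critical faces), supporting a free resolution of $R/I$: the pruned resolution for the given order. Its module in homological degree $i$ is the direct sum of $R(-\deg m_\sigma)$ over critical $\sigma$ with $|\sigma|=i$; so it is minimal iff, for all $i,\alpha$, the number of critical $\sigma$ with $|\sigma|=i$ and multidegree $\alpha$ is $\beta_{i,\alpha}(R/I)$. Betti splitting version. $I=J+K$, with $G(I)$ the disjoint union of $G(J)$ and $G(K)$, is a Betti splitting if $\beta_{i,\alpha}(I)=\beta_{i,\alpha}(J)+\beta_{i,\alpha}(K)+\beta_{i-1,\alpha}(J\cap K)$ for all $i$ and $\alpha\in\mathbb Z^n$. Then one may prune separately the faces with vertices in $G(J)$, the faces with vertices in $G(K)$,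 and the remaining faces (which account for $J\cap K$), and iterate this using Betti splittings of $J$, $K$, $J\cap K$; this is always a partial pruning of $X_{\mathrm{Taylor}}$, and the numbers of generators (pruned Betti numbers) satisfy $\overline\beta_{i,\alpha}(I)=\overline\beta_{i,\alpha}(J)+\overline\beta_{i,\alpha}(K)+\overline\beta_{i-1,\alpha}(J\cap K)$. An $x_n$-splitting is a Betti splitting in which the first summand is generated by the minimal generators divisible by $x_n$ and the second by the others. $I$ admits a minimal pruned resolution if, for some order of the generators, the cellular resolution given by the pruning algorithm or by its iterated Betti splitting version is minimal. Explicitly (recursively, in finitely many steps): either for some order of $G(I)$ the pruned resolution of $R/I$ is minimal, or there is a Betti splitting $I=J+K$ such that $J$, $K$ and $J\cap K$ all admit minimal pruned resolutions. *)

theory Defs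
  imports "HOL-Library.Poly_Mapping"
begin

section \<open>Polynomials, monomials and monomial ideals\<close>

type_synonym 'v expo = "'v \<Rightarrow>\<^sub>0 nat"
type_synonym ('v, 'k) mpoly = "'v expo \<Rightarrow>\<^sub>0 'k"

text \<open>The polynomial ring \<open>K[x_v : v \<in> V]\<close> is a subset of the ambient type of all polynomials in
  indeterminates indexed by \<open>'v\<close>, so that rings in different sets of variables can be compared.\<close>

definition poly_ring :: "'v set \<Rightarrow> ('v, 'k::field) mpoly set" where
  "poly_ring V = {p. \<forall>e \<in> Poly_Mapping.keys p. Poly_Mapping.keys e \<subseteq> V}"

definition xvar :: "'v \<Rightarrow> 'v expo" where
  "xvar v = Poly_Mapping.single v 1"

definition mon :: "'v expo \<Rightarrow> ('v, 'k::field) mpoly" where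
  "mon e = Poly_Mapping.single e 1"

definition mon_lcm :: "'v expo set \<Rightarrow> 'v expo" where
  "mon_lcm M = Abs_poly_mapping (\<lambda>v. Max (insert 0 ((\<lambda>e. Poly_Mapping.lookup e v) ` M)))"

lemma lookup_mon_lcm:
  assumes "finite M"
  shows "Poly_Mapping.lookup (mon_lcm M) v = Max (insert 0 ((\<lambda>e. Poly_Mapping.lookup e v) ` M))"
proof -
  have "{v. Max (insert 0 ((\<lambda>e. Poly_Mapping.lookup e v) ` M)) \<noteq> 0}
      \<subseteq> (\<Union>e\<in>M. Poly_Mapping.keys e)"
  proof
    fix v assume "v \<in> {v. Max (insert 0 ((\<lambda>e. Poly_Mapping.lookup e v) ` M)) \<noteq> 0}"
    moreover have "Max (insert 0 ((\<lambda>e. Poly_Mapping.lookup e v) ` M))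
        \<in> insert 0 ((\<lambda>e. Poly_Mapping.lookup e v) ` M)"
      using assms by (intro Max_in) auto
    ultimately show "v \<in> (\<Union>e\<in>M. Poly_Mapping.keys e)"
      by (auto simp: in_keys_iff)
  qed
  moreover have "finite (\<Union>e\<in>M. Poly_Mapping.keys e)"
    using assms by simp
  ultimately have "finite {v. Max (insert 0 ((\<lambda>e. Poly_Mapping.lookup e v) ` M)) \<noteq> 0}"
    by (rule finite_subset)
  then show ?thesis
    unfolding mon_lcm_def by (simp only: lookup_Abs_poly_mapping)
qed

definition ideal_gen :: "'v set \<Rightarrow> ('v, 'k::field) mpoly set \<Rightarrow> ('v, 'k) mpoly set" where
  "ideal_gen V S =
    {(\<Sum>s\<in>T. c s * s) | c T. finite T \<and> T \<subseteq> S \<and> (\<forall>s\<in>T. c s \<in> poly_ring V)}"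

definition monomial_ideal :: "'v set \<Rightarrow> ('v, 'k::field) mpoly set \<Rightarrow> bool" where
  "monomial_ideal V I \<longleftrightarrow>
    (\<exists>M. (\<forall>e\<in>M. Poly_Mapping.keys e \<subseteq> V) \<and> I = ideal_gen V (mon ` M))"

text \<open>\<open>G(I)\<close>, as a set of exponents; divisibility of monomials is addition of exponents.\<close>

definition min_gens :: "('v, 'k::field) mpoly set \<Rightarrow> 'v expo set" where
  "min_gens I = {e. mon e \<in> I \<and> (\<forall>e' t. e = e' + t \<and> mon e' \<in> I \<longrightarrow> e' = e)}"


section \<open>Minimal multigraded free resolutions and Betti numbers\<close>

text \<open>A multidegree is an integer vector \<open>'v \<Rightarrow> int\<close>, zero outside \<open>V\<close>.
  A record \<open>F\<close> below describes a complex of graded free modules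
  \<open>F_i = \<Oplus>_{b < frank F i} R(- fdeg F i b)\<close> over \<open>R = poly_ring V\<close> with basis \<open>e_b\<close>, where
  \<open>fmat F i a b\<close> is the coefficient of \<open>e_a\<close> in the image of \<open>e_b\<close> under the differential
  \<open>F_{i+1} \<rightarrow> F_i\<close>, together with images \<open>faug F b\<close> of the basis elements of \<open>F_0\<close>.\<close>

record (overloaded) ('v, 'k) free_complex =
  frank :: "nat \<Rightarrow> nat"
  fdeg :: "nat \<Rightarrow> nat \<Rightarrow> 'v \<Rightarrow> int"
  fmat :: "nat \<Rightarrow> nat \<Rightarrow> nat \<Rightarrow> (('v \<Rightarrow>\<^sub>0 nat) \<Rightarrow>\<^sub>0 'k)"
  faug :: "nat \<Rightarrow> (('v \<Rightarrow>\<^sub>0 nat) \<Rightarrow>\<^sub>0 'k)"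

definition mdeg :: "'v expo \<Rightarrow> 'v \<Rightarrow> int" where
  "mdeg e v = int (Poly_Mapping.lookup e v)"

definition homogeneous :: "('v \<Rightarrow> int) \<Rightarrow> ('v, 'k::field) mpoly \<Rightarrow> bool" where
  "homogeneous \<alpha> p \<longleftrightarrow> (\<forall>e \<in> Poly_Mapping.keys p. mdeg e = \<alpha>)"

definition free_mod :: "'v set \<Rightarrow> nat \<Rightarrow> (nat \<Rightarrow> ('v, 'k::field) mpoly) set" where
  "free_mod V r = {x. (\<forall>b<r. x b \<in> poly_ring V) \<and> (\<forall>b\<ge>r. x b = 0)}"

definition fdiff ::
    "('v, 'k::field) free_complex \<Rightarrow> nat \<Rightarrow> (nat \<Rightarrow> ('v, 'k) mpoly) \<Rightarrow> nat \<Rightarrow> ('v, 'k) mpoly" where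
  "fdiff F i x = (\<lambda>a. if a < frank F i then \<Sum>b<frank F (Suc i). x b * fmat F i a b else 0)"

definition faugment ::
    "('v, 'k::field) free_complex \<Rightarrow> (nat \<Rightarrow> ('v, 'k) mpoly) \<Rightarrow> ('v, 'k) mpoly" where
  "faugment F x = (\<Sum>b<frank F 0. x b * faug F b)"

text \<open>Graded free resolutions of the module \<open>A / B\<close>, for monomial ideals \<open>B \<subseteq> A\<close> of \<open>poly_ring V\<close>:
  the pair \<open>(I, {0})\<close> gives the ideal \<open>I\<close> as a module, the pair \<open>(poly_ring V, I)\<close> gives \<open>R/I\<close>.\<close>

definition graded_free_res ::
    "'v set \<Rightarrow> ('v, 'k::field) mpoly set \<Rightarrow> ('v, 'k) mpoly set \<Rightarrow> ('v, 'k) free_complex \<Rightarrow> bool" where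
  "graded_free_res V A B F \<longleftrightarrow>
     (\<forall>i. \<forall>b < frank F i. \<forall>v. v \<notin> V \<longrightarrow> fdeg F i b v = 0) \<and>
     (\<forall>i. \<forall>a < frank F i. \<forall>b < frank F (Suc i).
        fmat F i a b \<in> poly_ring V \<and>
        homogeneous (\<lambda>v. fdeg F (Suc i) b v - fdeg F i a v) (fmat F i a b)) \<and>
     (\<forall>b < frank F 0. faug F b \<in> A \<and> homogeneous (fdeg F 0 b) (faug F b)) \<and>
     (\<forall>f\<in>A. \<exists>x \<in> free_mod V (frank F 0). f - faugment F x \<in> B) \<and>
     (\<forall>x \<in> free_mod V (frank F 0).
        faugment F x \<in> B \<longleftrightarrow> (\<exists>y \<in> free_mod V (frank F 1). x = fdiff F 0 y)) \<and>
     (\<forall>i. \<forall>x \<in> free_mod V (frank F (Suc i)).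
        fdiff F i x = (\<lambda>_. 0) \<longleftrightarrow>
          (\<exists>y \<in> free_mod V (frank F (Suc (Suc i))). x = fdiff F (Suc i) y))"

text \<open>Minimality: all entries of the differentials lie in the ideal generated by the variables.\<close>

definition min_free_res ::
    "'v set \<Rightarrow> ('v, 'k::field) mpoly set \<Rightarrow> ('v, 'k) mpoly set \<Rightarrow> ('v, 'k) free_complex \<Rightarrow> bool" where
  "min_free_res V A B F \<longleftrightarrow>
     graded_free_res V A B F \<and>
     (\<forall>i. \<forall>a < frank F i. \<forall>b < frank F (Suc i). Poly_Mapping.lookup (fmat F i a b) 0 = 0)"

definition betti ::
    "'v set \<Rightarrow> ('v, 'k::field) mpoly set \<Rightarrow> ('v, 'k) mpoly set \<Rightarrow> nat \<Rightarrow> ('v \<Rightarrow> int) \<Rightarrow> nat" where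
  "betti V A B i \<alpha> =
     (THE k. \<exists>F. min_free_res V A B F \<and> k = card {b. b < frank F i \<and> fdeg F i b = \<alpha>})"

abbreviation betti_ideal :: "'v set \<Rightarrow> ('v, 'k::field) mpoly set \<Rightarrow> nat \<Rightarrow> ('v \<Rightarrow> int) \<Rightarrow> nat" where
  "betti_ideal V I \<equiv> betti V I {0}"

abbreviation betti_quot :: "'v set \<Rightarrow> ('v, 'k::field) mpoly set \<Rightarrow> nat \<Rightarrow> ('v \<Rightarrow> int) \<Rightarrow> nat" where
  "betti_quot V I \<equiv> betti V (poly_ring V) I"


section \<open>Pruned resolutions\<close>

text \<open>Faces of the Taylor simplex are sets of positions in the list \<open>ms\<close> of ordered generators.\<close>

definition face_lcm :: "'v expo list \<Rightarrow> nat set \<Rightarrow> 'v expo" where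
  "face_lcm ms \<sigma> = mon_lcm ((!) ms ` \<sigma>)"

definition edge_ends :: "(nat set \<times> nat set) set \<Rightarrow> nat set set" where
  "edge_ends P = fst ` P \<union> snd ` P"

text \<open>The edges selected in the first \<open>j\<close> steps. Edges of a single step are pairwise disjoint, so
  they can be selected simultaneously.\<close>

primrec pruned_edges :: "'v expo list \<Rightarrow> nat \<Rightarrow> (nat set \<times> nat set) set" where
  "pruned_edges ms 0 = {}"
| "pruned_edges ms (Suc j) = pruned_edges ms j \<union>
    {(\<sigma>, insert j \<sigma>) | \<sigma>. \<sigma> \<subseteq> {..<length ms} \<and> j \<notin> \<sigma> \<and>
       face_lcm ms \<sigma> = face_lcm ms (insert j \<sigma>) \<and>
       \<sigma> \<notin> edge_ends (pruned_edges ms j) \<and> insert j \<sigma> \<notin> edge_ends (pruned_edges ms j)}"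

definition critical_faces :: "'v expo list \<Rightarrow> nat set set" where
  "critical_faces ms = Pow {..<length ms} - edge_ends (pruned_edges ms (length ms))"

definition pruned_rank :: "'v expo list \<Rightarrow> nat \<Rightarrow> ('v \<Rightarrow> int) \<Rightarrow> nat" where
  "pruned_rank ms i \<alpha> =
     card {\<sigma> \<in> critical_faces ms. card \<sigma> = i \<and> mdeg (face_lcm ms \<sigma>) = \<alpha>}"

text \<open>The pruned resolution has \<open>pruned_rank ms i \<alpha>\<close> generators of multidegree \<open>\<alpha>\<close> in homological
  degree \<open>i\<close>; it is minimal when these numbers are the Betti numbers of \<open>R/I\<close>.\<close>

definition min_pruned_order :: "'v set \<Rightarrow> ('v, 'k::field) mpoly set \<Rightarrow> 'v expo list \<Rightarrow> bool" where
  "min_pruned_order V I ms \<longleftrightarrow>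
     distinct ms \<and> set ms = min_gens I \<and> (\<forall>i \<alpha>. pruned_rank ms i \<alpha> = betti_quot V I i \<alpha>)"

definition betti_splitting ::
    "'v set \<Rightarrow> ('v, 'k::field) mpoly set \<Rightarrow> ('v, 'k) mpoly set \<Rightarrow> ('v, 'k) mpoly set \<Rightarrow> bool" where
  "betti_splitting V I J K \<longleftrightarrow>
     monomial_ideal V I \<and> monomial_ideal V J \<and> monomial_ideal V K \<and>
     I = {f + g | f g. f \<in> J \<and> g \<in> K} \<and>
     min_gens I = min_gens J \<union> min_gens K \<and> min_gens J \<inter> min_gens K = {} \<and>
     (\<forall>i \<alpha>. betti_ideal V I i \<alpha> =
        betti_ideal V J i \<alpha> + betti_ideal V K i \<alpha> +
        (if i = 0 then 0 else betti_ideal V (J \<inter> K) (i - 1) \<alpha>))"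

inductive admits_min_pruned :: "'v set \<Rightarrow> ('v, 'k::field) mpoly set \<Rightarrow> bool"
  for V :: "'v set" where
  order: "\<lbrakk>monomial_ideal V I; min_pruned_order V I ms\<rbrakk> \<Longrightarrow> admits_min_pruned V I"
| splitting: "\<lbrakk>betti_splitting V I J K; admits_min_pruned V J; admits_min_pruned V K;
     admits_min_pruned V (J \<inter> K)\<rbrakk> \<Longrightarrow> admits_min_pruned V I"


section \<open>Edge ideals\<close>

text \<open>A simple graph on the vertex set \<open>V\<close> is given by its set of edges, two-element subsets of \<open>V\<close>.\<close>

definition simple_graph :: "'v set \<Rightarrow> 'v set set \<Rightarrow> bool" where
  "simple_graph V E \<longleftrightarrow> (\<forall>e\<in>E. e \<subseteq> V \<and> card e = 2)"

definition nbrs :: "'v set set \<Rightarrow> 'v \<Rightarrow> 'v set" where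
  "nbrs E v = {w. {v, w} \<in> E}"

definition delete_vertex :: "'v set set \<Rightarrow> 'v \<Rightarrow> 'v set set" where
  "delete_vertex E v = {e \<in> E. v \<notin> e}"

definition edge_ideal :: "'v set \<Rightarrow> 'v set set \<Rightarrow> ('v, 'k::field) mpoly set" where
  "edge_ideal V E = ideal_gen V {mon (xvar i + xvar j) | i j. {i, j} \<in> E}"

text \<open>\<open>I(H_{k_1,...,k_m})\<close> as an ideal of \<open>poly_ring W\<close>, for \<open>ks = {k_1,...,k_m}\<close>, where \<open>u\<close> is the
  vertex \<open>x_n\<close>; a choice of \<open>x_{l_t} \<in> N(x_{k_t}) - {u}\<close> is a function \<open>l\<close> on \<open>ks\<close>.\<close>

definition H_ideal ::
    "'v set \<Rightarrow> 'v set set \<Rightarrow> 'v \<Rightarrow> 'v set \<Rightarrow> ('v, 'k::field) mpoly set" where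
  "H_ideal W E u ks = ideal_gen W
     ({mon (xvar i + xvar j) | i j. {i, j} \<in> E \<and> i \<in> W \<and> j \<in> W \<and>
         i \<notin> (\<Inter>k\<in>ks. nbrs E k) \<and> j \<notin> (\<Inter>k\<in>ks. nbrs E k)} \<union>
      {mon (mon_lcm ((\<lambda>k. xvar (l k)) ` ks)) | l. \<forall>k\<in>ks. l k \<in> nbrs E k - {u}})"

end

theory Submission
  imports Defs
begin

text \<open>Both splittings used are forced by multidegrees: if the lcm of the generators of \<open>J\<close> is not in
  \<open>K\<close> and vice versa, then no multidegree of the minimal resolution of \<open>J \<inter> K\<close> occurs in those of \<open>J\<close>
  and \<open>K\<close>, so the mapping cone of the comparison maps resolves \<open>J + K\<close> minimally. This applies
  to \<open>I = x\<^sub>n J + K\<close>, because every edge of \<open>K\<close> has a vertex outside \<open>{x\<^sub>1, \<dots>, x\<^sub>s}\<close>. Here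
  \<open>x\<^sub>n J \<inter> K = \<Sum>\<^sub>k x\<^sub>k (x\<^sub>n I(H\<^sub>k))\<close>; splitting off one \<open>x\<^sub>k\<close> at a time leaves only multiples of
  intersections of the ideals \<open>I(H\<^sub>k)\<close>, which are the ideals \<open>I(H_{k_1,...,k_m})\<close>. Since the resolutions
  are multigraded, all of this is linear algebra over the field, one multidegree at a time.\<close>

text \<open>\<open>betti\<close> is a definite description, so an equation between Betti numbers
  says something only once minimal resolutions are known to exist and to have equal graded ranks.
  Existence is by iterated syzygies. Each step is finitely generated because of a bound
  \<open>N\<close>, the lcm of the generators: a nonzero syzygy in degree \<alpha> already lives in
  degree \<open>inf \<alpha> N\<close>, so the finitely many degrees between 0 and \<open>N\<close>
  suffice, and the same \<open>N\<close> serves the next syzygies. Hence all degrees of the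
  resolution divide \<open>N\<close>, which is what the splitting criterion exploits.

  The given ideals live in different rings, so a transfer result carries whole derivations of
  \<open>admits_min_pruned\<close> along an extension of the ring and a multiplication by a monomial
  in new variables. One result on sums of x_i L_i then serves twice: with every L_i equal to (x_n)
  it gives x_n J, with L_i = x_n I(H_i) the intersection. In the second case a monomial divisible by
  x_i need not lie in the summand of i: if an edge of K dividing it contains another neighbor a of
  x_n, the summand of a is the right one.\<close>

abbreviation lookup :: "('a \<Rightarrow>\<^sub>0 'b::zero) \<Rightarrow> 'a \<Rightarrow> 'b" where
  "lookup \<equiv> Poly_Mapping.lookup"

abbreviation keys :: "('a \<Rightarrow>\<^sub>0 'b::zero) \<Rightarrow> 'a set" where
  "keys \<equiv> Poly_Mapping.keys"

section \<open>Strands of multigraded complexes\<close>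

definition vdeg :: "'v set \<Rightarrow> ('v \<Rightarrow> int) set" where
  "vdeg V = {\<alpha>. \<forall>v. v \<notin> V \<longrightarrow> \<alpha> v = 0}"

definition mv :: "'b set \<Rightarrow> ('a \<Rightarrow> 'b \<Rightarrow> 'k::field) \<Rightarrow> ('b \<Rightarrow> 'k) \<Rightarrow> 'a \<Rightarrow> 'k" where
  "mv X M x = (\<lambda>a. \<Sum>b\<in>X. M a b * x b)"

text \<open>A homogeneous element of degree \<alpha> in the free module on \<open>X\<close> has, at
  the basis element \<open>b\<close>, a scalar times the monomial of degree \<alpha> minus
  \<open>g b\<close>, which exists only if \<open>g b\<close> divides \<alpha>. The strand keeps
  these scalars; multiplication by a monomial becomes the inclusion
  \<open>strand_mono\<close>.\<close>

definition strand :: "'b set \<Rightarrow> ('b \<Rightarrow> 'd::order) \<Rightarrow> 'd \<Rightarrow> ('b \<Rightarrow> 'k::field) set" where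
  "strand X g \<alpha> = {x. \<forall>b. x b \<noteq> 0 \<longrightarrow> b \<in> X \<and> g b \<le> \<alpha>}"

lemma strandI: "(\<And>b. x b \<noteq> 0 \<Longrightarrow> b \<in> X \<and> g b \<le> \<alpha>) \<Longrightarrow> x \<in> strand X g \<alpha>"
  by (auto simp: strand_def)

lemma strandD: "x \<in> strand X g \<alpha> \<Longrightarrow> x b \<noteq> 0 \<Longrightarrow> b \<in> X \<and> g b \<le> \<alpha>"
  by (auto simp: strand_def)

lemma zero_in_strand [simp]: "(\<lambda>_. 0) \<in> strand X g \<alpha>"
  by (simp add: strand_def)

lemma strand_add: "x \<in> strand X g \<alpha> \<Longrightarrow> y \<in> strand X g \<alpha> \<Longrightarrow> (\<lambda>b. x b + y b) \<in> strand X g \<alpha>"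
  by (rule strandI) (metis add.right_neutral strandD)

lemma strand_uminus: "x \<in> strand X g \<alpha> \<Longrightarrow> (\<lambda>b. - x b) \<in> strand X g \<alpha>"
  unfolding strand_def by auto

lemma strand_diff: "x \<in> strand X g \<alpha> \<Longrightarrow> y \<in> strand X g \<alpha> \<Longrightarrow> (\<lambda>b. x b - y b) \<in> strand X g \<alpha>"
  using strand_add[OF _ strand_uminus, of x X g \<alpha> y] by simp

lemma strand_scale: "x \<in> strand X g \<alpha> \<Longrightarrow> (\<lambda>b. c * x b) \<in> strand X g \<alpha>"
  unfolding strand_def by auto

lemma strand_mono: "x \<in> strand X g \<alpha> \<Longrightarrow> \<alpha> \<le> \<beta> \<Longrightarrow> x \<in> strand X g \<beta>"
  by (rule strandI) (blast dest: strandD intro: order_trans)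

lemma mv_strand:
  assumes "\<And>a b. b \<in> X \<Longrightarrow> M a b \<noteq> 0 \<Longrightarrow> a \<in> Y \<and> h a \<le> g b" and "x \<in> strand X g \<alpha>"
  shows "mv X M x \<in> strand Y h \<alpha>"
proof (rule strandI)
  fix a assume "mv X M x a \<noteq> 0"
  then obtain b where "b \<in> X" "M a b * x b \<noteq> 0"
    unfolding mv_def by (meson sum.neutral)
  then show "a \<in> Y \<and> h a \<le> \<alpha>"
    using assms(1)[of b a] strandD[OF assms(2), of b] order_trans[of "h a" "g b" \<alpha>] by auto
qed

lemma mv_zero [simp]: "mv X M (\<lambda>_. 0) = (\<lambda>_. 0)"
  by (simp add: mv_def)

lemma mv_add: "mv X M (\<lambda>b. x b + y b) = (\<lambda>a. mv X M x a + mv X M y a)"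
  by (simp add: mv_def ring_distribs sum.distrib)

lemma mv_diff: "mv X M (\<lambda>b. x b - y b) = (\<lambda>a. mv X M x a - mv X M y a)"
  by (simp add: mv_def ring_distribs sum_subtractf)

lemma mv_uminus: "mv X M (\<lambda>b. - x b) = (\<lambda>a. - mv X M x a)"
  by (simp add: mv_def sum_negf)

lemma mv_scale: "mv X M (\<lambda>b. c * x b) = (\<lambda>a. c * mv X M x a)"
  by (simp add: mv_def sum_distrib_left mult.left_commute)

text \<open>The product matrix is written column by column, because chain conditions such as
  \<open>d_d\<close> are stated for columns and can then be rewritten inside it.\<close>

lemma mv_mv: "mv X M (mv Y N x) = mv Y (\<lambda>a b. mv X M (\<lambda>c. N c b) a) x"
proof
  fix a
  have "mv X M (mv Y N x) a = (\<Sum>c\<in>X. \<Sum>b\<in>Y. M a c * N c b * x b)"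
    by (simp add: mv_def sum_distrib_left mult.assoc)
  also have "\<dots> = (\<Sum>b\<in>Y. \<Sum>c\<in>X. M a c * N c b * x b)" by (rule sum.swap)
  also have "\<dots> = mv Y (\<lambda>a b. mv X M (\<lambda>c. N c b) a) x a"
    by (simp add: mv_def sum_distrib_right)
  finally show "mv X M (mv Y N x) a = mv Y (\<lambda>a b. mv X M (\<lambda>c. N c b) a) x a" .
qed

lemma mv_unit:
  assumes "finite X" "b \<in> X"
  shows "mv X M (\<lambda>c. if c = b then 1 else 0) = (\<lambda>a. M a b)"
proof
  fix a
  have "mv X M (\<lambda>c. if c = b then 1 else 0) a = (\<Sum>c\<in>X. if c = b then M a c else 0)"
    unfolding mv_def by (intro sum.cong) auto
  then show "mv X M (\<lambda>c. if c = b then 1 else 0) a = M a b" using assms by simp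
qed

lemma unit_strand: "b \<in> X \<Longrightarrow> (\<lambda>c. if c = b then 1 else 0) \<in> strand X g (g b)"
  by (rule strandI) (auto split: if_splits)

section \<open>Linear algebra: more unknowns than equations, and left inverses\<close>

lemma homogeneous_system_solution:
  fixes P :: "'c \<Rightarrow> 'b \<Rightarrow> 'k::field"
  assumes "finite Y" "finite X" "card Y < card X"
  shows "\<exists>x. (\<exists>b\<in>X. x b \<noteq> 0) \<and> (\<forall>c\<in>Y. (\<Sum>b\<in>X. P c b * x b) = 0)"
  using assms
proof (induction Y arbitrary: X P rule: finite_induct)
  case empty
  then obtain b where "b \<in> X" by fastforce
  then show ?case by (intro exI[of _ "\<lambda>_. 1"]) auto
next
  case (insert c Y)
  show ?case
  proof (cases "\<exists>b\<in>X. P c b \<noteq> 0")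
    case False
    from insert have "card Y < card X" by simp
    with insert obtain x where "\<exists>b\<in>X. x b \<noteq> 0" "\<forall>c\<in>Y. (\<Sum>b\<in>X. P c b * x b) = 0" by blast
    with False show ?thesis by (intro exI[of _ x]) auto
  next
    case True
    then obtain b0 where b0: "b0 \<in> X" "P c b0 \<noteq> 0" by blast
    define X' where "X' = X - {b0}"
    \<comment> \<open>The system after Gaussian elimination of the unknown \<open>b0\<close> by
      means of equation \<open>c\<close>, whose pivot is \<open>P c b0\<close>.\<close>
    define P' where "P' = (\<lambda>c' b. P c' b - P c' b0 * P c b / P c b0)"
    have fin: "finite X'" "b0 \<notin> X'" "X = insert b0 X'" using insert.prems b0 by (auto simp: X'_def)
    then have "card Y < card X'" using insert.prems insert.hyps by simp
    from insert.IH[OF fin(1) this, of P'] obtain x where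
      x: "\<exists>b\<in>X'. x b \<noteq> 0" "\<forall>c'\<in>Y. (\<Sum>b\<in>X'. P' c' b * x b) = 0" by blast
    define s where "s = (\<Sum>b\<in>X'. P c b * x b)"
    \<comment> \<open>The value at \<open>b0\<close> is the one that equation \<open>c\<close>
      forces.\<close>
    define x' where "x' = x(b0 := - s / P c b0)"
    have eq: "(\<Sum>b\<in>X. P c' b * x' b) = (\<Sum>b\<in>X'. P c' b * x b) - P c' b0 * s / P c b0" for c'
    proof -
      have "(\<Sum>b\<in>X'. P c' b * x' b) = (\<Sum>b\<in>X'. P c' b * x b)"
        using fin by (intro sum.cong) (auto simp: x'_def)
      then show ?thesis using fin by (simp add: x'_def)
    qed
    have "(\<Sum>b\<in>X. P c' b * x' b) = 0" if "c' \<in> Y" for c'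
    proof -
      have "(\<Sum>b\<in>X'. P' c' b * x b) = (\<Sum>b\<in>X'. P c' b * x b) - P c' b0 * s / P c b0"
        unfolding P'_def s_def by (simp add: left_diff_distrib sum_subtractf sum_distrib_left
            sum_divide_distrib mult.assoc)
      then show ?thesis using x(2) that eq by simp
    qed
    moreover have "(\<Sum>b\<in>X. P c b * x' b) = 0" using eq[of c] b0 by (simp add: s_def)
    moreover have "\<exists>b\<in>X. x' b \<noteq> 0" using x(1) fin by (auto simp: x'_def)
    ultimately show ?thesis by (intro exI[of _ x']) auto
  qed
qed

text \<open>If \<open>X\<close> were larger, \<open>P\<close> would have a nonzero kernel vector,
  and applying \<open>Q\<close> to its zero image would return that vector.\<close>

lemma card_le_of_left_inverse:
  fixes P :: "'c \<Rightarrow> 'b \<Rightarrow> 'k::field"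
  assumes "finite X" "finite Y"
    and QP: "\<And>a b. a \<in> X \<Longrightarrow> b \<in> X \<Longrightarrow> (\<Sum>c\<in>Y. Q a c * P c b) = (if a = b then 1 else 0)"
  shows "card X \<le> card Y"
proof (rule ccontr)
  assume "\<not> ?thesis"
  then obtain x where x: "\<exists>b\<in>X. x b \<noteq> 0" "\<forall>c\<in>Y. (\<Sum>b\<in>X. P c b * x b) = 0"
    using homogeneous_system_solution[OF assms(2,1), of P] by auto
  then obtain a where a: "a \<in> X" "x a \<noteq> 0" by blast
  have "0 = (\<Sum>c\<in>Y. Q a c * (\<Sum>b\<in>X. P c b * x b))" using x(2) by simp
  also have "\<dots> = (\<Sum>c\<in>Y. \<Sum>b\<in>X. Q a c * P c b * x b)"
    by (simp add: sum_distrib_left mult.assoc)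
  also have "\<dots> = (\<Sum>b\<in>X. \<Sum>c\<in>Y. Q a c * P c b * x b)" by (rule sum.swap)
  also have "\<dots> = (\<Sum>b\<in>X. (if a = b then 1 else 0) * x b)"
    using a QP by (simp add: sum_distrib_right[symmetric])
  also have "\<dots> = (\<Sum>b\<in>X. if a = b then x b else 0)" by (intro sum.cong) auto
  also have "\<dots> = x a" using a assms(1) by simp
  finally show False using a by simp
qed

section \<open>Minimal resolutions in terms of scalars\<close>

text \<open>A minimal \<open>\<int>^V\<close>-graded free resolution of \<open>M/N\<close>, for monomial ideals \<open>N \<subseteq> M\<close> whose exponents
  form \<open>Q \<subseteq> A\<close>. Since a homogeneous polynomial is a scalar times a monomial, only the scalars
  \<open>d i a b\<close> and \<open>\<epsilon> b\<close> are kept, and exactness is required in each multidegree. Minimality says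
  that nonzero entries of the differential strictly increase the degree.\<close>

locale scalar_res =
  fixes V :: "'v set" and A Q :: "('v \<Rightarrow> int) set"
    and B :: "nat \<Rightarrow> 'b set" and deg :: "nat \<Rightarrow> 'b \<Rightarrow> 'v \<Rightarrow> int"
    and d :: "nat \<Rightarrow> 'b \<Rightarrow> 'b \<Rightarrow> 'k::field" and \<epsilon> :: "'b \<Rightarrow> 'k"
  assumes A_vdeg: "A \<subseteq> vdeg V"
    and A_up: "\<alpha> \<in> A \<Longrightarrow> \<beta> \<in> vdeg V \<Longrightarrow> \<alpha> \<le> \<beta> \<Longrightarrow> \<beta> \<in> A"
    and Q_up: "\<alpha> \<in> Q \<Longrightarrow> \<beta> \<in> vdeg V \<Longrightarrow> \<alpha> \<le> \<beta> \<Longrightarrow> \<beta> \<in> Q"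
    and finite_B: "finite (B i)"
    and deg_vdeg: "b \<in> B i \<Longrightarrow> deg i b \<in> vdeg V"
    and d_nz: "d i a b \<noteq> 0 \<Longrightarrow> a \<in> B i \<and> b \<in> B (Suc i) \<and> deg i a < deg (Suc i) b"
    and \<epsilon>_nz: "\<epsilon> b \<noteq> 0 \<Longrightarrow> b \<in> B 0 \<and> deg 0 b \<in> A"
    and surj: "\<alpha> \<in> A \<Longrightarrow> \<alpha> \<notin> Q \<Longrightarrow> \<exists>x\<in>strand (B 0) (deg 0) \<alpha>. (\<Sum>b\<in>B 0. \<epsilon> b * x b) = 1"
    and exact0: "\<alpha> \<in> vdeg V \<Longrightarrow> x \<in> strand (B 0) (deg 0) \<alpha> \<Longrightarrow>
      (\<alpha> \<notin> Q \<longrightarrow> (\<Sum>b\<in>B 0. \<epsilon> b * x b) = 0) \<longleftrightarrow>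
      (\<exists>y\<in>strand (B 1) (deg 1) \<alpha>. x = mv (B 1) (d 0) y)"
    and exact_Suc: "\<alpha> \<in> vdeg V \<Longrightarrow> x \<in> strand (B (Suc i)) (deg (Suc i)) \<alpha> \<Longrightarrow>
      mv (B (Suc i)) (d i) x = (\<lambda>_. 0) \<longleftrightarrow>
      (\<exists>y\<in>strand (B (Suc (Suc i))) (deg (Suc (Suc i))) \<alpha>. x = mv (B (Suc (Suc i))) (d (Suc i)) y)"
begin

lemma d_col_strand: "(\<lambda>a. d i a b) \<in> strand (B i) (deg i) (deg (Suc i) b)"
  by (rule strandI) (use d_nz in fastforce)

lemma mv_d_strand:
  "x \<in> strand (B (Suc i)) (deg (Suc i)) \<alpha> \<Longrightarrow> mv (B (Suc i)) (d i) x \<in> strand (B i) (deg i) \<alpha>"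
  by (erule mv_strand[rotated]) (use d_nz in fastforce)

lemma d_col_eq_mv: "b \<in> B (Suc i) \<Longrightarrow>
   (\<lambda>a. d i a b) = mv (B (Suc i)) (d i) (\<lambda>c. if c = b then 1 else 0)"
  by (simp add: mv_unit finite_B)

lemma d_outside: "b \<notin> B (Suc i) \<Longrightarrow> (\<lambda>a. d i a b) = (\<lambda>_. 0)"
  by (rule ext) (metis d_nz)

lemma d_col_boundary:
  assumes "b \<in> B (Suc i)"
  shows "\<exists>y\<in>strand (B (Suc i)) (deg (Suc i)) (deg (Suc i) b). (\<lambda>a. d i a b) = mv (B (Suc i)) (d i) y"
proof (rule bexI)
  show "(\<lambda>a. d i a b) = mv (B (Suc i)) (d i) (\<lambda>c. if c = b then 1 else 0)"
    using assms by (rule d_col_eq_mv)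
qed (rule unit_strand[OF assms])

text \<open>A column of \<open>d\<close> is the image of a unit vector, hence a boundary. Exactness
  is assumed as an equivalence, so it also says that boundaries are cycles.\<close>

lemma d_d: "mv (B (Suc i)) (d i) (\<lambda>a. d (Suc i) a b) = (\<lambda>_. 0)"
proof (cases "b \<in> B (Suc (Suc i))")
  case True
  show ?thesis
    by (rule exact_Suc[OF deg_vdeg[OF True] d_col_strand, THEN iffD2]) (rule d_col_boundary[OF True])
next
  case False
  show ?thesis unfolding d_outside[OF False] by (rule mv_zero)
qed

text \<open>In degrees of \<open>Q\<close> the module that is resolved has zero component and
  \<open>exact0\<close> says nothing about \<epsilon>; hence the restriction on the degree of
  \<open>b\<close>.\<close>

lemma \<epsilon>_d:
  assumes "b \<in> B 1" "deg 1 b \<notin> Q"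
  shows "(\<Sum>a\<in>B 0. \<epsilon> a * d 0 a b) = 0"
proof -
  have b: "b \<in> B (Suc 0)" using assms by simp
  have "deg 1 b \<notin> Q \<longrightarrow> (\<Sum>a\<in>B 0. \<epsilon> a * d 0 a b) = 0"
    using exact0[of "deg 1 b" "\<lambda>a. d 0 a b"] deg_vdeg[OF b] d_col_strand[of 0 b] d_col_boundary[OF b]
    unfolding One_nat_def by blast
  with assms(2) show ?thesis by simp
qed

text \<open>By minimality only basis elements of degree strictly above \<open>deg i b\<close> can
  hit \<open>b\<close>, and none of those lies in the strand at \<open>deg i b\<close>.\<close>

lemma unit_not_boundary:
  assumes "b \<in> B i" "y \<in> strand (B (Suc i)) (deg (Suc i)) (deg i b)"
  shows "mv (B (Suc i)) (d i) y b = 0"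
  unfolding mv_def
proof (rule sum.neutral, rule)
  fix c assume "c \<in> B (Suc i)"
  show "d i b c * y c = 0"
    using d_nz[of i b c] strandD[OF assms(2), of c] leD mult_eq_0_iff by metis
qed

text \<open>A basis element killed by the differential or by \<epsilon> would give a unit vector
  that is a cycle, hence a boundary, contrary to \<open>unit_not_boundary\<close>. So each basis
  element lies above one of the previous homological degree, and those with nonzero \<epsilon> start
  in \<open>A\<close>.\<close>

lemma deg_in_A:
  assumes "Q = {}" "b \<in> B i"
  shows "deg i b \<in> A"
  using assms(2)
proof (induction i arbitrary: b)
  case 0
  have "\<epsilon> b \<noteq> 0"
  proof
    assume "\<epsilon> b = 0"
    then have "(\<Sum>c\<in>B 0. \<epsilon> c * (if c = b then 1 else 0)) = 0" by (simp add: sum.neutral)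
    then obtain y where "y\<in>strand (B 1) (deg 1) (deg 0 b)" "(\<lambda>c. if c = b then 1 else 0) = mv (B 1) (d 0) y"
      using exact0[OF deg_vdeg[OF 0] unit_strand[OF 0]] by auto
    then show False using unit_not_boundary[OF 0, of y] by (auto dest: fun_cong[of _ _ b])
  qed
  then show ?case using \<epsilon>_nz by blast
next
  case (Suc i)
  have "\<exists>a. d i a b \<noteq> 0"
  proof (rule ccontr)
    assume "\<nexists>a. d i a b \<noteq> 0"
    then have "mv (B (Suc i)) (d i) (\<lambda>c. if c = b then 1 else 0) = (\<lambda>_. 0)"
      using d_col_eq_mv[OF Suc.prems] by simp
    then obtain y where "y\<in>strand (B (Suc (Suc i))) (deg (Suc (Suc i))) (deg (Suc i) b)"
       "(\<lambda>c. if c = b then 1 else 0) = mv (B (Suc (Suc i))) (d (Suc i)) y"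
      using exact_Suc[OF deg_vdeg[OF Suc.prems] unit_strand[OF Suc.prems]] by auto
    then show False using unit_not_boundary[OF Suc.prems, of y] by (auto dest: fun_cong[of _ _ b])
  qed
  then show ?case using Suc.IH d_nz deg_vdeg[OF Suc.prems] A_up by (metis less_imp_le)
qed

end

section \<open>Comparison and uniqueness\<close>

text \<open>The source is free, so each column of \<open>f\<close> may be any preimage of what the
  chain condition prescribes, and exactness of the target supplies one in the right strand. It lifts
  the inclusion of the quotient given by \<open>A\<close> and \<open>Q\<close> into the one given by
  \<open>A'\<close> and \<open>Q\<close>. Uniqueness of Betti numbers uses \<open>A' = A\<close>,
  the mapping cone uses \<open>Q = {}\<close>.\<close>

lemma comparison_map:
  fixes d :: "nat \<Rightarrow> 'b \<Rightarrow> 'b \<Rightarrow> 'k::field" and d' :: "nat \<Rightarrow> 'c \<Rightarrow> 'c \<Rightarrow> 'k"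
  assumes "scalar_res V A Q B deg d \<epsilon>" and "scalar_res V A' Q B' deg' d' \<epsilon>'" and "A \<subseteq> A'"
  obtains f :: "nat \<Rightarrow> 'c \<Rightarrow> 'b \<Rightarrow> 'k" where
    "\<And>i c b. f i c b \<noteq> 0 \<Longrightarrow> c \<in> B' i \<and> b \<in> B i \<and> deg' i c \<le> deg i b"
    "\<And>b. b \<in> B 0 \<Longrightarrow> deg 0 b \<notin> Q \<Longrightarrow> (\<Sum>c\<in>B' 0. \<epsilon>' c * f 0 c b) = \<epsilon> b"
    "\<And>i b. mv (B' (Suc i)) (d' i) (\<lambda>c. f (Suc i) c b) = mv (B i) (f i) (\<lambda>a. d i a b)"
proof -
  interpret F: scalar_res V A Q B deg d \<epsilon> by fact
  interpret G: scalar_res V A' Q B' deg' d' \<epsilon>' by fact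
  define supp where "supp = (\<lambda>i (f :: 'c \<Rightarrow> 'b \<Rightarrow> 'k).
     \<forall>c b. f c b \<noteq> 0 \<longrightarrow> c \<in> B' i \<and> b \<in> B i \<and> deg' i c \<le> deg i b)"
  \<comment> \<open>Solvability of the equations for the next map; carrying it as an invariant makes
    the construction a dependent choice.\<close>
  define lifts where "lifts = (\<lambda>i (f :: 'c \<Rightarrow> 'b \<Rightarrow> 'k). \<forall>b\<in>B (Suc i).
     \<exists>y\<in>strand (B' (Suc i)) (deg' (Suc i)) (deg (Suc i) b).
       mv (B i) f (\<lambda>a. d i a b) = mv (B' (Suc i)) (d' i) y)"
  define aug where "aug = (\<lambda>f :: 'c \<Rightarrow> 'b \<Rightarrow> 'k. \<forall>b\<in>B 0. deg 0 b \<notin> Q \<longrightarrow> (\<Sum>c\<in>B' 0. \<epsilon>' c * f c b) = \<epsilon> b)"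
  have str: "mv (B i) f x \<in> strand (B' i) (deg' i) \<alpha>" if "supp i f" "x \<in> strand (B i) (deg i) \<alpha>" for i f x \<alpha>
    by (rule mv_strand[OF _ that(2)]) (use that(1) in \<open>auto simp: supp_def\<close>)
  have "\<exists>f. \<forall>i. (supp i (f i) \<and> lifts i (f i) \<and> (i = 0 \<longrightarrow> aug (f i))) \<and>
       (\<forall>b. mv (B' (Suc i)) (d' i) (\<lambda>c. f (Suc i) c b) = mv (B i) (f i) (\<lambda>a. d i a b))"
  proof (rule dependent_nat_choice)
    have "\<exists>y\<in>strand (B' 0) (deg' 0) (deg 0 b). deg 0 b \<notin> Q \<longrightarrow> (\<Sum>c\<in>B' 0. \<epsilon>' c * y c) = \<epsilon> b" if b: "b \<in> B 0" for b
    proof (cases "deg 0 b \<in> Q \<or> \<epsilon> b = 0")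
      case True
      then show ?thesis by (intro bexI[of _ "\<lambda>_. 0"]) auto
    next
      case False
      then have "deg 0 b \<in> A'" using F.\<epsilon>_nz assms(3) by blast
      with False obtain x where x: "x \<in> strand (B' 0) (deg' 0) (deg 0 b)" "(\<Sum>c\<in>B' 0. \<epsilon>' c * x c) = 1"
        using G.surj by blast
      have "(\<Sum>c\<in>B' 0. \<epsilon>' c * (\<epsilon> b * x c)) = \<epsilon> b * (\<Sum>c\<in>B' 0. \<epsilon>' c * x c)"
        by (simp add: sum_distrib_left mult.left_commute)
      with x show ?thesis by (intro bexI[of _ "\<lambda>c. \<epsilon> b * x c"]) (auto intro: strand_scale)
    qed
    then obtain y where y: "\<And>b. b \<in> B 0 \<Longrightarrow> y b \<in> strand (B' 0) (deg' 0) (deg 0 b)"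
      "\<And>b. b \<in> B 0 \<Longrightarrow> deg 0 b \<notin> Q \<Longrightarrow> (\<Sum>c\<in>B' 0. \<epsilon>' c * y b c) = \<epsilon> b" by metis
    define f where "f = (\<lambda>c b. if b \<in> B 0 then y b c else 0)"
    have s: "supp 0 f" unfolding supp_def f_def using strandD[OF y(1)] by auto
    have a: "aug f" unfolding aug_def f_def using y(2) by simp
    have "lifts 0 f" unfolding lifts_def
    proof
      fix b assume b: "b \<in> B (Suc 0)"
      let ?z = "mv (B 0) f (\<lambda>a. d 0 a b)"
      have "(\<Sum>c\<in>B' 0. \<epsilon>' c * ?z c) = 0" if nq: "deg 1 b \<notin> Q"
      proof -
        have *: "(\<Sum>c\<in>B' 0. \<epsilon>' c * f c a) * d 0 a b = \<epsilon> a * d 0 a b" if "a \<in> B 0" for a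
        proof (cases "d 0 a b = 0")
          case False
          then have "deg 0 a \<le> deg 1 b" using F.d_nz by fastforce
          \<comment> \<open>Since \<open>Q\<close> is closed upwards, every \<open>a\<close> that
            occurs in the column of \<open>b\<close> has its degree outside \<open>Q\<close>, where
            the augmentation condition on \<open>f\<close> holds.\<close>
          then have "deg 0 a \<notin> Q" using nq F.Q_up F.deg_vdeg[OF b] by auto
          then show ?thesis using a that by (simp add: aug_def)
        qed simp
        have "(\<Sum>c\<in>B' 0. \<epsilon>' c * ?z c) = (\<Sum>c\<in>B' 0. \<Sum>a\<in>B 0. \<epsilon>' c * f c a * d 0 a b)"
          by (simp add: mv_def sum_distrib_left mult.assoc)
        also have "\<dots> = (\<Sum>a\<in>B 0. \<Sum>c\<in>B' 0. \<epsilon>' c * f c a * d 0 a b)" by (rule sum.swap)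
        also have "\<dots> = (\<Sum>a\<in>B 0. (\<Sum>c\<in>B' 0. \<epsilon>' c * f c a) * d 0 a b)"
          by (simp add: sum_distrib_right)
        also have "\<dots> = (\<Sum>a\<in>B 0. \<epsilon> a * d 0 a b)" using * by (intro sum.cong) auto
        also have "\<dots> = 0" using F.\<epsilon>_d[of b] b nq by simp
        finally show ?thesis .
      qed
      then show "\<exists>y\<in>strand (B' (Suc 0)) (deg' (Suc 0)) (deg (Suc 0) b). ?z = mv (B' (Suc 0)) (d' 0) y"
        using G.exact0[OF F.deg_vdeg[OF b] str[OF s F.d_col_strand]] by simp
    qed
    with s a show "\<exists>f. supp 0 f \<and> lifts 0 f \<and> (0 = 0 \<longrightarrow> aug f)" by blast
  next
    fix f i assume "supp i f \<and> lifts i f \<and> (i = 0 \<longrightarrow> aug f)"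
    then have s: "supp i f" and l: "lifts i f" by auto
    from l obtain y where y: "\<And>b. b \<in> B (Suc i) \<Longrightarrow> y b \<in> strand (B' (Suc i)) (deg' (Suc i)) (deg (Suc i) b)"
      "\<And>b. b \<in> B (Suc i) \<Longrightarrow> mv (B i) f (\<lambda>a. d i a b) = mv (B' (Suc i)) (d' i) (y b)"
      unfolding lifts_def by metis
    define f' where "f' = (\<lambda>c b. if b \<in> B (Suc i) then y b c else 0)"
    have s': "supp (Suc i) f'" unfolding supp_def f'_def using strandD[OF y(1)] by auto
    have c: "mv (B' (Suc i)) (d' i) (\<lambda>c. f' c b) = mv (B i) f (\<lambda>a. d i a b)" for b
    proof (cases "b \<in> B (Suc i)")
      case True then show ?thesis using y(2) by (simp add: f'_def)
    next
      case False
      then have "(\<lambda>a. d i a b) = (\<lambda>_. 0)" by (rule F.d_outside)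
      with False show ?thesis by (simp add: f'_def)
    qed
    have "lifts (Suc i) f'" unfolding lifts_def
    proof
      fix b assume b: "b \<in> B (Suc (Suc i))"
      let ?z = "mv (B (Suc i)) f' (\<lambda>a. d (Suc i) a b)"
      have "mv (B' (Suc i)) (d' i) ?z = mv (B i) f (mv (B (Suc i)) (d i) (\<lambda>a. d (Suc i) a b))"
        by (simp add: mv_mv c)
      then have "mv (B' (Suc i)) (d' i) ?z = (\<lambda>_. 0)" by (simp add: F.d_d)
      then show "\<exists>y\<in>strand (B' (Suc (Suc i))) (deg' (Suc (Suc i))) (deg (Suc (Suc i)) b).
          ?z = mv (B' (Suc (Suc i))) (d' (Suc i)) y"
        using G.exact_Suc[OF F.deg_vdeg[OF b] str[OF s' F.d_col_strand]] by simp
    qed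
    with s' c show "\<exists>f'. (supp (Suc i) f' \<and> lifts (Suc i) f' \<and> (Suc i = 0 \<longrightarrow> aug f')) \<and>
       (\<forall>b. mv (B' (Suc i)) (d' i) (\<lambda>c. f' c b) = mv (B i) f (\<lambda>a. d i a b))" by blast
  qed
  then obtain f where f: "\<And>i. supp i (f i)" "aug (f 0)"
    "\<And>i b. mv (B' (Suc i)) (d' i) (\<lambda>c. f (Suc i) c b) = mv (B i) (f i) (\<lambda>a. d i a b)" by blast
  show thesis
  proof (rule that)
    show "f i c b \<noteq> 0 \<Longrightarrow> c \<in> B' i \<and> b \<in> B i \<and> deg' i c \<le> deg i b" for i c b
      using f(1) by (auto simp: supp_def)
    show "b \<in> B 0 \<Longrightarrow> deg 0 b \<notin> Q \<Longrightarrow> (\<Sum>c\<in>B' 0. \<epsilon>' c * f 0 c b) = \<epsilon> b" for b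
      using f(2) by (auto simp: aug_def)
  qed (rule f(3))
qed

context scalar_res
begin

text \<open>A chain endomorphism over the zero map is null-homotopic, and by minimality a null-homotopic
  map has no unit entries.\<close>

lemma no_unit_entries_over_zero:
  assumes supp: "\<And>i a b. \<phi> i a b \<noteq> 0 \<Longrightarrow> a \<in> B i \<and> b \<in> B i \<and> deg i a \<le> deg i b"
    and aug: "\<And>b. b \<in> B 0 \<Longrightarrow> deg 0 b \<notin> Q \<Longrightarrow> (\<Sum>a\<in>B 0. \<epsilon> a * \<phi> 0 a b) = 0"
    and chain: "\<And>i b. mv (B (Suc i)) (d i) (\<lambda>c. \<phi> (Suc i) c b) = mv (B i) (\<phi> i) (\<lambda>a. d i a b)"
    and eq: "deg i a = deg i b"
  shows "\<phi> i a b = 0"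
proof -
  define hsupp where "hsupp = (\<lambda>i (h :: 'b \<Rightarrow> 'b \<Rightarrow> 'k).
     \<forall>c b. h c b \<noteq> 0 \<longrightarrow> c \<in> B (Suc i) \<and> b \<in> B i \<and> deg (Suc i) c \<le> deg i b)"
  \<comment> \<open>The homotopy \<open>h\<close> has to satisfy \<phi> = d h + h d; the invariant
    says that the next instance of this equation can be solved for the following map.\<close>
  define lifts where "lifts = (\<lambda>i (h :: 'b \<Rightarrow> 'b \<Rightarrow> 'k). \<forall>b\<in>B (Suc i).
     \<exists>y\<in>strand (B (Suc (Suc i))) (deg (Suc (Suc i))) (deg (Suc i) b).
       (\<lambda>a. \<phi> (Suc i) a b - mv (B i) h (\<lambda>a. d i a b) a) = mv (B (Suc (Suc i))) (d (Suc i)) y)"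
  define start where "start = (\<lambda>h :: 'b \<Rightarrow> 'b \<Rightarrow> 'k. \<forall>b. (\<lambda>a. \<phi> 0 a b) = mv (B (Suc 0)) (d 0) (\<lambda>c. h c b))"
  have str: "mv (B i) h x \<in> strand (B (Suc i)) (deg (Suc i)) \<alpha>"
    if "hsupp i h" "x \<in> strand (B i) (deg i) \<alpha>" for i h x \<alpha>
    by (rule mv_strand[OF _ that(2)]) (use that(1) in \<open>auto simp: hsupp_def\<close>)
  have \<phi>str: "(\<lambda>a. \<phi> i a b) \<in> strand (B i) (deg i) (deg i b)" for i b
    using supp by (intro strandI) auto
  have w: "(\<lambda>a. \<phi> (Suc i) a b - mv (B i) h (\<lambda>a. d i a b) a) \<in> strand (B (Suc i)) (deg (Suc i)) (deg (Suc i) b)"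
    if "hsupp i h" for i h b
    by (intro strand_diff \<phi>str str that d_col_strand)
  have "\<exists>h. \<forall>i. (hsupp i (h i) \<and> lifts i (h i) \<and> (i = 0 \<longrightarrow> start (h i))) \<and>
       (\<forall>b. (\<lambda>a. \<phi> (Suc i) a b - mv (B i) (h i) (\<lambda>a. d i a b) a) =
             mv (B (Suc (Suc i))) (d (Suc i)) (\<lambda>c. h (Suc i) c b))"
  proof (rule dependent_nat_choice)
    have "\<exists>y\<in>strand (B 1) (deg 1) (deg 0 b). (\<lambda>a. \<phi> 0 a b) = mv (B 1) (d 0) y" if b: "b \<in> B 0" for b
      using exact0[OF deg_vdeg[OF b] \<phi>str] aug[OF b] by simp
    then obtain y where y: "\<And>b. b \<in> B 0 \<Longrightarrow> y b \<in> strand (B 1) (deg 1) (deg 0 b)"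
      "\<And>b. b \<in> B 0 \<Longrightarrow> (\<lambda>a. \<phi> 0 a b) = mv (B 1) (d 0) (y b)" by metis
    define h where "h = (\<lambda>c b. if b \<in> B 0 then y b c else 0)"
    have s: "hsupp 0 h" unfolding hsupp_def h_def using strandD[OF y(1)] by auto
    have "(\<lambda>a. \<phi> 0 a b) = (\<lambda>_. 0)" if "b \<notin> B 0" for b
      using supp that by (intro ext) metis
    then have "(\<lambda>a. \<phi> 0 a b) = mv (B (Suc 0)) (d 0) (\<lambda>c. h c b)" for b
      using y(2)[of b] by (cases "b \<in> B 0") (simp_all add: h_def)
    then have st: "start h" by (simp add: start_def)
    have "lifts 0 h" unfolding lifts_def
    proof
      fix b assume b: "b \<in> B (Suc 0)"
      have "mv (B (Suc 0)) (d 0) (\<lambda>a. \<phi> (Suc 0) a b - mv (B 0) h (\<lambda>a. d 0 a b) a) = (\<lambda>_. 0)"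
        unfolding mv_diff mv_mv chain st[unfolded start_def, rule_format, symmetric] by simp
      then show "\<exists>y\<in>strand (B (Suc (Suc 0))) (deg (Suc (Suc 0))) (deg (Suc 0) b).
         (\<lambda>a. \<phi> (Suc 0) a b - mv (B 0) h (\<lambda>a. d 0 a b) a) = mv (B (Suc (Suc 0))) (d (Suc 0)) y"
        using exact_Suc[OF deg_vdeg[OF b] w[OF s]] by simp
    qed
    with s st show "\<exists>h. hsupp 0 h \<and> lifts 0 h \<and> (0 = 0 \<longrightarrow> start h)" by blast
  next
    fix h i assume "hsupp i h \<and> lifts i h \<and> (i = 0 \<longrightarrow> start h)"
    then have s: "hsupp i h" and l: "lifts i h" by auto
    from bchoice[OF l[unfolded lifts_def Bex_def]] obtain y where y: "\<And>b. b \<in> B (Suc i) \<Longrightarrow> y b \<in> strand (B (Suc (Suc i))) (deg (Suc (Suc i))) (deg (Suc i) b)"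
      "\<And>b. b \<in> B (Suc i) \<Longrightarrow> (\<lambda>a. \<phi> (Suc i) a b - mv (B i) h (\<lambda>a. d i a b) a) =
         mv (B (Suc (Suc i))) (d (Suc i)) (y b)"
      by auto
    define h' where "h' = (\<lambda>c b. if b \<in> B (Suc i) then y b c else 0)"
    have s': "hsupp (Suc i) h'" unfolding hsupp_def h'_def using strandD[OF y(1)] by auto
    have c: "(\<lambda>a. \<phi> (Suc i) a b - mv (B i) h (\<lambda>a. d i a b) a) =
         mv (B (Suc (Suc i))) (d (Suc i)) (\<lambda>c. h' c b)" for b
    proof (cases "b \<in> B (Suc i)")
      case True then show ?thesis using y(2) by (simp add: h'_def)
    next
      case False
      then have "(\<lambda>a. d i a b) = (\<lambda>_. 0)" by (rule d_outside)
      moreover have "\<phi> (Suc i) a b = 0" for a using supp False by metis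
      ultimately show ?thesis using False by (simp add: h'_def)
    qed
    have "lifts (Suc i) h'" unfolding lifts_def
    proof
      fix b assume b: "b \<in> B (Suc (Suc i))"
      let ?x = "\<lambda>a. d (Suc i) a b"
      \<comment> \<open>From d h' = \<phi> - h d, applied to a column of d, where h d d vanishes:
        \<phi> - h' d is again a cycle.\<close>
      have "mv (B (Suc (Suc i))) (d (Suc i)) (mv (B (Suc i)) h' ?x) =
         (\<lambda>a. mv (B (Suc i)) (\<phi> (Suc i)) ?x a - mv (B i) h (mv (B (Suc i)) (d i) ?x) a)"
        unfolding mv_mv c[symmetric] by (simp add: mv_def left_diff_distrib sum_subtractf fun_eq_iff)
      also have "\<dots> = mv (B (Suc i)) (\<phi> (Suc i)) ?x" by (simp add: d_d)
      finally have "mv (B (Suc (Suc i))) (d (Suc i))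
          (\<lambda>a. \<phi> (Suc (Suc i)) a b - mv (B (Suc i)) h' ?x a) = (\<lambda>_. 0)"
        unfolding mv_diff chain by simp
      then show "\<exists>y\<in>strand (B (Suc (Suc (Suc i)))) (deg (Suc (Suc (Suc i)))) (deg (Suc (Suc i)) b).
         (\<lambda>a. \<phi> (Suc (Suc i)) a b - mv (B (Suc i)) h' ?x a) = mv (B (Suc (Suc (Suc i)))) (d (Suc (Suc i))) y"
        using exact_Suc[OF deg_vdeg[OF b] w[OF s']] by simp
    qed
    with s' c show "\<exists>h'. (hsupp (Suc i) h' \<and> lifts (Suc i) h' \<and> (Suc i = 0 \<longrightarrow> start h')) \<and>
       (\<forall>b. (\<lambda>a. \<phi> (Suc i) a b - mv (B i) h (\<lambda>a. d i a b) a) =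
             mv (B (Suc (Suc i))) (d (Suc i)) (\<lambda>c. h' c b))" by blast
  qed
  then obtain h where h: "\<And>i. hsupp i (h i)" "start (h 0)"
    "\<And>i b. (\<lambda>a. \<phi> (Suc i) a b - mv (B i) (h i) (\<lambda>a. d i a b) a) =
         mv (B (Suc (Suc i))) (d (Suc i)) (\<lambda>c. h (Suc i) c b)" by blast
  \<comment> \<open>\<open>h\<close> respects degrees and entries of \<open>d\<close> raise them
    strictly, so neither d h nor h d has an entry between basis elements of equal degree.\<close>
  have dh: "mv (B (Suc i)) (d i) (\<lambda>c. h i c b) a = 0"
    unfolding mv_def
  proof (rule sum.neutral, rule)
    fix c show "d i a c * h i c b = 0"
      using d_nz[of i a c] h(1)[of i] eq unfolding hsupp_def by (metis leD mult_eq_0_iff)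
  qed
  show ?thesis
  proof (cases i)
    case 0
    then show ?thesis using h(2) dh unfolding start_def by (metis)
  next
    case (Suc j)
    have "mv (B j) (h j) (\<lambda>a. d j a b) a = 0"
      unfolding mv_def
    proof (rule sum.neutral, rule)
      fix c show "h j a c * d j c b = 0"
        using d_nz[of j c b] h(1)[of j] eq Suc unfolding hsupp_def by (metis leD mult_eq_0_iff)
    qed
    then show ?thesis using fun_cong[OF h(3)[of j b], of a] dh Suc by simp
  qed
qed

end

text \<open>Comparison maps in both directions compose to a map that differs from the identity by a
  map over zero. Between equal degrees the difference vanishes, so in degree \<alpha> the block of
  \<open>f\<close> has a left inverse.\<close>

lemma scalar_res_card_le:
  fixes d :: "nat \<Rightarrow> 'b \<Rightarrow> 'b \<Rightarrow> 'k::field" and d' :: "nat \<Rightarrow> 'c \<Rightarrow> 'c \<Rightarrow> 'k"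
  assumes F: "scalar_res V A Q B deg d \<epsilon>" and G: "scalar_res V A Q B' deg' d' \<epsilon>'"
  shows "card {b\<in>B i. deg i b = \<alpha>} \<le> card {c\<in>B' i. deg' i c = \<alpha>}"
proof -
  interpret F: scalar_res V A Q B deg d \<epsilon> by fact
  interpret G: scalar_res V A Q B' deg' d' \<epsilon>' by fact
  obtain f where f: "\<And>i c b. f i c b \<noteq> 0 \<Longrightarrow> c \<in> B' i \<and> b \<in> B i \<and> deg' i c \<le> deg i b"
    "\<And>b. b \<in> B 0 \<Longrightarrow> deg 0 b \<notin> Q \<Longrightarrow> (\<Sum>c\<in>B' 0. \<epsilon>' c * f 0 c b) = \<epsilon> b"
    "\<And>i b. mv (B' (Suc i)) (d' i) (\<lambda>c. f (Suc i) c b) = mv (B i) (f i) (\<lambda>a. d i a b)"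
    using comparison_map[OF F G] by blast
  obtain g where g: "\<And>i c b. g i c b \<noteq> 0 \<Longrightarrow> c \<in> B i \<and> b \<in> B' i \<and> deg i c \<le> deg' i b"
    "\<And>b. b \<in> B' 0 \<Longrightarrow> deg' 0 b \<notin> Q \<Longrightarrow> (\<Sum>c\<in>B 0. \<epsilon> c * g 0 c b) = \<epsilon>' b"
    "\<And>i b. mv (B (Suc i)) (d i) (\<lambda>c. g (Suc i) c b) = mv (B' i) (g i) (\<lambda>a. d' i a b)"
    using comparison_map[OF G F] by blast
  \<comment> \<open>The identity matrix, cut down to \<open>B i\<close> so that its support is that
    of a chain map.\<close>
  define one where "one = (\<lambda>i a b. if a = b \<and> a \<in> B i then 1 else 0 :: 'k)"
  define \<phi> where "\<phi> = (\<lambda>i a b. mv (B' i) (g i) (\<lambda>c. f i c b) a - one i a b)"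
  have one_mv: "mv (B i) (one i) x = x" if "x \<in> strand (B i) (deg i) \<beta>" for i x \<beta>
  proof
    fix a
    have "mv (B i) (one i) x a = (\<Sum>b\<in>B i. if a = b then x b else 0)"
      unfolding mv_def one_def by (intro sum.cong) auto
    also have "\<dots> = x a" using F.finite_B strandD[OF that, of a] by auto
    finally show "mv (B i) (one i) x a = x a" .
  qed
  have one_col: "(\<lambda>a. one i a b) \<in> strand (B i) (deg i) (deg i b)" for i b
    by (rule strandI) (auto simp: one_def split: if_splits)
  have gf: "(\<lambda>a. mv (B' i) (g i) (\<lambda>c. f i c b) a) \<in> strand (B i) (deg i) (deg i b)" for i b
    by (rule mv_strand[where g = "deg' i"]) (use g(1) f(1) in \<open>auto intro!: strandI\<close>)
  have \<phi>0: "\<phi> i a b = 0" if "deg i a = deg i b" for i a b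
  proof (rule F.no_unit_entries_over_zero[OF _ _ _ that])
    fix i a b assume "\<phi> i a b \<noteq> 0"
    then have ne: "mv (B' i) (g i) (\<lambda>c. f i c b) a \<noteq> 0 \<or> one i a b \<noteq> 0" by (auto simp: \<phi>_def)
    then have "a \<in> B i \<and> deg i a \<le> deg i b" using strandD[OF gf] strandD[OF one_col] by blast
    moreover have "b \<in> B i"
    proof (rule ccontr)
      assume b: "b \<notin> B i"
      then have "(\<lambda>c. f i c b) = (\<lambda>_. 0)" using f(1) by (intro ext) metis
      with ne b show False by (auto simp: one_def split: if_splits)
    qed
    ultimately show "a \<in> B i \<and> b \<in> B i \<and> deg i a \<le> deg i b" by blast
  next
    fix b assume b: "b \<in> B 0" "deg 0 b \<notin> Q"
    have "(\<Sum>a\<in>B 0. \<epsilon> a * mv (B' 0) (g 0) (\<lambda>c. f 0 c b) a) =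
        (\<Sum>a\<in>B 0. \<Sum>c\<in>B' 0. \<epsilon> a * g 0 a c * f 0 c b)"
      by (simp add: mv_def sum_distrib_left mult.assoc)
    also have "\<dots> = (\<Sum>c\<in>B' 0. \<Sum>a\<in>B 0. \<epsilon> a * g 0 a c * f 0 c b)" by (rule sum.swap)
    also have "\<dots> = (\<Sum>c\<in>B' 0. (\<Sum>a\<in>B 0. \<epsilon> a * g 0 a c) * f 0 c b)" by (simp add: sum_distrib_right)
    also have "\<dots> = (\<Sum>c\<in>B' 0. \<epsilon>' c * f 0 c b)"
    proof (intro sum.cong refl)
      fix c assume c: "c \<in> B' 0"
      show "(\<Sum>a\<in>B 0. \<epsilon> a * g 0 a c) * f 0 c b = \<epsilon>' c * f 0 c b"
      proof (cases "f 0 c b = 0")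
        case False
        then have "deg' 0 c \<notin> Q" using f(1) b F.Q_up F.deg_vdeg by blast
        then show ?thesis using g(2) c by simp
      qed simp
    qed
    also have "\<dots> = \<epsilon> b" using f(2) b by simp
    finally have 1: "(\<Sum>a\<in>B 0. \<epsilon> a * mv (B' 0) (g 0) (\<lambda>c. f 0 c b) a) = \<epsilon> b" .
    have "(\<Sum>a\<in>B 0. \<epsilon> a * one 0 a b) = (\<Sum>a\<in>B 0. if a = b then \<epsilon> a else 0)"
      unfolding one_def by (intro sum.cong) auto
    also have "\<dots> = \<epsilon> b" using b F.finite_B by simp
    finally show "(\<Sum>a\<in>B 0. \<epsilon> a * \<phi> 0 a b) = 0"
      using 1 by (simp add: \<phi>_def right_diff_distrib sum_subtractf)
  next
    fix i b
    have "mv (B (Suc i)) (d i) (mv (B' (Suc i)) (g (Suc i)) (\<lambda>c. f (Suc i) c b)) =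
       mv (B' i) (g i) (mv (B i) (f i) (\<lambda>a. d i a b))"
      unfolding mv_mv[of _ "d i"] g(3) by (simp add: mv_mv[symmetric] f(3))
    moreover have "mv (B (Suc i)) (d i) (\<lambda>a. one (Suc i) a b) = (\<lambda>a. d i a b)"
    proof (cases "b \<in> B (Suc i)")
      case True
      then have "(\<lambda>a. one (Suc i) a b) = (\<lambda>a. if a = b then 1 else 0)" by (auto simp: one_def)
      then show ?thesis using F.d_col_eq_mv[OF True] by simp
    next
      case False
      then have "(\<lambda>a. one (Suc i) a b) = (\<lambda>a. 0)" "(\<lambda>a. d i a b) = (\<lambda>_. 0)"
        using F.d_outside by (auto simp: one_def)
      then show ?thesis by simp
    qed
    moreover have "mv (B i) (\<phi> i) x = (\<lambda>a. mv (B' i) (g i) (mv (B i) (f i) x) a - mv (B i) (one i) x a)" for x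
      unfolding mv_mv by (simp add: \<phi>_def mv_def left_diff_distrib sum_subtractf fun_eq_iff)
    ultimately show "mv (B (Suc i)) (d i) (\<lambda>c. \<phi> (Suc i) c b) = mv (B i) (\<phi> i) (\<lambda>a. d i a b)"
      by (simp add: \<phi>_def mv_diff one_mv[OF F.d_col_strand])
  qed
  show ?thesis
  proof (rule card_le_of_left_inverse[where Q = "g i" and P = "f i"])
    fix a b assume a: "a \<in> {b \<in> B i. deg i b = \<alpha>}" and b: "b \<in> {b \<in> B i. deg i b = \<alpha>}"
    \<comment> \<open>A nonzero term forces \<open>deg' i c\<close> between \<open>deg i a\<close>
      and \<open>deg i b\<close>, both equal to \<alpha>, so only \<open>c\<close> of degree
      \<alpha> contribute.\<close>
    have "(\<Sum>c\<in>{c \<in> B' i. deg' i c = \<alpha>}. g i a c * f i c b) = (\<Sum>c\<in>B' i. g i a c * f i c b)"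
    proof (intro sum.mono_neutral_left)
      show "\<forall>c\<in>B' i - {c \<in> B' i. deg' i c = \<alpha>}. g i a c * f i c b = 0"
      proof
        fix c assume "c \<in> B' i - {c \<in> B' i. deg' i c = \<alpha>}"
        then show "g i a c * f i c b = 0"
          using g(1)[of i a c] f(1)[of i c b] a b by fastforce
      qed
    qed (use G.finite_B in auto)
    also have "\<dots> = one i a b"
      using \<phi>0[of i a b] a b by (simp add: \<phi>_def mv_def)
    finally show "(\<Sum>c\<in>{c \<in> B' i. deg' i c = \<alpha>}. g i a c * f i c b) = (if a = b then 1 else 0)"
      using a by (simp add: one_def)
  qed (use F.finite_B G.finite_B in auto)
qed

lemma scalar_res_card_eq:
  fixes d :: "nat \<Rightarrow> 'b \<Rightarrow> 'b \<Rightarrow> 'k::field" and d' :: "nat \<Rightarrow> 'c \<Rightarrow> 'c \<Rightarrow> 'k"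
  assumes "scalar_res V A Q B deg d \<epsilon>" and "scalar_res V A Q B' deg' d' \<epsilon>'"
  shows "card {b\<in>B i. deg i b = \<alpha>} = card {c\<in>B' i. deg' i c = \<alpha>}"
  using scalar_res_card_le[OF assms] scalar_res_card_le[OF assms(2,1)] by (rule antisym)

section \<open>Existence\<close>

text \<open>A graded submodule of a free module of finite rank, given by its components as vectors
  of scalars; multiplication by monomials is inclusion. The last clause says that a nonzero element
  of degree \<alpha> is a monomial multiple of one of degree \<open>inf \<alpha> N\<close>. It takes
  the part of Noetherianity in the construction of resolutions.\<close>

definition graded_family :: "'v set \<Rightarrow> ('v \<Rightarrow> int) \<Rightarrow> (('v \<Rightarrow> int) \<Rightarrow> (nat \<Rightarrow> 'k::field) set) \<Rightarrow> bool" where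
  "graded_family V N Z \<longleftrightarrow>
     (\<forall>\<alpha>. (\<lambda>_. 0) \<in> Z \<alpha> \<and> (\<forall>x\<in>Z \<alpha>. \<forall>y\<in>Z \<alpha>. \<forall>c. (\<lambda>a. x a + c * y a) \<in> Z \<alpha>)) \<and>
     (\<forall>\<alpha>\<in>vdeg V. \<forall>\<beta>\<in>vdeg V. \<alpha> \<le> \<beta> \<longrightarrow> Z \<alpha> \<subseteq> Z \<beta>) \<and>
     (\<exists>r. \<forall>\<alpha>. \<forall>x\<in>Z \<alpha>. \<forall>a\<ge>r. x a = 0) \<and>
     (\<forall>\<alpha>\<in>vdeg V. \<forall>x\<in>Z \<alpha>. x \<noteq> (\<lambda>_. 0) \<longrightarrow> (\<lambda>_. 0) \<le> \<alpha> \<and> x \<in> Z (inf \<alpha> N))"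

lemma
  assumes "graded_family V N Z"
  shows graded_family_zero: "(\<lambda>_. 0) \<in> Z \<alpha>"
    and graded_family_comb: "x \<in> Z \<alpha> \<Longrightarrow> y \<in> Z \<alpha> \<Longrightarrow> (\<lambda>a. x a + c * y a) \<in> Z \<alpha>"
    and graded_family_mono: "\<alpha> \<in> vdeg V \<Longrightarrow> \<beta> \<in> vdeg V \<Longrightarrow> \<alpha> \<le> \<beta> \<Longrightarrow> x \<in> Z \<alpha> \<Longrightarrow> x \<in> Z \<beta>"
    and graded_family_bound: "\<exists>r. \<forall>\<alpha>. \<forall>x\<in>Z \<alpha>. \<forall>a\<ge>r. x a = 0"
    and graded_family_inf: "\<alpha> \<in> vdeg V \<Longrightarrow> x \<in> Z \<alpha> \<Longrightarrow> x \<noteq> (\<lambda>_. 0) \<Longrightarrow>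
      (\<lambda>_. 0) \<le> \<alpha> \<and> x \<in> Z (inf \<alpha> N)"
  using assms unfolding graded_family_def by (simp_all add: subset_iff)

lemma graded_familyI:
  assumes "\<And>\<alpha>. (\<lambda>_. 0) \<in> Z \<alpha>"
    and "\<And>\<alpha> x y c. x \<in> Z \<alpha> \<Longrightarrow> y \<in> Z \<alpha> \<Longrightarrow> (\<lambda>a. x a + c * y a) \<in> Z \<alpha>"
    and "\<And>\<alpha> \<beta> x. \<alpha> \<in> vdeg V \<Longrightarrow> \<beta> \<in> vdeg V \<Longrightarrow> \<alpha> \<le> \<beta> \<Longrightarrow> x \<in> Z \<alpha> \<Longrightarrow> x \<in> Z \<beta>"
    and "\<And>\<alpha> x a. x \<in> Z \<alpha> \<Longrightarrow> a \<ge> r \<Longrightarrow> x a = 0"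
    and "\<And>\<alpha> x. \<alpha> \<in> vdeg V \<Longrightarrow> x \<in> Z \<alpha> \<Longrightarrow> x \<noteq> (\<lambda>_. 0) \<Longrightarrow> (\<lambda>_. 0) \<le> \<alpha> \<and> x \<in> Z (inf \<alpha> N)"
  shows "graded_family V N Z"
  unfolding graded_family_def
proof (intro conjI)
  show "\<forall>\<alpha>. (\<lambda>_. 0) \<in> Z \<alpha> \<and> (\<forall>x\<in>Z \<alpha>. \<forall>y\<in>Z \<alpha>. \<forall>c. (\<lambda>a. x a + c * y a) \<in> Z \<alpha>)"
    using assms(1,2) by blast
  show "\<forall>\<alpha>\<in>vdeg V. \<forall>\<beta>\<in>vdeg V. \<alpha> \<le> \<beta> \<longrightarrow> Z \<alpha> \<subseteq> Z \<beta>" using assms(3) by blast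
  show "\<exists>r. \<forall>\<alpha>. \<forall>x\<in>Z \<alpha>. \<forall>a\<ge>r. x a = 0" using assms(4) by blast
qed (use assms(5) in blast)

definition generates ::
    "'v set \<Rightarrow> ('v \<Rightarrow> int) \<Rightarrow> (('v \<Rightarrow> int) \<Rightarrow> (nat \<Rightarrow> 'k::field) set) \<Rightarrow> (('v \<Rightarrow> int) \<times> (nat \<Rightarrow> 'k)) set \<Rightarrow> bool"
  where
  "generates V N Z T \<longleftrightarrow> finite T \<and>
     (\<forall>p\<in>T. fst p \<in> vdeg V \<and> (\<lambda>_. 0) \<le> fst p \<and> fst p \<le> N \<and> snd p \<in> Z (fst p)) \<and>
     (\<forall>\<alpha>\<in>vdeg V. \<forall>x\<in>Z \<alpha>. \<exists>y\<in>strand T fst \<alpha>. x = mv T (\<lambda>a p. snd p a) y)"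

text \<open>Coordinates are removed one at a time: the vectors vanishing at \<open>b\<close> form a
  subspace with smaller support, and one vector not vanishing at \<open>b\<close> generates the rest
  over it.\<close>

lemma subspace_finitely_generated:
  fixes Z :: "(nat \<Rightarrow> 'k::field) set"
  assumes "finite X" and "\<And>x a. x \<in> Z \<Longrightarrow> a \<notin> X \<Longrightarrow> x a = 0"
    and "\<And>x y c. x \<in> Z \<Longrightarrow> y \<in> Z \<Longrightarrow> (\<lambda>a. x a + c * y a) \<in> Z"
  shows "\<exists>G. finite G \<and> G \<subseteq> Z \<and> (\<forall>x\<in>Z. \<exists>c. x = (\<lambda>a. \<Sum>z\<in>G. c z * z a))"
  using assms
proof (induction X arbitrary: Z rule: finite_induct)
  case empty
  then show ?case by (intro exI[of _ "{}"]) auto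
next
  case (insert b X)
  define Z' where "Z' = {x \<in> Z. x b = 0}"
  have "\<exists>G. finite G \<and> G \<subseteq> Z' \<and> (\<forall>x\<in>Z'. \<exists>c. x = (\<lambda>a. \<Sum>z\<in>G. c z * z a))"
  proof (rule insert.IH)
    show "x a = 0" if "x \<in> Z'" "a \<notin> X" for x a
      using that insert.prems(1) by (cases "a = b") (auto simp: Z'_def)
    show "(\<lambda>a. x a + c * y a) \<in> Z'" if "x \<in> Z'" "y \<in> Z'" for x y c
      using that insert.prems(2) by (auto simp: Z'_def)
  qed
  then obtain G where G: "finite G" "G \<subseteq> Z'" "\<And>x. x \<in> Z' \<Longrightarrow> \<exists>c. x = (\<lambda>a. \<Sum>z\<in>G. c z * z a)"
    by blast
  show ?case
  proof (cases "Z' = Z")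
    case True
    then show ?thesis using G by blast
  next
    case False
    then obtain z0 where z0: "z0 \<in> Z" "z0 b \<noteq> 0" by (auto simp: Z'_def)
    then have nG: "z0 \<notin> G" using G(2) by (auto simp: Z'_def)
    have "\<exists>c. x = (\<lambda>a. \<Sum>z\<in>insert z0 G. c z * z a)" if x: "x \<in> Z" for x
    proof -
      have "(\<lambda>a. x a + (- x b / z0 b) * z0 a) \<in> Z'"
        using insert.prems(2)[OF x z0(1), of "- x b / z0 b"] z0(2) by (simp add: Z'_def)
      from G(3)[OF this] obtain c where "(\<lambda>a. x a + (- x b / z0 b) * z0 a) = (\<lambda>a. \<Sum>z\<in>G. c z * z a)"
        by blast
      then have c: "x a + (- x b / z0 b) * z0 a = (\<Sum>z\<in>G. c z * z a)" for a by (rule fun_cong)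
      have "(\<Sum>z\<in>G. (c(z0 := x b / z0 b)) z * z a) = (\<Sum>z\<in>G. c z * z a)" for a
        using nG by (intro sum.cong) auto
      then have "x a = (\<Sum>z\<in>insert z0 G. (c(z0 := x b / z0 b)) z * z a)" for a
        using c[of a] nG G(1) by (simp add: algebra_simps)
      then show ?thesis by blast
    qed
    then show ?thesis using G z0 by (intro exI[of _ "insert z0 G"]) (auto simp: Z'_def)
  qed
qed

lemma finite_degree_box:
  fixes N :: "'v \<Rightarrow> int"
  assumes "finite V"
  shows "finite {\<alpha> \<in> vdeg V. (\<lambda>_. 0) \<le> \<alpha> \<and> \<alpha> \<le> N}"
proof (rule finite_subset)
  let ?m = "Max (insert 0 (N ` V))"
  have "\<alpha> v \<le> ?m" if "v \<in> V" "\<alpha> \<le> N" for v \<alpha>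
  proof -
    have "N v \<le> ?m" using assms that(1) by (intro Max_ge) auto
    with le_funD[OF that(2), of v] show ?thesis by linarith
  qed
  then show "{\<alpha> \<in> vdeg V. (\<lambda>_. 0) \<le> \<alpha> \<and> \<alpha> \<le> N} \<subseteq>
      {\<alpha>. \<forall>v. (v \<in> V \<longrightarrow> \<alpha> v \<in> {0..?m}) \<and> (v \<notin> V \<longrightarrow> \<alpha> v = 0)}"
    by (auto simp: vdeg_def dest: le_funD)
  show "finite {\<alpha>. \<forall>v. (v \<in> V \<longrightarrow> \<alpha> v \<in> {0..?m}) \<and> (v \<notin> V \<longrightarrow> \<alpha> v = 0)}"
    using assms by (intro finite_set_of_finite_funs) auto
qed

lemma inf_vdeg: "\<alpha> \<in> vdeg V \<Longrightarrow> \<beta> \<in> vdeg V \<Longrightarrow> inf \<alpha> \<beta> \<in> vdeg V"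
  by (simp add: vdeg_def)

text \<open>Generators are collected from the components in the finitely many degrees between 0 and
  \<open>N\<close>; a nonzero element of degree \<alpha> is expanded in the component of degree
  \<open>inf \<alpha> N\<close>.\<close>

lemma generates_exists:
  fixes Z :: "('v \<Rightarrow> int) \<Rightarrow> (nat \<Rightarrow> 'k::field) set"
  assumes "finite V" "N \<in> vdeg V" "(\<lambda>_. 0) \<le> N" "graded_family V N Z"
  shows "\<exists>T. generates V N Z T"
proof -
  obtain r where r: "\<And>\<alpha> x a. x \<in> Z \<alpha> \<Longrightarrow> a \<ge> r \<Longrightarrow> x a = 0"
    using graded_family_bound[OF assms(4)] by blast
  have "\<exists>G. finite G \<and> G \<subseteq> Z \<alpha> \<and> (\<forall>x\<in>Z \<alpha>. \<exists>c. x = (\<lambda>a. \<Sum>z\<in>G. c z * z a))" for \<alpha>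
  proof (rule subspace_finitely_generated)
    show "x a = 0" if "x \<in> Z \<alpha>" "a \<notin> {..<r}" for x a using that r by simp
    show "(\<lambda>a. x a + c * y a) \<in> Z \<alpha>" if "x \<in> Z \<alpha>" "y \<in> Z \<alpha>" for x y c
      using that by (rule graded_family_comb[OF assms(4)])
  qed simp
  then have "\<exists>G. \<forall>\<alpha>. finite (G \<alpha>) \<and> G \<alpha> \<subseteq> Z \<alpha> \<and> (\<forall>x\<in>Z \<alpha>. \<exists>c. x = (\<lambda>a. \<Sum>z\<in>G \<alpha>. c z * z a))"
    by (intro choice allI)
  then obtain G where "\<forall>\<alpha>. finite (G \<alpha>) \<and> G \<alpha> \<subseteq> Z \<alpha> \<and> (\<forall>x\<in>Z \<alpha>. \<exists>c. x = (\<lambda>a. \<Sum>z\<in>G \<alpha>. c z * z a))" ..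
  then have G: "finite (G \<alpha>)" "G \<alpha> \<subseteq> Z \<alpha>"
    "x \<in> Z \<alpha> \<Longrightarrow> \<exists>c. x = (\<lambda>a. \<Sum>z\<in>G \<alpha>. c z * z a)" for \<alpha> x by simp_all
  define T where "T = (SIGMA \<alpha> : {\<alpha> \<in> vdeg V. (\<lambda>_. 0) \<le> \<alpha> \<and> \<alpha> \<le> N}. G \<alpha>)"
  have finT: "finite T" unfolding T_def using G(1) finite_degree_box[OF assms(1)] by blast
  have "\<exists>y\<in>strand T fst \<alpha>. x = mv T (\<lambda>a p. snd p a) y" if \<alpha>: "\<alpha> \<in> vdeg V" and x: "x \<in> Z \<alpha>" for \<alpha> x
  proof (cases "x = (\<lambda>_. 0)")
    case True
    then show ?thesis by (intro bexI[of _ "\<lambda>_. 0"]) simp_all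
  next
    case False
    let ?\<beta> = "inf \<alpha> N"
    have 0: "(\<lambda>_. 0) \<le> \<alpha>" "x \<in> Z ?\<beta>"
      using graded_family_inf[OF assms(4) \<alpha> x False] by blast+
    then have \<beta>: "?\<beta> \<in> {\<alpha> \<in> vdeg V. (\<lambda>_. 0) \<le> \<alpha> \<and> \<alpha> \<le> N}"
      using assms(2,3) \<alpha> by (simp add: inf_vdeg)
    obtain c where c: "x = (\<lambda>a. \<Sum>z\<in>G ?\<beta>. c z * z a)" using G(3)[OF 0(2)] by blast
    define y where "y = (\<lambda>p. if p \<in> {?\<beta>} \<times> G ?\<beta> then c (snd p) else 0)"
    have sub: "{?\<beta>} \<times> G ?\<beta> \<subseteq> T" using \<beta> by (auto simp: T_def)
    have "y \<in> strand T fst \<alpha>"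
      by (rule strandI) (use sub in \<open>auto simp: y_def split: if_splits\<close>)
    moreover have "mv T (\<lambda>a p. snd p a) y a = x a" for a
    proof -
      have "mv T (\<lambda>a p. snd p a) y a = (\<Sum>p\<in>{?\<beta>} \<times> G ?\<beta>. snd p a * y p)"
        unfolding mv_def using sub finT by (intro sum.mono_neutral_right) (auto simp: y_def)
      also have "\<dots> = (\<Sum>p\<in>{?\<beta>} \<times> G ?\<beta>. c (snd p) * snd p a)"
        by (intro sum.cong) (auto simp: y_def)
      also have "\<dots> = (\<Sum>z\<in>G ?\<beta>. c z * z a)"
        by (rule sum.reindex_bij_witness[where i = "\<lambda>z. (?\<beta>, z)" and j = snd]) auto
      finally show ?thesis using c by simp
    qed
    ultimately show ?thesis by (intro bexI[of _ y]) auto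
  qed
  moreover have "fst p \<in> vdeg V \<and> (\<lambda>_. 0) \<le> fst p \<and> fst p \<le> N \<and> snd p \<in> Z (fst p)" if "p \<in> T" for p
    using that subsetD[OF G(2)] by (auto simp: T_def)
  ultimately have "generates V N Z T" using finT unfolding generates_def by blast
  then show ?thesis by blast
qed

text \<open>A relation in the degree of \<open>p\<close> with nonzero coefficient at
  \<open>p\<close> would express \<open>p\<close> through the other generators, and a smaller
  generating set would remain.\<close>

lemma minimal_generators_irredundant:
  fixes Z :: "('v \<Rightarrow> int) \<Rightarrow> (nat \<Rightarrow> 'k::field) set"
  assumes gen: "generates V N Z T" and min: "\<And>T'. generates V N Z T' \<Longrightarrow> card T \<le> card T'"
    and y: "y \<in> strand T fst (fst p)" "mv T (\<lambda>a p. snd p a) y = (\<lambda>_. 0)" and p: "p \<in> T"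
  shows "y p = 0"
proof (rule ccontr)
  assume ne: "y p \<noteq> 0"
  have fin: "finite T" using gen by (simp add: generates_def)
  have "\<exists>z\<in>strand (T - {p}) fst \<alpha>. x = mv (T - {p}) (\<lambda>a p. snd p a) z"
    if \<alpha>: "\<alpha> \<in> vdeg V" and x: "x \<in> Z \<alpha>" for \<alpha> x
  proof -
    obtain c where c: "c \<in> strand T fst \<alpha>" "x = mv T (\<lambda>a p. snd p a) c"
      using gen \<alpha> x unfolding generates_def by blast
    \<comment> \<open>The multiple of the relation \<open>y\<close> is chosen to cancel the
      coefficient of \<open>p\<close>. It stays in the strand at \<alpha>: either \<open>c p\<close>
      is zero, or the degree of \<open>p\<close> is below \<alpha>.\<close>
    define z where "z = (\<lambda>q. c q - (c p / y p) * y q)"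
    have zp: "z p = 0" using ne by (simp add: z_def)
    have "z \<in> strand T fst \<alpha>"
    proof (cases "c p = 0")
      case True
      then show ?thesis using c(1) by (simp add: z_def)
    next
      case False
      then have "fst p \<le> \<alpha>" using strandD[OF c(1)] by blast
      then show ?thesis unfolding z_def by (intro strand_diff c(1) strand_scale strand_mono[OF y(1)])
    qed
    then have 1: "z \<in> strand (T - {p}) fst \<alpha>" using zp by (auto simp: strand_def)
    have "mv T (\<lambda>a p. snd p a) z = x"
      unfolding z_def mv_diff mv_scale y(2) c(2) by simp
    moreover have "mv T (\<lambda>a p. snd p a) z = mv (T - {p}) (\<lambda>a p. snd p a) z"
      unfolding mv_def using zp fin p by (intro ext sum.mono_neutral_right) auto
    ultimately show ?thesis using 1 by metis
  qed
  then have "generates V N Z (T - {p})" using gen unfolding generates_def by blast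
  from min[OF this] show False using fin p
    by (metis card_Diff1_less leD)
qed

section \<open>Minimal generators and syzygies of a graded family\<close>

definition gdeg :: "('d \<times> 'e) list \<Rightarrow> nat \<Rightarrow> 'd" where
  "gdeg gs b = fst (gs ! b)"

definition gmat :: "('d \<times> (nat \<Rightarrow> 'k::field)) list \<Rightarrow> nat \<Rightarrow> nat \<Rightarrow> 'k" where
  "gmat gs a b = (if b < length gs then snd (gs ! b) a else 0)"

text \<open>The syzygies of the listed generators in degree \<alpha>.\<close>

definition gker :: "(('v \<Rightarrow> int) \<times> (nat \<Rightarrow> 'k::field)) list \<Rightarrow> ('v \<Rightarrow> int) \<Rightarrow> (nat \<Rightarrow> 'k) set" where
  "gker gs \<alpha> = {y \<in> strand {..<length gs} (gdeg gs) \<alpha>. mv {..<length gs} (gmat gs) y = (\<lambda>_. 0)}"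

text \<open>The last clause excludes syzygies with a unit coefficient at a generator. Applied to the
  columns of the next differential it becomes the strict increase of degrees required by
  \<open>d_nz\<close>.\<close>

definition min_generators ::
    "'v set \<Rightarrow> ('v \<Rightarrow> int) \<Rightarrow> (('v \<Rightarrow> int) \<Rightarrow> (nat \<Rightarrow> 'k::field) set) \<Rightarrow> (('v \<Rightarrow> int) \<times> (nat \<Rightarrow> 'k)) list \<Rightarrow> bool"
  where
  "min_generators V N Z gs \<longleftrightarrow>
     (\<forall>b<length gs. gdeg gs b \<in> vdeg V \<and> (\<lambda>_. 0) \<le> gdeg gs b \<and> gdeg gs b \<le> N \<and>
        (\<lambda>a. gmat gs a b) \<in> Z (gdeg gs b)) \<and>
     (\<forall>\<alpha>\<in>vdeg V. Z \<alpha> = mv {..<length gs} (gmat gs) ` strand {..<length gs} (gdeg gs) \<alpha>) \<and>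
     (\<forall>\<alpha> b y. y \<in> gker gs \<alpha> \<longrightarrow> b < length gs \<longrightarrow> gdeg gs b = \<alpha> \<longrightarrow> y b = 0)"

lemma
  assumes "min_generators V N Z gs"
  shows min_generators_deg: "b < length gs \<Longrightarrow> gdeg gs b \<in> vdeg V \<and> (\<lambda>_. 0) \<le> gdeg gs b \<and> gdeg gs b \<le> N"
    and min_generators_mem: "b < length gs \<Longrightarrow> (\<lambda>a. gmat gs a b) \<in> Z (gdeg gs b)"
    and min_generators_image: "\<alpha> \<in> vdeg V \<Longrightarrow>
      Z \<alpha> = mv {..<length gs} (gmat gs) ` strand {..<length gs} (gdeg gs) \<alpha>"
    and min_generators_irredundant: "y \<in> gker gs (gdeg gs b) \<Longrightarrow> b < length gs \<Longrightarrow> y b = 0"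
proof -
  note c = assms[unfolded min_generators_def]
  show "b < length gs \<Longrightarrow> gdeg gs b \<in> vdeg V \<and> (\<lambda>_. 0) \<le> gdeg gs b \<and> gdeg gs b \<le> N"
    "b < length gs \<Longrightarrow> (\<lambda>a. gmat gs a b) \<in> Z (gdeg gs b)"
    using conjunct1[OF c] by simp_all
  show "\<alpha> \<in> vdeg V \<Longrightarrow> Z \<alpha> = mv {..<length gs} (gmat gs) ` strand {..<length gs} (gdeg gs) \<alpha>"
    using conjunct1[OF conjunct2[OF c]] by (rule bspec)
  show "y \<in> gker gs (gdeg gs b) \<Longrightarrow> b < length gs \<Longrightarrow> y b = 0"
    using conjunct2[OF conjunct2[OF c]] by simp
qed

lemma min_generators_exists:
  fixes Z :: "('v \<Rightarrow> int) \<Rightarrow> (nat \<Rightarrow> 'k::field) set"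
  assumes "finite V" "N \<in> vdeg V" "(\<lambda>_. 0) \<le> N" and Z: "graded_family V N Z"
  shows "\<exists>gs. min_generators V N Z gs"
proof -
  obtain T where T: "generates V N Z T" "\<And>T'. generates V N Z T' \<Longrightarrow> card T \<le> card T'"
    using ex_has_least_nat[where P = "generates V N Z" and m = card] generates_exists[OF assms] by blast
  have fin: "finite T" using T(1) by (simp add: generates_def)
  then obtain gs where gs: "set gs = T" "distinct gs" using finite_distinct_list by blast
  let ?n = "length gs"
  have bij: "bij_betw ((!) gs) {..<?n} T" using bij_betw_nth[OF gs(2), of "{..<?n}" T] gs(1) by simp
  have mv_eq: "mv T (\<lambda>a p. snd p a) y = mv {..<?n} (gmat gs) (\<lambda>b. if b < ?n then y (gs ! b) else 0)" for y
    unfolding mv_def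
  proof
    fix a
    have "(\<Sum>p\<in>T. snd p a * y p) = (\<Sum>b\<in>{..<?n}. snd (gs ! b) a * y (gs ! b))"
      by (rule sum.reindex_bij_betw[OF bij, symmetric])
    also have "\<dots> = (\<Sum>b\<in>{..<?n}. gmat gs a b * (if b < ?n then y (gs ! b) else 0))"
      by (intro sum.cong) (auto simp: gmat_def)
    finally show "(\<Sum>p\<in>T. snd p a * y p) = (\<Sum>b<?n. gmat gs a b * (if b < ?n then y (gs ! b) else 0))" .
  qed
  have P1: "gdeg gs b \<in> vdeg V \<and> (\<lambda>_. 0) \<le> gdeg gs b \<and> gdeg gs b \<le> N \<and>
        (\<lambda>a. gmat gs a b) \<in> Z (gdeg gs b)" if "b < ?n" for b
    using that T(1) nth_mem[OF that] gs(1) by (simp add: generates_def gdeg_def gmat_def)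
  have "mv {..<?n} (gmat gs) y \<in> Z \<alpha>" if \<alpha>: "\<alpha> \<in> vdeg V" and y: "y \<in> strand {..<?n} (gdeg gs) \<alpha>" for y \<alpha>
  proof -
    have "(\<lambda>a. \<Sum>b\<in>S. gmat gs a b * y b) \<in> Z \<alpha>" if "S \<subseteq> {..<?n}" for S
      using finite_subset[OF that finite_lessThan] that
    proof (induction S rule: finite_induct)
      case empty
      then show ?case using graded_family_zero[OF Z] by simp
    next
      case (insert b S)
      have *: "(\<lambda>a. gmat gs a b) \<in> Z \<alpha> \<or> y b = 0"
      proof (cases "y b = 0")
        case False
        then have "gdeg gs b \<le> \<alpha>" using strandD[OF y] by blast
        then show ?thesis using P1[of b] insert.prems \<alpha> graded_family_mono[OF Z] by blast
      qed simp
      have IH: "(\<lambda>a. \<Sum>b\<in>S. gmat gs a b * y b) \<in> Z \<alpha>" using insert by simp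
      have eq: "(\<lambda>a. \<Sum>b\<in>insert b S. gmat gs a b * y b) =
          (\<lambda>a. (\<Sum>b\<in>S. gmat gs a b * y b) + y b * gmat gs a b)"
        using insert.hyps by (simp add: algebra_simps)
      show ?case
      proof (cases "y b = 0")
        case True
        then show ?thesis using eq IH by simp
      next
        case False
        with * have "(\<lambda>a. gmat gs a b) \<in> Z \<alpha>" by simp
        then show ?thesis unfolding eq using IH by (intro graded_family_comb[OF Z])
      qed
    qed
    then show ?thesis unfolding mv_def by blast
  qed
  moreover have "x \<in> mv {..<?n} (gmat gs) ` strand {..<?n} (gdeg gs) \<alpha>"
    if \<alpha>: "\<alpha> \<in> vdeg V" and x: "x \<in> Z \<alpha>" for x \<alpha>
  proof -
    obtain y where y: "y\<in>strand T fst \<alpha>" "x = mv T (\<lambda>a p. snd p a) y"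
      using T(1) \<alpha> x unfolding generates_def by blast
    have "(\<lambda>b. if b < ?n then y (gs ! b) else 0) \<in> strand {..<?n} (gdeg gs) \<alpha>"
      by (rule strandI) (use strandD[OF y(1)] in \<open>auto simp: gdeg_def split: if_splits\<close>)
    then show ?thesis using y(2) mv_eq by blast
  qed
  ultimately have P2: "Z \<alpha> = mv {..<?n} (gmat gs) ` strand {..<?n} (gdeg gs) \<alpha>" if "\<alpha> \<in> vdeg V" for \<alpha>
    using that by blast
  have P3: "y b = 0" if y: "y \<in> gker gs \<alpha>" and b: "b < ?n" "gdeg gs b = \<alpha>" for \<alpha> b y
  proof -
    \<comment> \<open>The syzygy moved from list positions to the set \<open>T\<close>, where
      minimality of the cardinality is available.\<close>
    define y' where "y' = (\<lambda>p. if p \<in> T then y (the_inv_into {..<?n} ((!) gs) p) else 0)"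
    have y'b: "y' (gs ! c) = y c" if "c < ?n" for c
      using that bij gs(1) nth_mem[OF that] the_inv_into_f_f[of "(!) gs" "{..<?n}" c] by (simp add: y'_def bij_betw_def)
    have "y = (\<lambda>b. if b < ?n then y' (gs ! b) else 0)"
      using y y'b by (auto simp: gker_def strand_def fun_eq_iff)
    then have 0: "mv T (\<lambda>a p. snd p a) y' = (\<lambda>_. 0)" using y unfolding mv_eq gker_def by simp
    have "y' \<in> strand T fst (fst (gs ! b))"
    proof (rule strandI)
      fix p assume p: "y' p \<noteq> 0"
      then have "p \<in> T" unfolding y'_def by (metis (full_types))
      then obtain c where c: "c < ?n" "p = gs ! c" using gs(1) by (metis in_set_conv_nth)
      with p y'b have "y c \<noteq> 0" by simp
      then have "gdeg gs c \<le> \<alpha>" using y unfolding gker_def by (blast dest: strandD)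
      then show "p \<in> T \<and> fst p \<le> fst (gs ! b)" using \<open>p \<in> T\<close> c b by (simp add: gdeg_def)
    qed
    from minimal_generators_irredundant[OF T this 0] have "y' (gs ! b) = 0" using b gs(1) by force
    then show ?thesis using y'b b by simp
  qed
  from P1 P2 P3 show ?thesis unfolding min_generators_def by blast
qed

text \<open>All generator degrees are at most \<open>N\<close>, so a generator degree below \<alpha>
  is already below \<open>inf \<alpha> N\<close>. Syzygies therefore inherit the same bound, and the
  construction can be repeated without enlarging it.\<close>

lemma graded_family_gker:
  assumes gs: "min_generators V N Z gs" and N: "N \<in> vdeg V"
  shows "graded_family V N (gker gs)"
proof -
  let ?n = "length gs"
  show ?thesis
  proof (rule graded_familyI)
    show "(\<lambda>_. 0) \<in> gker gs \<alpha>" for \<alpha> by (simp add: gker_def)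
    show "(\<lambda>a. x a + c * y a) \<in> gker gs \<alpha>" if "x \<in> gker gs \<alpha>" "y \<in> gker gs \<alpha>" for x y c \<alpha>
      using that by (auto simp: gker_def mv_add mv_scale intro!: strand_add strand_scale)
    show "x \<in> gker gs \<beta>" if "\<alpha> \<le> \<beta>" "x \<in> gker gs \<alpha>" for \<alpha> \<beta> x
      using strand_mono that unfolding gker_def by blast
    show "x a = 0" if "x \<in> gker gs \<alpha>" "a \<ge> ?n" for \<alpha> x a
      using that strandD[of x "{..<?n}" "gdeg gs" \<alpha> a] by (auto simp: gker_def)
    show "(\<lambda>_. 0) \<le> \<alpha> \<and> x \<in> gker gs (inf \<alpha> N)" if x: "x \<in> gker gs \<alpha>" "x \<noteq> (\<lambda>_. 0)" for x \<alpha>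
    proof
      have le: "b < ?n \<and> gdeg gs b \<le> \<alpha>" if "x b \<noteq> 0" for b
        using x(1) that unfolding gker_def by (blast dest: strandD)
      have ge: "(\<lambda>_. 0) \<le> gdeg gs b \<and> gdeg gs b \<le> N" if "b < ?n" for b
        using min_generators_deg[OF gs that] by blast
      from x(2) obtain b where "x b \<noteq> 0" by auto
      then show "(\<lambda>_. 0) \<le> \<alpha>" using le[of b] ge[of b] order_trans[of "\<lambda>_. 0" "gdeg gs b" \<alpha>] by blast
      have "x \<in> strand {..<?n} (gdeg gs) (inf \<alpha> N)"
        by (rule strandI) (use le ge in simp)
      then show "x \<in> gker gs (inf \<alpha> N)" using x(1) by (simp add: gker_def)
    qed
  qed
qed

text \<open>Minimal generators of the ideal, then of their syzygies, and so on. The indexing by all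
  natural numbers allows the iteration to run forever, possibly with empty lists.\<close>

lemma scalar_res_exists:
  fixes N :: "'v \<Rightarrow> int"
  assumes V: "finite V" and A: "A \<subseteq> vdeg V"
    and A_up: "\<And>\<alpha> \<beta>. \<alpha> \<in> A \<Longrightarrow> \<beta> \<in> vdeg V \<Longrightarrow> \<alpha> \<le> \<beta> \<Longrightarrow> \<beta> \<in> A"
    and N: "N \<in> vdeg V" "(\<lambda>_. 0) \<le> N"
    and AN: "\<And>\<alpha>. \<alpha> \<in> A \<Longrightarrow> (\<lambda>_. 0) \<le> \<alpha> \<and> inf \<alpha> N \<in> A"
  obtains r :: "nat \<Rightarrow> nat" and deg and d :: "nat \<Rightarrow> nat \<Rightarrow> nat \<Rightarrow> 'k::field" and \<epsilon> where
    "scalar_res V A {} (\<lambda>i. {..<r i}) deg d \<epsilon>" "\<And>i b. b < r i \<Longrightarrow> deg i b \<le> N"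
proof -
  \<comment> \<open>The ideal itself as a graded family: a line in coordinate 0 in the degrees of
    \<open>A\<close>, zero elsewhere.\<close>
  define Z0 where "Z0 = (\<lambda>\<alpha>. {x :: nat \<Rightarrow> 'k. (\<forall>b. b \<noteq> 0 \<longrightarrow> x b = 0) \<and> (x 0 \<noteq> 0 \<longrightarrow> \<alpha> \<in> A)})"
  have "graded_family V N Z0"
  proof (rule graded_familyI[where r = 1])
    show "x \<in> Z0 \<beta>" if "\<alpha> \<in> vdeg V" "\<beta> \<in> vdeg V" "\<alpha> \<le> \<beta>" "x \<in> Z0 \<alpha>" for \<alpha> \<beta> x
      using that A_up unfolding Z0_def by blast
    show "(\<lambda>_. 0) \<le> \<alpha> \<and> x \<in> Z0 (inf \<alpha> N)" if x: "x \<in> Z0 \<alpha>" "x \<noteq> (\<lambda>_. 0)" for \<alpha> x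
    proof -
      from x(2) obtain b where "x b \<noteq> 0" by auto
      with x(1) have "x 0 \<noteq> 0" by (cases "b = 0") (simp_all add: Z0_def)
      with x(1) have "\<alpha> \<in> A" by (simp add: Z0_def)
      with x(1) AN show "(\<lambda>_. 0) \<le> \<alpha> \<and> x \<in> Z0 (inf \<alpha> N)" by (simp add: Z0_def)
    qed
  qed (auto simp: Z0_def)
  then obtain g0 where g0: "min_generators V N Z0 g0" using min_generators_exists[OF V N] by blast
  \<comment> \<open>The existential over \<open>Z\<close> only records that \<open>g i\<close> is a
    minimal generating list of something, which is what \<open>graded_family_gker\<close> asks
    for.\<close>
  have "\<exists>g. \<forall>i. ((\<exists>Z. min_generators V N Z (g i)) \<and> (i = 0 \<longrightarrow> g i = g0)) \<and>
      min_generators V N (gker (g i)) (g (Suc i))"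
  proof (rule dependent_nat_choice)
    show "\<exists>gs. (\<exists>Z. min_generators V N Z gs) \<and> (0 = 0 \<longrightarrow> gs = g0)" using g0 by blast
    fix gs :: "(('v \<Rightarrow> int) \<times> (nat \<Rightarrow> 'k)) list" and i :: nat
    assume "(\<exists>Z. min_generators V N Z gs) \<and> (i = 0 \<longrightarrow> gs = g0)"
    then obtain Z where "min_generators V N Z gs" by blast
    from min_generators_exists[OF V N graded_family_gker[OF this N(1)]] obtain gs' where
      "min_generators V N (gker gs) gs'" by blast
    then show "\<exists>gs'. ((\<exists>Z. min_generators V N Z gs') \<and> (Suc i = 0 \<longrightarrow> gs' = g0)) \<and> min_generators V N (gker gs) gs'"
      by blast
  qed
  then obtain g where g: "\<forall>i. ((\<exists>Z. min_generators V N Z (g i)) \<and> (i = 0 \<longrightarrow> g i = g0)) \<and>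
      min_generators V N (gker (g i)) (g (Suc i))" ..
  then have gG: "\<exists>Z. min_generators V N Z (g i)" and gS: "min_generators V N (gker (g i)) (g (Suc i))" for i :: nat
    by simp_all
  have g_0: "g 0 = g0" using g by simp
  define r where "r = (\<lambda>i. length (g i))"
  define deg where "deg = (\<lambda>i. gdeg (g i))"
  define d where "d = (\<lambda>i. gmat (g (Suc i)))"
  define \<epsilon> where "\<epsilon> = gmat g0 0"
  have degs: "deg i b \<in> vdeg V \<and> (\<lambda>_. 0) \<le> deg i b \<and> deg i b \<le> N" if "b < r i" for i b
    using gG[of i] that min_generators_deg unfolding r_def deg_def by blast
  have col: "(\<lambda>a. d i a b) \<in> gker (g i) (deg (Suc i) b)" if "b < r (Suc i)" for i b
    using min_generators_mem[OF gS] that unfolding r_def deg_def d_def by blast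
  have im: "gker (g i) \<alpha> = mv {..<r (Suc i)} (d i) ` strand {..<r (Suc i)} (deg (Suc i)) \<alpha>"
    if "\<alpha> \<in> vdeg V" for i \<alpha>
    using min_generators_image[OF gS] that unfolding r_def deg_def d_def by blast
  have col0: "(\<lambda>a. gmat g0 a b) \<in> Z0 (deg 0 b)" if "b < r 0" for b
    using min_generators_mem[OF g0] that unfolding r_def deg_def g_0 by blast
  have ker0: "x \<in> gker (g 0) \<alpha> \<longleftrightarrow> (\<Sum>b<r 0. \<epsilon> b * x b) = 0" if x: "x \<in> strand {..<r 0} (deg 0) \<alpha>" for x \<alpha>
  proof -
    have "mv {..<r 0} (gmat g0) x a = 0" if "a \<noteq> 0" for a
      unfolding mv_def
    proof (rule sum.neutral, rule)
      fix b assume "b \<in> {..<r 0}"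
      then show "gmat g0 a b * x b = 0" using col0[of b] that unfolding Z0_def by auto
    qed
    then have "mv {..<r 0} (gmat g0) x = (\<lambda>_. 0) \<longleftrightarrow> mv {..<r 0} (gmat g0) x 0 = 0" by (metis)
    then show ?thesis using x by (simp add: gker_def r_def deg_def g_0 \<epsilon>_def mv_def)
  qed
  have "scalar_res V A {} (\<lambda>i. {..<r i}) deg d \<epsilon>"
  proof unfold_locales
    fix i a b assume nz: "d i a b \<noteq> 0"
    then have b: "b < r (Suc i)" by (auto simp: d_def gmat_def r_def split: if_splits)
    have a: "a < r i" "deg i a \<le> deg (Suc i) b"
      using col[OF b] strandD[of "\<lambda>a. d i a b" _ _ _ a] nz unfolding gker_def r_def deg_def by auto
    \<comment> \<open>A column of \<open>d i\<close> is a syzygy of \<open>g i\<close>; equal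
      degrees would make its entry at \<open>a\<close> a unit coefficient.\<close>
    have "deg i a \<noteq> deg (Suc i) b"
    proof
      assume eq: "deg i a = deg (Suc i) b"
      obtain Z where "min_generators V N Z (g i)" using gG by blast
      then have "d i a b = 0"
        using min_generators_irredundant[of V N Z "g i" "\<lambda>a. d i a b" a] col[OF b] a(1) eq
        by (simp add: r_def deg_def)
      with nz show False by blast
    qed
    with a b show "a \<in> {..<r i} \<and> b \<in> {..<r (Suc i)} \<and> deg i a < deg (Suc i) b" by auto
  next
    fix b assume nz: "\<epsilon> b \<noteq> 0"
    then have b: "b < r 0" by (auto simp: \<epsilon>_def gmat_def r_def g_0 split: if_splits)
    with nz col0 show "b \<in> {..<r 0} \<and> deg 0 b \<in> A" by (auto simp: Z0_def \<epsilon>_def)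
  next
    fix \<alpha> assume \<alpha>: "\<alpha> \<in> A"
    then have "(\<lambda>b. if b = 0 then 1 else 0) \<in> Z0 \<alpha>" by (simp add: Z0_def)
    moreover have "Z0 \<alpha> = mv {..<r 0} (gmat g0) ` strand {..<r 0} (deg 0) \<alpha>"
      using min_generators_image[OF g0] \<alpha> A unfolding r_def deg_def g_0 by blast
    ultimately obtain x where x: "x \<in> strand {..<r 0} (deg 0) \<alpha>"
      "(\<lambda>b. if b = 0 then 1 else 0) = mv {..<r 0} (gmat g0) x" by blast
    from fun_cong[OF x(2), of 0] have "(\<Sum>b<r 0. \<epsilon> b * x b) = 1" by (simp add: mv_def \<epsilon>_def)
    with x show "\<exists>x\<in>strand {..<r 0} (deg 0) \<alpha>. (\<Sum>b<r 0. \<epsilon> b * x b) = 1" by blast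
  next
    fix \<alpha> and x :: "nat \<Rightarrow> 'k" assume \<alpha>: "\<alpha> \<in> vdeg V" and x: "x \<in> strand {..<r 0} (deg 0) \<alpha>"
    show "(\<alpha> \<notin> {} \<longrightarrow> (\<Sum>b<r 0. \<epsilon> b * x b) = 0) = (\<exists>y\<in>strand {..<r 1} (deg 1) \<alpha>. x = mv {..<r 1} (d 0) y)"
      using ker0[OF x] im[OF \<alpha>, of 0] by (auto simp: image_iff)
  next
    fix \<alpha> i and x :: "nat \<Rightarrow> 'k" assume \<alpha>: "\<alpha> \<in> vdeg V" and x: "x \<in> strand {..<r (Suc i)} (deg (Suc i)) \<alpha>"
    have "x \<in> gker (g (Suc i)) \<alpha> \<longleftrightarrow> mv {..<r (Suc i)} (d i) x = (\<lambda>_. 0)"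
      using x by (simp add: gker_def r_def deg_def d_def)
    then show "(mv {..<r (Suc i)} (d i) x = (\<lambda>_. 0)) =
       (\<exists>y\<in>strand {..<r (Suc (Suc i))} (deg (Suc (Suc i))) \<alpha>. x = mv {..<r (Suc (Suc i))} (d (Suc i)) y)"
      using im[OF \<alpha>, of "Suc i"] by (auto simp: image_iff)
  qed (use A A_up degs in auto)
  then show thesis using degs that by blast
qed

section \<open>Mapping cones\<close>

definition triple :: "('g \<Rightarrow> 'k) \<Rightarrow> ('h \<Rightarrow> 'k) \<Rightarrow> ('f \<Rightarrow> 'k) \<Rightarrow> 'g + 'h + 'f \<Rightarrow> 'k" where
  "triple x y z = case_sum x (case_sum y z)"

lemma triple_eq_iff: "triple x y z = triple x' y' z' \<longleftrightarrow> x = x' \<and> y = y' \<and> z = z'"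
  unfolding triple_def by (metis case_sum_o_inj(1,2))

lemma triple_exhaust: obtains x y z where "w = triple x y z"
proof
  show "w = triple (w \<circ> Inl) (w \<circ> Inr \<circ> Inl) (w \<circ> Inr \<circ> Inr)"
    by (auto simp: triple_def fun_eq_iff split: sum.split)
qed

lemma triple_zero: "(\<lambda>_. 0) = triple (\<lambda>_. 0) (\<lambda>_. 0) (\<lambda>_. 0)"
  by (auto simp: triple_def fun_eq_iff split: sum.split)

context
  fixes BG :: "nat \<Rightarrow> 'g set" and BH :: "nat \<Rightarrow> 'h set" and BF :: "nat \<Rightarrow> 'f set"
begin

definition cone_basis :: "nat \<Rightarrow> ('g + 'h + 'f) set" where
  "cone_basis i = BG i <+> (BH i <+> (case i of 0 \<Rightarrow> {} | Suc j \<Rightarrow> BF j))"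

text \<open>The third summand is shifted by one homological degree. At \<open>i = 0\<close> the
  truncated difference yields \<open>eF 0\<close>, which does no harm since
  \<open>cone_basis\<close> has no third summand there.\<close>

definition cone_deg ::
    "(nat \<Rightarrow> 'g \<Rightarrow> 'v \<Rightarrow> int) \<Rightarrow> (nat \<Rightarrow> 'h \<Rightarrow> 'v \<Rightarrow> int) \<Rightarrow> (nat \<Rightarrow> 'f \<Rightarrow> 'v \<Rightarrow> int) \<Rightarrow>
     nat \<Rightarrow> 'g + 'h + 'f \<Rightarrow> 'v \<Rightarrow> int" where
  "cone_deg eG eH eF i = case_sum (eG i) (case_sum (eH i) (eF (i - 1)))"

text \<open>The differential \<open>(x, y, z) \<mapsto> (d\<^sub>G x + f z, d\<^sub>H y - g z, - d\<^sub>F z)\<close>.\<close>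

definition cone_diff ::
    "(nat \<Rightarrow> 'g \<Rightarrow> 'g \<Rightarrow> 'k) \<Rightarrow> (nat \<Rightarrow> 'h \<Rightarrow> 'h \<Rightarrow> 'k) \<Rightarrow> (nat \<Rightarrow> 'f \<Rightarrow> 'f \<Rightarrow> 'k) \<Rightarrow>
     (nat \<Rightarrow> 'g \<Rightarrow> 'f \<Rightarrow> 'k) \<Rightarrow> (nat \<Rightarrow> 'h \<Rightarrow> 'f \<Rightarrow> 'k::field) \<Rightarrow> nat \<Rightarrow> 'g + 'h + 'f \<Rightarrow> 'g + 'h + 'f \<Rightarrow> 'k" where
  "cone_diff dG dH dF f g i a b =
    (case a of
      Inl a \<Rightarrow> triple (dG i a) (\<lambda>_. 0) (f i a) b
    | Inr (Inl a) \<Rightarrow> triple (\<lambda>_. 0) (dH i a) (\<lambda>b. - g i a b) b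
    | Inr (Inr a) \<Rightarrow> triple (\<lambda>_. 0) (\<lambda>_. 0) (\<lambda>b. case i of 0 \<Rightarrow> 0 | Suc j \<Rightarrow> - dF j a b) b)"

lemma triple_strand:
  "triple x y z \<in> strand (cone_basis i) (cone_deg eG eH eF i) \<alpha> \<longleftrightarrow>
    x \<in> strand (BG i) (eG i) \<alpha> \<and> y \<in> strand (BH i) (eH i) \<alpha> \<and>
    (case i of 0 \<Rightarrow> z = (\<lambda>_. 0) | Suc j \<Rightarrow> z \<in> strand (BF j) (eF j) \<alpha>)"
proof -
  have all: "(\<forall>b. P b) \<longleftrightarrow> (\<forall>a. P (Inl a)) \<and> (\<forall>a. P (Inr (Inl a))) \<and> (\<forall>a. P (Inr (Inr a)))"
    for P :: "'g + 'h + 'f \<Rightarrow> bool" by (metis sum.exhaust)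
  show ?thesis
    unfolding strand_def mem_Collect_eq all
    by (cases i) (auto simp: triple_def cone_basis_def cone_deg_def Plus_def fun_eq_iff)
qed

lemma mv_cone:
  assumes "finite (BG (Suc i))" "finite (BH (Suc i))" "finite (BF i)"
  shows "mv (cone_basis (Suc i)) (cone_diff dG dH dF f g i) (triple x y z) =
    triple (\<lambda>a. mv (BG (Suc i)) (dG i) x a + mv (BF i) (f i) z a)
      (\<lambda>a. mv (BH (Suc i)) (dH i) y a - mv (BF i) (g i) z a)
      (case i of 0 \<Rightarrow> (\<lambda>_. 0) | Suc j \<Rightarrow> (\<lambda>a. - mv (BF (Suc j)) (dF j) z a))"
proof
  fix a
  show "mv (cone_basis (Suc i)) (cone_diff dG dH dF f g i) (triple x y z) a =
    triple (\<lambda>a. mv (BG (Suc i)) (dG i) x a + mv (BF i) (f i) z a)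
      (\<lambda>a. mv (BH (Suc i)) (dH i) y a - mv (BF i) (g i) z a)
      (case i of 0 \<Rightarrow> (\<lambda>_. 0) | Suc j \<Rightarrow> (\<lambda>a. - mv (BF (Suc j)) (dF j) z a)) a"
    unfolding mv_def cone_basis_def
    using assms
    by (cases i) (auto simp: sum.Plus triple_def cone_diff_def sum_negf split: sum.split)
qed

end

context scalar_res
begin

lemma mv_d_d: "mv (B (Suc i)) (d i) (mv (B (Suc (Suc i))) (d (Suc i)) y) = (\<lambda>_. 0)"
  unfolding mv_mv d_d by (simp add: mv_def)

lemma cycle_bounds:
  assumes "\<alpha> \<in> vdeg V" "x \<in> strand (B (Suc i)) (deg (Suc i)) \<alpha>" "mv (B (Suc i)) (d i) x = (\<lambda>_. 0)"
  obtains y where "y \<in> strand (B (Suc (Suc i))) (deg (Suc (Suc i))) \<alpha>"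
    "x = mv (B (Suc (Suc i))) (d (Suc i)) y"
  using exact_Suc[OF assms(1,2)] assms(3) by blast

lemma cycle_bounds_0:
  assumes "\<alpha> \<in> vdeg V" "x \<in> strand (B 0) (deg 0) \<alpha>" "(\<Sum>b\<in>B 0. \<epsilon> b * x b) = 0"
  obtains y where "y \<in> strand (B (Suc 0)) (deg (Suc 0)) \<alpha>" "x = mv (B (Suc 0)) (d 0) y"
  using exact0[OF assms(1,2)] assms(3) unfolding One_nat_def by blast

lemma \<epsilon>_mv_d:
  assumes "Q = {}" "\<alpha> \<in> vdeg V" "y \<in> strand (B (Suc 0)) (deg (Suc 0)) \<alpha>"
  shows "(\<Sum>b\<in>B 0. \<epsilon> b * mv (B (Suc 0)) (d 0) y b) = 0"
proof -
  have "\<exists>y'\<in>strand (B 1) (deg 1) \<alpha>. mv (B (Suc 0)) (d 0) y = mv (B 1) (d 0) y'"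
    using assms(3) by (intro bexI[of _ y]) simp_all
  then have "\<alpha> \<notin> Q \<longrightarrow> (\<Sum>b\<in>B 0. \<epsilon> b * mv (B (Suc 0)) (d 0) y b) = 0"
    by (rule exact0[OF assms(2) mv_d_strand[OF assms(3)], THEN iffD2])
  with assms(1) show ?thesis by simp
qed

end

text \<open>The sum J + K is the cokernel of the map z to (z, -z) from the intersection into the
  direct sum, so the cone of the lifted map resolves it. The disjointness of degrees turns the weak
  inequalities for the comparison maps into strict ones, which is minimality of the cone.\<close>

lemma scalar_res_cone:
  fixes dG :: "nat \<Rightarrow> 'g \<Rightarrow> 'g \<Rightarrow> 'k::field" and dH :: "nat \<Rightarrow> 'h \<Rightarrow> 'h \<Rightarrow> 'k"
    and dF :: "nat \<Rightarrow> 'f \<Rightarrow> 'f \<Rightarrow> 'k"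
  assumes "scalar_res V A {} BG eG dG \<epsilon>G" and "scalar_res V A' {} BH eH dH \<epsilon>H"
    and "scalar_res V (A \<inter> A') {} BF eF dF \<epsilon>F"
    and disjoint_G: "\<And>i a b. a \<in> BG i \<Longrightarrow> b \<in> BF i \<Longrightarrow> eG i a \<noteq> eF i b"
    and disjoint_H: "\<And>i a b. a \<in> BH i \<Longrightarrow> b \<in> BF i \<Longrightarrow> eH i a \<noteq> eF i b"
  obtains d :: "nat \<Rightarrow> 'g + 'h + 'f \<Rightarrow> 'g + 'h + 'f \<Rightarrow> 'k" and \<epsilon> where
    "scalar_res V (A \<union> A') {} (cone_basis BG BH BF) (cone_deg eG eH eF) d \<epsilon>"
proof -
  interpret G: scalar_res V A "{}" BG eG dG \<epsilon>G by fact
  interpret H: scalar_res V A' "{}" BH eH dH \<epsilon>H by fact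
  interpret F: scalar_res V "A \<inter> A'" "{}" BF eF dF \<epsilon>F by fact
  obtain f where f: "\<And>i c b. f i c b \<noteq> 0 \<Longrightarrow> c \<in> BG i \<and> b \<in> BF i \<and> eG i c \<le> eF i b"
    "\<And>b. b \<in> BF 0 \<Longrightarrow> eF 0 b \<notin> {} \<Longrightarrow> (\<Sum>c\<in>BG 0. \<epsilon>G c * f 0 c b) = \<epsilon>F b"
    "\<And>i b. mv (BG (Suc i)) (dG i) (\<lambda>c. f (Suc i) c b) = mv (BF i) (f i) (\<lambda>a. dF i a b)"
    using comparison_map[OF assms(3,1) inf_le1] by blast
  obtain g where g: "\<And>i c b. g i c b \<noteq> 0 \<Longrightarrow> c \<in> BH i \<and> b \<in> BF i \<and> eH i c \<le> eF i b"
    "\<And>b. b \<in> BF 0 \<Longrightarrow> eF 0 b \<notin> {} \<Longrightarrow> (\<Sum>c\<in>BH 0. \<epsilon>H c * g 0 c b) = \<epsilon>F b"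
    "\<And>i b. mv (BH (Suc i)) (dH i) (\<lambda>c. g (Suc i) c b) = mv (BF i) (g i) (\<lambda>a. dF i a b)"
    using comparison_map[OF assms(3,2) inf_le2] by blast
  let ?C = "cone_basis BG BH BF" and ?deg = "cone_deg eG eH eF"
  define d where "d = cone_diff dG dH dF f g"
  define \<epsilon> where "\<epsilon> = triple \<epsilon>G \<epsilon>H (\<lambda>_::'f. 0)"
  have f_chain: "mv (BG (Suc i)) (dG i) (mv (BF (Suc i)) (f (Suc i)) z) =
      mv (BF i) (f i) (mv (BF (Suc i)) (dF i) z)" for i z
    unfolding mv_mv f(3) by (rule refl)
  have g_chain: "mv (BH (Suc i)) (dH i) (mv (BF (Suc i)) (g (Suc i)) z) =
      mv (BF i) (g i) (mv (BF (Suc i)) (dF i) z)" for i z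
    unfolding mv_mv g(3) by (rule refl)
  have aug: "(\<Sum>c\<in>X. e c * mv (BF 0) h z c) = (\<Sum>b\<in>BF 0. \<epsilon>F b * z b)"
    if "\<And>b. b \<in> BF 0 \<Longrightarrow> (\<Sum>c\<in>X. e c * h c b) = \<epsilon>F b" for X :: "'x set" and e h z
  proof -
    have "(\<Sum>c\<in>X. e c * mv (BF 0) h z c) = (\<Sum>c\<in>X. \<Sum>b\<in>BF 0. e c * h c b * z b)"
      by (simp add: mv_def sum_distrib_left mult.assoc)
    also have "\<dots> = (\<Sum>b\<in>BF 0. \<Sum>c\<in>X. e c * h c b * z b)" by (rule sum.swap)
    also have "\<dots> = (\<Sum>b\<in>BF 0. (\<Sum>c\<in>X. e c * h c b) * z b)" by (simp add: sum_distrib_right)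
    also have "\<dots> = (\<Sum>b\<in>BF 0. \<epsilon>F b * z b)" using that by (intro sum.cong) auto
    finally show ?thesis .
  qed
  have f_aug: "(\<Sum>c\<in>BG 0. \<epsilon>G c * mv (BF 0) (f 0) z c) = (\<Sum>b\<in>BF 0. \<epsilon>F b * z b)" for z
    by (rule aug) (use f(2) in simp)
  have g_aug: "(\<Sum>c\<in>BH 0. \<epsilon>H c * mv (BF 0) (g 0) z c) = (\<Sum>b\<in>BF 0. \<epsilon>F b * z b)" for z
    by (rule aug) (use g(2) in simp)
  have f_strand: "mv (BF i) (f i) z \<in> strand (BG i) (eG i) \<alpha>" if "z \<in> strand (BF i) (eF i) \<alpha>" for i z \<alpha>
    by (rule mv_strand[OF _ that]) (use f(1) in blast)
  have g_strand: "mv (BF i) (g i) z \<in> strand (BH i) (eH i) \<alpha>" if "z \<in> strand (BF i) (eF i) \<alpha>" for i z \<alpha>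
    by (rule mv_strand[OF _ that]) (use g(1) in blast)
  have mv_C: "mv (?C (Suc i)) (d i) (triple x y z) =
    triple (\<lambda>a. mv (BG (Suc i)) (dG i) x a + mv (BF i) (f i) z a)
      (\<lambda>a. mv (BH (Suc i)) (dH i) y a - mv (BF i) (g i) z a)
      (case i of 0 \<Rightarrow> (\<lambda>_. 0) | Suc j \<Rightarrow> (\<lambda>a. - mv (BF (Suc j)) (dF j) z a))" for i x y z
    unfolding d_def by (rule mv_cone) (rule G.finite_B H.finite_B F.finite_B)+
  have \<epsilon>_C: "(\<Sum>b\<in>?C 0. \<epsilon> b * triple x y z b) = (\<Sum>b\<in>BG 0. \<epsilon>G b * x b) + (\<Sum>b\<in>BH 0. \<epsilon>H b * y b)" for x y z
    using G.finite_B H.finite_B by (simp add: cone_basis_def sum.Plus \<epsilon>_def triple_def)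
  \<comment> \<open>The third component of a cycle is a cycle of F. In degree 0 this is read off
    from the first row: \<epsilon>F z = \<epsilon>G (f z) = - \<epsilon>G (dG x) = 0.\<close>
  have cycle_F: "\<exists>w\<in>strand (BF (Suc i)) (eF (Suc i)) \<alpha>. z = mv (BF (Suc i)) (dF i) w"
    if \<alpha>: "\<alpha> \<in> vdeg V" and str: "x \<in> strand (BG (Suc i)) (eG (Suc i)) \<alpha>" "z \<in> strand (BF i) (eF i) \<alpha>"
      and cyc: "mv (?C (Suc i)) (d i) (triple x y z) = (\<lambda>_. 0)" for i \<alpha> x y z
  proof (cases i)
    case 0
    from cyc have eq: "mv (BG (Suc 0)) (dG 0) x a + mv (BF 0) (f 0) z a = 0" for a
      unfolding 0 mv_C triple_zero triple_eq_iff by (auto dest: fun_cong[of _ _ a])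
    have "(\<Sum>b\<in>BF 0. \<epsilon>F b * z b) = (\<Sum>c\<in>BG 0. \<epsilon>G c * mv (BF 0) (f 0) z c) +
       (\<Sum>c\<in>BG 0. \<epsilon>G c * mv (BG (Suc 0)) (dG 0) x c)"
      using G.\<epsilon>_mv_d[OF refl \<alpha> str(1)[unfolded 0]] by (simp add: f_aug)
    also have "\<dots> = (\<Sum>c\<in>BG 0. \<epsilon>G c * (mv (BG (Suc 0)) (dG 0) x c + mv (BF 0) (f 0) z c))"
      by (simp add: ring_distribs sum.distrib)
    finally have "(\<Sum>b\<in>BF 0. \<epsilon>F b * z b) = 0" by (simp add: eq)
    from F.cycle_bounds_0[OF \<alpha> str(2)[unfolded 0] this] show ?thesis unfolding 0 by blast
  next
    case (Suc j)
    from cyc have "(\<lambda>a. - mv (BF (Suc j)) (dF j) z a) = (\<lambda>_. 0)"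
      unfolding Suc mv_C triple_zero triple_eq_iff by simp
    then have "mv (BF (Suc j)) (dF j) z = (\<lambda>_. 0)" by (simp add: fun_eq_iff)
    from F.cycle_bounds[OF \<alpha> str(2)[unfolded Suc] this] show ?thesis unfolding Suc by blast
  qed
  have "scalar_res V (A \<union> A') {} ?C ?deg d \<epsilon>"
  proof unfold_locales
    show "A \<union> A' \<subseteq> vdeg V" using G.A_vdeg H.A_vdeg by blast
    show "\<beta> \<in> A \<union> A'" if "\<alpha> \<in> A \<union> A'" "\<beta> \<in> vdeg V" "\<alpha> \<le> \<beta>" for \<alpha> \<beta>
      using that G.A_up H.A_up by blast
    show "finite (?C i)" for i
      using G.finite_B H.finite_B F.finite_B by (cases i) (simp_all add: cone_basis_def)
    show "?deg i b \<in> vdeg V" if "b \<in> ?C i" for i b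
      using that G.deg_vdeg H.deg_vdeg F.deg_vdeg
      by (cases i) (auto simp: cone_basis_def cone_deg_def)
  next
    fix i a b assume nz: "d i a b \<noteq> 0"
    have lt_f: "eG i a < eF i b" if "f i a b \<noteq> 0" for a b
      using f(1)[OF that] disjoint_G by (simp add: order_less_le)
    have lt_g: "eH i a < eF i b" if "g i a b \<noteq> 0" for a b
      using g(1)[OF that] disjoint_H by (simp add: order_less_le)
    show "a \<in> ?C i \<and> b \<in> ?C (Suc i) \<and> ?deg i a < ?deg (Suc i) b"
      using nz G.d_nz[of i] H.d_nz[of i] f(1)[of i] g(1)[of i] lt_f lt_g F.d_nz[of "i - 1"]
      by (auto simp: d_def cone_diff_def triple_def cone_basis_def cone_deg_def split: sum.splits nat.splits)
  next
    fix b assume "\<epsilon> b \<noteq> 0"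
    then show "b \<in> ?C 0 \<and> ?deg 0 b \<in> A \<union> A'"
      using G.\<epsilon>_nz H.\<epsilon>_nz by (auto simp: \<epsilon>_def triple_def cone_basis_def cone_deg_def split: sum.splits)
  next
    fix \<alpha> assume "\<alpha> \<in> A \<union> A'"
    then consider x where "x \<in> strand (BG 0) (eG 0) \<alpha>" "(\<Sum>b\<in>BG 0. \<epsilon>G b * x b) = 1"
      | y where "y \<in> strand (BH 0) (eH 0) \<alpha>" "(\<Sum>b\<in>BH 0. \<epsilon>H b * y b) = 1"
      using G.surj H.surj by blast
    then show "\<exists>x\<in>strand (?C 0) (?deg 0) \<alpha>. (\<Sum>b\<in>?C 0. \<epsilon> b * x b) = 1"
    proof cases
      case 1
      then show ?thesis
        by (intro bexI[of _ "triple x (\<lambda>_. 0) (\<lambda>_. 0)"]) (simp_all add: triple_strand \<epsilon>_C)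
    next
      case 2
      then show ?thesis
        by (intro bexI[of _ "triple (\<lambda>_. 0) y (\<lambda>_. 0)"]) (simp_all add: triple_strand \<epsilon>_C)
    qed
  next
    fix \<alpha> and w :: "'g + 'h + 'f \<Rightarrow> 'k" assume \<alpha>: "\<alpha> \<in> vdeg V" and w: "w \<in> strand (?C 0) (?deg 0) \<alpha>"
    obtain x y z where xyz: "w = triple x y z" by (rule triple_exhaust)
    have str: "x \<in> strand (BG 0) (eG 0) \<alpha>" "y \<in> strand (BH 0) (eH 0) \<alpha>" and z: "z = (\<lambda>_. 0)"
      using w by (simp_all add: xyz triple_strand)
    have "\<exists>v\<in>strand (?C (Suc 0)) (?deg (Suc 0)) \<alpha>. w = mv (?C (Suc 0)) (d 0) v"
      if sum0: "(\<Sum>b\<in>BG 0. \<epsilon>G b * x b) + (\<Sum>b\<in>BH 0. \<epsilon>H b * y b) = 0"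
    proof -
      define c where "c = (\<Sum>b\<in>BG 0. \<epsilon>G b * x b)"
      \<comment> \<open>The two augmentations are c and -c. If c is nonzero, both ideals contain
        \<alpha>, so \<alpha> lies in the intersection and c is hit from F; subtracting f u and
        adding g u then makes both components cycles.\<close>
      have "\<exists>u\<in>strand (BF 0) (eF 0) \<alpha>. (\<Sum>b\<in>BF 0. \<epsilon>F b * u b) = c"
      proof (cases "c = 0")
        case True
        then show ?thesis by (intro bexI[of _ "\<lambda>_. 0"]) simp_all
      next
        case False
        obtain a where a: "a \<in> BG 0" "\<epsilon>G a * x a \<noteq> 0"
          using False unfolding c_def by (meson sum.neutral)
        then have "\<alpha> \<in> A" using G.\<epsilon>_nz[of a] strandD[OF str(1), of a] G.A_up[OF _ \<alpha>] by auto
        moreover obtain a' where a': "a' \<in> BH 0" "\<epsilon>H a' * y a' \<noteq> 0"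
        proof -
          have "(\<Sum>b\<in>BH 0. \<epsilon>H b * y b) \<noteq> 0" using False sum0 by (auto simp: c_def)
          then show thesis using that by (meson sum.neutral)
        qed
        then have "\<alpha> \<in> A'" using H.\<epsilon>_nz[of a'] strandD[OF str(2), of a'] H.A_up[OF _ \<alpha>] by auto
        ultimately obtain u where u: "u \<in> strand (BF 0) (eF 0) \<alpha>" "(\<Sum>b\<in>BF 0. \<epsilon>F b * u b) = 1"
          using F.surj by blast
        have "(\<Sum>b\<in>BF 0. \<epsilon>F b * (c * u b)) = c * (\<Sum>b\<in>BF 0. \<epsilon>F b * u b)"
          by (simp add: sum_distrib_left mult.left_commute)
        with u show ?thesis by (intro bexI[of _ "\<lambda>b. c * u b"]) (simp_all add: strand_scale)
      qed
      then obtain u where u: "u \<in> strand (BF 0) (eF 0) \<alpha>" "(\<Sum>b\<in>BF 0. \<epsilon>F b * u b) = c" by blast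
      have "(\<Sum>b\<in>BG 0. \<epsilon>G b * (x b - mv (BF 0) (f 0) u b)) = 0"
        using u(2) by (simp add: right_diff_distrib sum_subtractf f_aug c_def)
      from G.cycle_bounds_0[OF \<alpha> strand_diff[OF str(1) f_strand[OF u(1)]] this]
      obtain x' where x': "x' \<in> strand (BG (Suc 0)) (eG (Suc 0)) \<alpha>"
        "(\<lambda>b. x b - mv (BF 0) (f 0) u b) = mv (BG (Suc 0)) (dG 0) x'" .
      have "(\<Sum>b\<in>BH 0. \<epsilon>H b * (y b + mv (BF 0) (g 0) u b)) = 0"
        using u(2) sum0 by (simp add: ring_distribs sum.distrib g_aug c_def add.commute)
      from H.cycle_bounds_0[OF \<alpha> strand_add[OF str(2) g_strand[OF u(1)]] this]
      obtain y' where y': "y' \<in> strand (BH (Suc 0)) (eH (Suc 0)) \<alpha>"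
        "(\<lambda>b. y b + mv (BF 0) (g 0) u b) = mv (BH (Suc 0)) (dH 0) y'" .
      show ?thesis
      proof (rule bexI[of _ "triple x' y' u"])
        show "w = mv (?C (Suc 0)) (d 0) (triple x' y' u)"
          unfolding xyz mv_C triple_eq_iff x'(2)[symmetric] y'(2)[symmetric] by (simp add: z)
      qed (simp add: triple_strand x' y' u)
    qed
    moreover have "(\<Sum>b\<in>BG 0. \<epsilon>G b * x b) + (\<Sum>b\<in>BH 0. \<epsilon>H b * y b) = 0"
      if v: "v\<in>strand (?C (Suc 0)) (?deg (Suc 0)) \<alpha>" "w = mv (?C (Suc 0)) (d 0) v" for v
    proof -
      obtain x' y' u where v': "v = triple x' y' u" by (rule triple_exhaust)
      have s: "x' \<in> strand (BG (Suc 0)) (eG (Suc 0)) \<alpha>" "y' \<in> strand (BH (Suc 0)) (eH (Suc 0)) \<alpha>"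
        using v(1) by (simp_all add: v' triple_strand)
      have eqs: "x = (\<lambda>a. mv (BG (Suc 0)) (dG 0) x' a + mv (BF 0) (f 0) u a)"
        "y = (\<lambda>a. mv (BH (Suc 0)) (dH 0) y' a - mv (BF 0) (g 0) u a)"
        using v(2) unfolding xyz v' mv_C triple_eq_iff by simp_all
      show ?thesis
        unfolding eqs using G.\<epsilon>_mv_d[OF refl \<alpha> s(1)] H.\<epsilon>_mv_d[OF refl \<alpha> s(2)]
        by (simp add: ring_distribs sum.distrib sum_subtractf f_aug g_aug)
    qed
    ultimately show "(\<alpha> \<notin> {} \<longrightarrow> (\<Sum>b\<in>?C 0. \<epsilon> b * w b) = 0) =
        (\<exists>y\<in>strand (?C 1) (?deg 1) \<alpha>. w = mv (?C 1) (d 0) y)"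
      unfolding xyz \<epsilon>_C One_nat_def by blast
  next
    fix \<alpha> i and w :: "'g + 'h + 'f \<Rightarrow> 'k" assume \<alpha>: "\<alpha> \<in> vdeg V" and w: "w \<in> strand (?C (Suc i)) (?deg (Suc i)) \<alpha>"
    obtain x y z where xyz: "w = triple x y z" by (rule triple_exhaust)
    have str: "x \<in> strand (BG (Suc i)) (eG (Suc i)) \<alpha>" "y \<in> strand (BH (Suc i)) (eH (Suc i)) \<alpha>"
      "z \<in> strand (BF i) (eF i) \<alpha>"
      using w by (simp_all add: xyz triple_strand)
    show "(mv (?C (Suc i)) (d i) w = (\<lambda>_. 0)) =
       (\<exists>y\<in>strand (?C (Suc (Suc i))) (?deg (Suc (Suc i))) \<alpha>. w = mv (?C (Suc (Suc i))) (d (Suc i)) y)"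
    proof
      assume cyc: "mv (?C (Suc i)) (d i) w = (\<lambda>_. 0)"
      obtain u where u: "u \<in> strand (BF (Suc i)) (eF (Suc i)) \<alpha>" "z = mv (BF (Suc i)) (dF i) u"
        using cycle_F[OF \<alpha> str(1,3) cyc[unfolded xyz]] by blast
      have eq: "(\<lambda>a. mv (BG (Suc i)) (dG i) x a + mv (BF i) (f i) z a) = (\<lambda>_. 0)"
        "(\<lambda>a. mv (BH (Suc i)) (dH i) y a - mv (BF i) (g i) z a) = (\<lambda>_. 0)"
        using cyc unfolding xyz mv_C triple_zero triple_eq_iff by simp_all
      have "mv (BG (Suc i)) (dG i) (\<lambda>b. x b + mv (BF (Suc i)) (f (Suc i)) u b) = (\<lambda>_. 0)"
        unfolding mv_add f_chain u(2)[symmetric] by (rule eq)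
      from G.cycle_bounds[OF \<alpha> strand_add[OF str(1) f_strand[OF u(1)]] this]
      obtain x' where x': "x' \<in> strand (BG (Suc (Suc i))) (eG (Suc (Suc i))) \<alpha>"
        "(\<lambda>b. x b + mv (BF (Suc i)) (f (Suc i)) u b) = mv (BG (Suc (Suc i))) (dG (Suc i)) x'" .
      have "mv (BH (Suc i)) (dH i) (\<lambda>b. y b - mv (BF (Suc i)) (g (Suc i)) u b) = (\<lambda>_. 0)"
        unfolding mv_diff g_chain u(2)[symmetric] by (rule eq)
      from H.cycle_bounds[OF \<alpha> strand_diff[OF str(2) g_strand[OF u(1)]] this]
      obtain y' where y': "y' \<in> strand (BH (Suc (Suc i))) (eH (Suc (Suc i))) \<alpha>"
        "(\<lambda>b. y b - mv (BF (Suc i)) (g (Suc i)) u b) = mv (BH (Suc (Suc i))) (dH (Suc i)) y'" .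
      show "\<exists>y\<in>strand (?C (Suc (Suc i))) (?deg (Suc (Suc i))) \<alpha>. w = mv (?C (Suc (Suc i))) (d (Suc i)) y"
      \<comment> \<open>The sign compensates for the minus in front of \<open>dF\<close> in the cone
        differential.\<close>
      proof (rule bexI[of _ "triple x' y' (\<lambda>b. - u b)"])
        show "w = mv (?C (Suc (Suc i))) (d (Suc i)) (triple x' y' (\<lambda>b. - u b))"
          unfolding xyz mv_C triple_eq_iff x'(2)[symmetric] y'(2)[symmetric] mv_uminus by (simp add: u(2))
      qed (simp add: triple_strand x' y' u strand_uminus)
    next
      assume "\<exists>y\<in>strand (?C (Suc (Suc i))) (?deg (Suc (Suc i))) \<alpha>. w = mv (?C (Suc (Suc i))) (d (Suc i)) y"
      then obtain v where v: "w = mv (?C (Suc (Suc i))) (d (Suc i)) v" by blast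
      obtain x' y' u where v': "v = triple x' y' u" by (rule triple_exhaust)
      have eqs: "w = triple (\<lambda>a. mv (BG (Suc (Suc i))) (dG (Suc i)) x' a + mv (BF (Suc i)) (f (Suc i)) u a)
        (\<lambda>a. mv (BH (Suc (Suc i))) (dH (Suc i)) y' a - mv (BF (Suc i)) (g (Suc i)) u a)
        (\<lambda>a. - mv (BF (Suc i)) (dF i) u a)"
        unfolding v v' mv_C by simp
      show "mv (?C (Suc i)) (d i) w = (\<lambda>_. 0)"
        unfolding eqs mv_C triple_zero triple_eq_iff mv_add mv_diff mv_uminus f_chain g_chain
          G.mv_d_d H.mv_d_d
        by (cases i) (simp_all add: F.mv_d_d)
    qed
  qed simp_all
  then show thesis by (rule that)
qed

section \<open>Extension of the ring, multiplication by a monomial, and quotient rings\<close>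

definition vrestr :: "'v set \<Rightarrow> ('v \<Rightarrow> int) \<Rightarrow> 'v \<Rightarrow> int" where
  "vrestr W \<alpha> = (\<lambda>v. if v \<in> W then \<alpha> v else 0)"

text \<open>Polynomial extension is flat and multiplication by a monomial shifts degrees. In terms
  of strands: the strand at \<alpha> is the old strand at the restriction of \<alpha> to
  \<open>W\<close> if \<open>u\<close> divides \<alpha> outside \<open>W\<close>, and zero
  otherwise, so exactness is inherited with unchanged scalars.\<close>

lemma scalar_res_extend:
  fixes d :: "nat \<Rightarrow> 'b \<Rightarrow> 'b \<Rightarrow> 'k::field"
  assumes "scalar_res W A {} B deg d \<epsilon>" and WV: "W \<subseteq> V" and u: "u \<in> vdeg (V - W)"
    and A': "A' = {\<alpha> \<in> vdeg V. (\<forall>v\<in>V - W. u v \<le> \<alpha> v) \<and> vrestr W \<alpha> \<in> A}"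
  shows "scalar_res V A' {} B (\<lambda>i b v. deg i b v + u v) d \<epsilon>"
proof -
  interpret scalar_res W A "{}" B deg d \<epsilon> by fact
  let ?deg = "\<lambda>i b v. deg i b v + u v"
  have rW: "vrestr W \<alpha> \<in> vdeg W" for \<alpha> by (simp add: vdeg_def vrestr_def)
  have le: "?deg i b \<le> \<alpha> \<longleftrightarrow> (\<forall>v\<in>V - W. u v \<le> \<alpha> v) \<and> deg i b \<le> vrestr W \<alpha>"
    if b: "b \<in> B i" and \<alpha>: "\<alpha> \<in> vdeg V" for b i \<alpha>
  proof -
    have 1: "deg i b v = 0" if "v \<notin> W" for v using deg_vdeg[OF b] that by (simp add: vdeg_def)
    have 2: "u v = 0" if "v \<in> W \<or> v \<notin> V" for v using u that by (auto simp: vdeg_def)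
    have 3: "\<alpha> v = 0" if "v \<notin> V" for v using \<alpha> that by (simp add: vdeg_def)
    have "deg i b v + u v \<le> \<alpha> v \<longleftrightarrow> (v \<in> V - W \<longrightarrow> u v \<le> \<alpha> v) \<and> deg i b v \<le> vrestr W \<alpha> v" for v
      using 1[of v] 2[of v] 3[of v] WV by (auto simp: vrestr_def)
    then show ?thesis unfolding le_fun_def by blast
  qed
  have str: "strand (B i) (?deg i) \<alpha> = strand (B i) (deg i) (vrestr W \<alpha>)"
    if "\<alpha> \<in> vdeg V" "\<forall>v\<in>V - W. u v \<le> \<alpha> v" for \<alpha> i
    unfolding strand_def using le[OF _ that(1)] that(2) by blast
  have str0: "x = (\<lambda>_. 0)"
    if "\<alpha> \<in> vdeg V" "\<not> (\<forall>v\<in>V - W. u v \<le> \<alpha> v)" "x \<in> strand (B i) (?deg i) \<alpha>" for \<alpha> i and x :: "'b \<Rightarrow> 'k"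
    using le[OF _ that(1)] that(2,3) unfolding strand_def by blast
  show ?thesis
  proof unfold_locales
    show "A' \<subseteq> vdeg V" by (auto simp: A')
    show "\<beta> \<in> A'" if "\<alpha> \<in> A'" "\<beta> \<in> vdeg V" "\<alpha> \<le> \<beta>" for \<alpha> \<beta>
    proof -
      have "vrestr W \<alpha> \<le> vrestr W \<beta>" using that(3) by (simp add: vrestr_def le_fun_def)
      then have "vrestr W \<beta> \<in> A" using that(1) A_up[OF _ rW] by (auto simp: A')
      moreover have "\<forall>v\<in>V - W. u v \<le> \<beta> v"
        using that(1,3) unfolding A' le_fun_def by (blast intro: order_trans)
      ultimately show ?thesis using that(2) by (simp add: A')
    qed
    show "finite (B i)" for i by (rule finite_B)
    show dV: "?deg i b \<in> vdeg V" if "b \<in> B i" for i b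
      using deg_vdeg[OF that] u WV by (auto simp: vdeg_def)
    show "a \<in> B i \<and> b \<in> B (Suc i) \<and> ?deg i a < ?deg (Suc i) b" if "d i a b \<noteq> 0" for i a b
      using d_nz[OF that] unfolding less_le_not_le le_fun_def by simp
    show "b \<in> B 0 \<and> ?deg 0 b \<in> A'" if "\<epsilon> b \<noteq> 0" for b
    proof -
      have b: "b \<in> B 0" "deg 0 b \<in> A" using \<epsilon>_nz[OF that] by auto
      have "vrestr W (?deg 0 b) = deg 0 b"
        using deg_vdeg[OF b(1)] u by (auto simp: vrestr_def vdeg_def)
      then show ?thesis using b dV[OF b(1)] deg_vdeg[OF b(1)] by (auto simp: A' vdeg_def)
    qed
    show "\<exists>x\<in>strand (B 0) (?deg 0) \<alpha>. (\<Sum>b\<in>B 0. \<epsilon> b * x b) = 1" if "\<alpha> \<in> A'" for \<alpha>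
      using surj[of "vrestr W \<alpha>"] that str[of \<alpha> 0] by (auto simp: A')
  next
    fix \<alpha> and x :: "'b \<Rightarrow> 'k" assume \<alpha>: "\<alpha> \<in> vdeg V" and x: "x \<in> strand (B 0) (?deg 0) \<alpha>"
    show "(\<alpha> \<notin> {} \<longrightarrow> (\<Sum>b\<in>B 0. \<epsilon> b * x b) = 0) = (\<exists>y\<in>strand (B 1) (?deg 1) \<alpha>. x = mv (B 1) (d 0) y)"
    proof (cases "\<forall>v\<in>V - W. u v \<le> \<alpha> v")
      case True
      show ?thesis using exact0[OF rW, of x \<alpha>] x unfolding str[OF \<alpha> True] by simp
    next
      case False
      then show ?thesis using str0[OF \<alpha> False x] by (auto intro!: bexI[of _ "\<lambda>_. 0"])
    qed
  next
    fix \<alpha> i and x :: "'b \<Rightarrow> 'k" assume \<alpha>: "\<alpha> \<in> vdeg V" and x: "x \<in> strand (B (Suc i)) (?deg (Suc i)) \<alpha>"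
    show "(mv (B (Suc i)) (d i) x = (\<lambda>_. 0)) =
       (\<exists>y\<in>strand (B (Suc (Suc i))) (?deg (Suc (Suc i))) \<alpha>. x = mv (B (Suc (Suc i))) (d (Suc i)) y)"
    proof (cases "\<forall>v\<in>V - W. u v \<le> \<alpha> v")
      case True
      show ?thesis using exact_Suc[OF rW, of x i \<alpha>] x unfolding str[OF \<alpha> True] by simp
    next
      case False
      then show ?thesis using str0[OF \<alpha> False x] by (auto intro!: bexI[of _ "\<lambda>_. 0"])
    qed
  qed simp_all
qed

text \<open>A resolution of the ideal is spliced with the inclusion of the ideal into the ring: the
  old augmentation becomes the first differential. That the ideal is proper keeps this differential
  free of units.\<close>

lemma scalar_res_quotient:
  fixes d :: "nat \<Rightarrow> nat \<Rightarrow> nat \<Rightarrow> 'k::field"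
  assumes "scalar_res V A {} B deg d \<epsilon>" and A: "\<And>\<alpha>. \<alpha> \<in> A \<Longrightarrow> (\<lambda>_. 0) \<le> \<alpha>" "(\<lambda>_. 0) \<notin> A"
  shows "scalar_res V {\<alpha> \<in> vdeg V. (\<lambda>_. 0) \<le> \<alpha>} A
    (\<lambda>i. case i of 0 \<Rightarrow> {0} | Suc j \<Rightarrow> B j) (\<lambda>i b. case i of 0 \<Rightarrow> (\<lambda>_. 0) | Suc j \<Rightarrow> deg j b)
    (\<lambda>i a b. case i of 0 \<Rightarrow> if a = 0 then \<epsilon> b else 0 | Suc j \<Rightarrow> d j a b)
    (\<lambda>b. if b = 0 then 1 else 0)"
proof -
  interpret scalar_res V A "{}" B deg d \<epsilon> by fact
  have mv0: "mv (B 0) (\<lambda>a b. if a = 0 then \<epsilon> b else 0) y = (\<lambda>a. if a = (0::nat) then \<Sum>b\<in>B 0. \<epsilon> b * y b else 0)" for y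
    by (auto simp: mv_def)
  show ?thesis
  proof unfold_locales
    fix i a b assume nz: "(case i of 0 \<Rightarrow> if a = 0 then \<epsilon> b else 0 | Suc j \<Rightarrow> d j a b) \<noteq> 0"
    show "a \<in> (case i of 0 \<Rightarrow> {0} | Suc j \<Rightarrow> B j) \<and>
       b \<in> (case Suc i of 0 \<Rightarrow> {0} | Suc j \<Rightarrow> B j) \<and>
       (case i of 0 \<Rightarrow> \<lambda>_. 0 | Suc j \<Rightarrow> deg j a) < (case Suc i of 0 \<Rightarrow> \<lambda>_. 0 | Suc j \<Rightarrow> deg j b)"
    proof (cases i)
      case 0
      with nz have "a = 0" "\<epsilon> b \<noteq> 0" by (simp_all split: if_splits)
      with \<epsilon>_nz[of b] A(1)[of "deg 0 b"] A(2) have "b \<in> B 0" "(\<lambda>_. 0) < deg 0 b"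
        by (auto simp: order_less_le)
      with \<open>a = 0\<close> show ?thesis by (simp add: 0)
    next
      case (Suc j)
      with nz d_nz[of j a b] show ?thesis by simp
    qed
  next
    fix \<alpha> and x :: "nat \<Rightarrow> 'k" assume \<alpha>: "\<alpha> \<in> vdeg V"
      and "x \<in> strand (case 0 of 0 \<Rightarrow> {0} | Suc j \<Rightarrow> B j) (\<lambda>b. case 0 of 0 \<Rightarrow> \<lambda>_. 0 | Suc j \<Rightarrow> deg j b) \<alpha>"
    then have x: "x b = 0" if "b \<noteq> 0" for b using that by (auto simp: strand_def)
    have "(\<alpha> \<notin> A \<longrightarrow> x 0 = 0) = (\<exists>y\<in>strand (B 0) (deg 0) \<alpha>. x = mv (B 0) (\<lambda>a b. if a = 0 then \<epsilon> b else 0) y)"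
    proof
      assume l: "\<alpha> \<notin> A \<longrightarrow> x 0 = 0"
      show "\<exists>y\<in>strand (B 0) (deg 0) \<alpha>. x = mv (B 0) (\<lambda>a b. if a = 0 then \<epsilon> b else 0) y"
      proof (cases "\<alpha> \<in> A")
        case True
        then obtain y where y: "y\<in>strand (B 0) (deg 0) \<alpha>" "(\<Sum>b\<in>B 0. \<epsilon> b * y b) = 1" using surj by blast
        have "(\<Sum>b\<in>B 0. \<epsilon> b * (x 0 * y b)) = x 0 * (\<Sum>b\<in>B 0. \<epsilon> b * y b)"
          by (simp add: sum_distrib_left mult.left_commute)
        then have "x = mv (B 0) (\<lambda>a b. if a = 0 then \<epsilon> b else 0) (\<lambda>b. x 0 * y b)"
          unfolding mv0 using x y(2) by auto
        then show ?thesis using strand_scale[OF y(1)] by blast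
      next
        case False
        then have "x b = 0" for b using l x by (cases "b = 0") simp_all
        then have "x = (\<lambda>_. 0)" by (rule ext)
        then show ?thesis by (intro bexI[of _ "\<lambda>_. 0"]) simp_all
      qed
    next
      assume "\<exists>y\<in>strand (B 0) (deg 0) \<alpha>. x = mv (B 0) (\<lambda>a b. if a = 0 then \<epsilon> b else 0) y"
      then obtain y where y: "y\<in>strand (B 0) (deg 0) \<alpha>" "x 0 = (\<Sum>b\<in>B 0. \<epsilon> b * y b)"
        unfolding mv0 by auto
      show "\<alpha> \<notin> A \<longrightarrow> x 0 = 0"
      proof
        assume "\<alpha> \<notin> A"
        then have "\<epsilon> b * y b = 0" for b
          using strandD[OF y(1), of b] \<epsilon>_nz[of b] A_up[OF _ \<alpha>, of "deg 0 b"] by auto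
        then show "x 0 = 0" unfolding y(2) by (simp only: sum.neutral_const)
      qed
    qed
    then show "(\<alpha> \<notin> A \<longrightarrow> (\<Sum>b\<in>(case 0 of 0 \<Rightarrow> {0} | Suc j \<Rightarrow> B j). (if b = 0 then 1 else 0) * x b) = 0) =
       (\<exists>y\<in>strand (case 1 of 0 \<Rightarrow> {0} | Suc j \<Rightarrow> B j) (\<lambda>b. case 1 of 0 \<Rightarrow> \<lambda>_. 0 | Suc j \<Rightarrow> deg j b) \<alpha>.
         x = mv (case 1 of 0 \<Rightarrow> {0} | Suc j \<Rightarrow> B j)
           (\<lambda>a b. case 0 of 0 \<Rightarrow> if a = 0 then \<epsilon> b else 0 | Suc j \<Rightarrow> d j a b) y)"
      by simp
  next
    fix \<alpha> i and x :: "nat \<Rightarrow> 'k" assume \<alpha>: "\<alpha> \<in> vdeg V"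
      and x: "x \<in> strand (case Suc i of 0 \<Rightarrow> {0} | Suc j \<Rightarrow> B j) (\<lambda>b. case Suc i of 0 \<Rightarrow> \<lambda>_. 0 | Suc j \<Rightarrow> deg j b) \<alpha>"
    show "(mv (case Suc i of 0 \<Rightarrow> {0} | Suc j \<Rightarrow> B j)
           (\<lambda>a b. case i of 0 \<Rightarrow> if a = 0 then \<epsilon> b else 0 | Suc j \<Rightarrow> d j a b) x = (\<lambda>_. 0)) =
       (\<exists>y\<in>strand (case Suc (Suc i) of 0 \<Rightarrow> {0} | Suc j \<Rightarrow> B j)
           (\<lambda>b. case Suc (Suc i) of 0 \<Rightarrow> \<lambda>_. 0 | Suc j \<Rightarrow> deg j b) \<alpha>.
         x = mv (case Suc (Suc i) of 0 \<Rightarrow> {0} | Suc j \<Rightarrow> B j)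
           (\<lambda>a b. case Suc i of 0 \<Rightarrow> if a = 0 then \<epsilon> b else 0 | Suc j \<Rightarrow> d j a b) y)"
    proof (cases i)
      case 0
      have "mv (B 0) (\<lambda>a b. if a = (0::nat) then \<epsilon> b else 0) x = (\<lambda>_. 0) \<longleftrightarrow> (\<Sum>b\<in>B 0. \<epsilon> b * x b) = 0"
        unfolding mv0 by (auto simp: fun_eq_iff)
      then show ?thesis using exact0[OF \<alpha>, of x] x 0 by simp
    next
      case (Suc j)
      then show ?thesis using exact_Suc[OF \<alpha>, of x j] x by simp
    qed
  next
    show "\<And>\<alpha>. \<alpha> \<in> {\<alpha> \<in> vdeg V. (\<lambda>_. 0) \<le> \<alpha>} \<Longrightarrow> \<alpha> \<notin> A \<Longrightarrow>
       \<exists>x\<in>strand (case 0 of 0 \<Rightarrow> {0} | Suc j \<Rightarrow> B j) (\<lambda>b. case 0 of 0 \<Rightarrow> \<lambda>_. 0 | Suc j \<Rightarrow> deg j b) \<alpha>.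
         (\<Sum>b\<in>(case 0 of 0 \<Rightarrow> {0} | Suc j \<Rightarrow> B j). (if b = 0 then 1 else 0) * x b) = 1"
      by (intro bexI[of _ "\<lambda>b. if b = 0 then 1 else 0"]) (auto simp: strand_def)
    show "\<And>\<alpha> \<beta>. \<alpha> \<in> {\<alpha> \<in> vdeg V. (\<lambda>_. 0) \<le> \<alpha>} \<Longrightarrow> \<beta> \<in> vdeg V \<Longrightarrow> \<alpha> \<le> \<beta> \<Longrightarrow>
       \<beta> \<in> {\<alpha> \<in> vdeg V. (\<lambda>_. 0) \<le> \<alpha>}"
      by (auto dest: order_trans)
    show "\<And>\<alpha> \<beta>. \<alpha> \<in> A \<Longrightarrow> \<beta> \<in> vdeg V \<Longrightarrow> \<alpha> \<le> \<beta> \<Longrightarrow> \<beta> \<in> A" by (rule A_up)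
    show "finite (case i of 0 \<Rightarrow> {0} | Suc j \<Rightarrow> B j)" for i by (simp add: finite_B split: nat.split)
    show "b \<in> (case i of 0 \<Rightarrow> {0} | Suc j \<Rightarrow> B j) \<Longrightarrow>
       (case i of 0 \<Rightarrow> \<lambda>_. 0 | Suc j \<Rightarrow> deg j b) \<in> vdeg V" for i b
      by (cases i) (auto simp: vdeg_def dest: deg_vdeg)
    show "(if b = 0 then 1 else 0) \<noteq> (0::'k) \<Longrightarrow> b \<in> (case 0 of 0 \<Rightarrow> {0} | Suc j \<Rightarrow> B j) \<and>
       (case 0 of 0 \<Rightarrow> \<lambda>_. 0 | Suc j \<Rightarrow> deg j b) \<in> {\<alpha> \<in> vdeg V. (\<lambda>_. 0) \<le> \<alpha>}" for b
      by (simp add: vdeg_def split: if_splits)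
  qed auto
qed

lemma scalar_res_principal:
  assumes "u \<in> vdeg V"
  shows "scalar_res V {\<alpha> \<in> vdeg V. u \<le> \<alpha>} {} (\<lambda>i. if i = 0 then {0::nat} else {}) (\<lambda>_ _. u)
    (\<lambda>_ _ _. 0 :: 'k::field) (\<lambda>b. if b = 0 then 1 else 0)"
proof unfold_locales
  fix \<alpha> assume "\<alpha> \<in> {\<alpha> \<in> vdeg V. u \<le> \<alpha>}"
  then show "\<exists>x\<in>strand (if 0 = (0::nat) then {0::nat} else {}) (\<lambda>_. u) \<alpha>.
     (\<Sum>b\<in>(if 0 = (0::nat) then {0} else {}). (if b = 0 then 1 else 0) * x b) = (1::'k)"
    by (intro bexI[of _ "\<lambda>b. if b = 0 then 1 else 0"]) (auto simp: strand_def)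
next
  fix \<alpha> and x :: "nat \<Rightarrow> 'k" assume "x \<in> strand (if 0 = (0::nat) then {0} else {}) (\<lambda>_. u) \<alpha>"
  then have "x b = 0" if "b \<noteq> 0" for b using that by (auto simp: strand_def)
  then have "x 0 = 0 \<longleftrightarrow> x = (\<lambda>_. 0)" by (metis)
  then show "(\<alpha> \<notin> {} \<longrightarrow> (\<Sum>b\<in>(if 0 = (0::nat) then {0} else {}). (if b = 0 then 1 else 0) * x b) = 0) =
     (\<exists>y\<in>strand (if 1 = (0::nat) then {0} else {}) (\<lambda>_. u) \<alpha>.
       x = mv (if 1 = (0::nat) then {0} else {}) (\<lambda>_ _. 0) y)"
    by (auto simp: mv_def intro!: bexI[of _ "\<lambda>_. 0"] exI[of _ "\<lambda>_. 0"])
next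
  fix \<alpha> i and x :: "nat \<Rightarrow> 'k" assume "x \<in> strand (if Suc i = (0::nat) then {0} else {}) (\<lambda>_. u) \<alpha>"
  then have "x = (\<lambda>_. 0)" by (auto simp: strand_def)
  then show "(mv (if Suc i = (0::nat) then {0} else {}) (\<lambda>_ _. 0) x = (\<lambda>_. 0)) =
     (\<exists>y\<in>strand (if Suc (Suc i) = (0::nat) then {0} else {}) (\<lambda>_. u) \<alpha>.
       x = mv (if Suc (Suc i) = (0::nat) then {0} else {}) (\<lambda>_ _. 0) y)"
    by (auto simp: mv_def intro!: bexI[of _ "\<lambda>_. 0"] exI[of _ "\<lambda>_. 0"])
qed (use assms in \<open>auto dest: order_trans split: if_splits\<close>)

section \<open>Homogeneous components\<close>

lemma lookup_mult_single_add:
  fixes p :: "('v, 'k::field) mpoly"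
  shows "lookup (p * Poly_Mapping.single e c) (s + e) = lookup p s * c"
proof -
  have "(\<Sum>q. lookup (Poly_Mapping.single e c) q when s + e = l + q) = (c when l = s)" for l
  proof -
    have "(\<lambda>q. lookup (Poly_Mapping.single e c) q when s + e = l + q) =
        (\<lambda>q. (c when l = s) when q = e)"
      by (auto simp: lookup_single when_def fun_eq_iff)
    then show ?thesis by (simp only: Sum_any_when_equal)
  qed
  then show ?thesis unfolding lookup_mult by (simp add: mult_when)
qed

lemma inj_mdeg: "inj mdeg"
  by (rule injI) (metis mdeg_def of_nat_eq_iff poly_mapping_eqI)

lemma mdeg_eq_iff [simp]: "mdeg e = mdeg e' \<longleftrightarrow> e = e'"
  by (rule inj_eq[OF inj_mdeg])

lemma inv_mdeg [simp]: "inv mdeg (mdeg e) = e"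
  by (rule inv_f_f[OF inj_mdeg])

lemma mdeg_add: "mdeg (e + e') = (\<lambda>v. mdeg e v + mdeg e' v)"
  by (simp add: mdeg_def lookup_add fun_eq_iff)

lemma mdeg_nonneg: "(\<lambda>_. 0) \<le> mdeg e"
  by (simp add: mdeg_def le_fun_def)

lemma mdeg_zero [simp]: "mdeg 0 = (\<lambda>_. 0)"
  by (simp add: mdeg_def fun_eq_iff)

lemma mdeg_vdeg_iff: "mdeg e \<in> vdeg V \<longleftrightarrow> keys e \<subseteq> V"
  by (auto simp: vdeg_def mdeg_def in_keys_iff)

lemma range_mdegI:
  assumes "finite V" "\<alpha> \<in> vdeg V" "(\<lambda>_. 0) \<le> \<alpha>"
  obtains e where "\<alpha> = mdeg e"
proof
  have "{v. nat (\<alpha> v) \<noteq> 0} \<subseteq> V" using assms(2) by (auto simp: vdeg_def)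
  then have "finite {v. nat (\<alpha> v) \<noteq> 0}" using assms(1) finite_subset by blast
  then show "\<alpha> = mdeg (Abs_poly_mapping (\<lambda>v. nat (\<alpha> v)))"
    using assms(3) by (simp add: mdeg_def le_fun_def fun_eq_iff)
qed

lemma mdeg_le_iff: "mdeg e \<le> mdeg e' \<longleftrightarrow> (\<exists>t. e' = e + t)"
proof
  assume le: "mdeg e \<le> mdeg e'"
  have "e' = e + (e' - e)"
    by (rule poly_mapping_eqI) (use le in \<open>simp add: lookup_add lookup_minus mdeg_def le_fun_def\<close>)
  then show "\<exists>t. e' = e + t" ..
next
  show "\<exists>t. e' = e + t \<Longrightarrow> mdeg e \<le> mdeg e'"
    by (auto simp: le_fun_def mdeg_def lookup_add)
qed

text \<open>Defined for every integer vector, because differences of degrees of basis elements may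
  have negative entries; such a component is zero.\<close>

definition hcoeff :: "('v \<Rightarrow> int) \<Rightarrow> ('v, 'k::field) mpoly \<Rightarrow> 'k" where
  "hcoeff \<delta> p = (if \<delta> \<in> range mdeg then lookup p (inv mdeg \<delta>) else 0)"

definition hmono :: "('v \<Rightarrow> int) \<Rightarrow> 'k::field \<Rightarrow> ('v, 'k) mpoly" where
  "hmono \<delta> c = (if \<delta> \<in> range mdeg then Poly_Mapping.single (inv mdeg \<delta>) c else 0)"

lemma hcoeff_mdeg [simp]: "hcoeff (mdeg e) p = lookup p e"
  by (simp add: hcoeff_def)

lemma hcoeff_outside: "\<delta> \<notin> range mdeg \<Longrightarrow> hcoeff \<delta> p = 0"
  by (simp add: hcoeff_def)

lemma hmono_mdeg: "hmono (mdeg e) c = Poly_Mapping.single e c"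
  by (simp add: hmono_def)

lemma hcoeff_zero [simp]: "hcoeff \<delta> 0 = 0"
  by (simp add: hcoeff_def)

lemma hcoeff_diff: "hcoeff \<delta> (p - q) = hcoeff \<delta> p - hcoeff \<delta> q"
  by (simp add: hcoeff_def lookup_minus)

lemma hcoeff_sum: "hcoeff \<delta> (\<Sum>i\<in>I. p i) = (\<Sum>i\<in>I. hcoeff \<delta> (p i))"
  by (simp add: hcoeff_def lookup_sum)

lemma hcoeff_nonneg: "hcoeff \<delta> p \<noteq> 0 \<Longrightarrow> (\<lambda>_. 0) \<le> \<delta>"
  by (auto simp: hcoeff_def mdeg_nonneg split: if_splits)

lemma hcoeff_hmono: "hcoeff \<delta> (hmono \<delta>' c) = (if \<delta> = \<delta>' \<and> \<delta> \<in> range mdeg then c else 0)"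
proof (cases "\<delta> \<in> range mdeg \<and> \<delta>' \<in> range mdeg")
  case True
  then show ?thesis by (auto simp: hmono_mdeg lookup_single when_def)
next
  case False
  then show ?thesis by (auto simp: hcoeff_outside hmono_def)
qed

lemma hcoeff_ext: "(\<And>\<delta>. hcoeff \<delta> p = hcoeff \<delta> q) \<Longrightarrow> p = q"
  by (metis hcoeff_mdeg poly_mapping_eqI)

lemma homogeneous_hmono: "homogeneous \<delta> (hmono \<delta> c)"
  by (auto simp: homogeneous_def hmono_def f_inv_into_f split: if_splits)

lemma hcoeff_nonzeroE:
  assumes "hcoeff \<delta> p \<noteq> 0"
  obtains e where "\<delta> = mdeg e" "e \<in> keys p"
proof -
  obtain e where "\<delta> = mdeg e" using assms hcoeff_outside by blast
  then show thesis using assms that by (simp add: in_keys_iff)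
qed

text \<open>A nonzero homogeneous polynomial is a scalar times one monomial, so multiplication by it
  only shifts degrees and scales.\<close>

lemma hcoeff_mult:
  assumes "homogeneous \<gamma> q"
  shows "hcoeff \<delta> (p * q) = hcoeff (\<lambda>v. \<delta> v - \<gamma> v) p * hcoeff \<gamma> q"
proof (cases "q = 0")
  case False
  then obtain e where e: "e \<in> keys q"
    by (metis in_keys_iff lookup_zero poly_mapping_eqI)
  then have \<gamma>: "\<gamma> = mdeg e" using assms by (simp add: homogeneous_def)
  have q: "q = Poly_Mapping.single e (lookup q e)"
  proof (rule poly_mapping_eqI)
    fix k show "lookup q k = lookup (Poly_Mapping.single e (lookup q e)) k"
      using assms \<gamma> by (cases "k \<in> keys q") (auto simp: homogeneous_def lookup_single when_def in_keys_iff)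
  qed
  have "hcoeff \<delta> (p * Poly_Mapping.single e c) = hcoeff (\<lambda>v. \<delta> v - mdeg e v) p * c" for c
  proof (cases "(\<lambda>v. \<delta> v - mdeg e v) \<in> range mdeg")
    case True
    then obtain s where s: "(\<lambda>v. \<delta> v - mdeg e v) = mdeg s" by blast
    have \<delta>: "\<delta> = mdeg (s + e)"
    proof
      fix v show "\<delta> v = mdeg (s + e) v" using fun_cong[OF s, of v] by (simp add: mdeg_add)
    qed
    show ?thesis unfolding s unfolding \<delta> hcoeff_mdeg by (rule lookup_mult_single_add)
  next
    case False
    have "hcoeff \<delta> (p * Poly_Mapping.single e c) = 0"
    proof (rule ccontr)
      assume nz: "hcoeff \<delta> (p * Poly_Mapping.single e c) \<noteq> 0"
      then obtain t where t: "\<delta> = mdeg t" using hcoeff_outside by blast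
      with nz have "t \<in> keys (p * Poly_Mapping.single e c)" by (simp add: in_keys_iff)
      then obtain a b where ab: "t = a + b" "b \<in> keys (Poly_Mapping.single e c)"
        using keys_mult by blast
      then have "b = e" by (auto split: if_splits)
      then have "(\<lambda>v. \<delta> v - mdeg e v) = mdeg a" by (simp add: t ab mdeg_add)
      with False show False by simp
    qed
    then show ?thesis using False by (simp add: hcoeff_outside)
  qed
  then show ?thesis using q \<gamma> by (metis hcoeff_mdeg)
qed simp

lemma poly_ring_iff: "p \<in> poly_ring V \<longleftrightarrow> (\<forall>\<delta>. hcoeff \<delta> p \<noteq> 0 \<longrightarrow> \<delta> \<in> vdeg V)"
proof
  assume "p \<in> poly_ring V"
  then show "\<forall>\<delta>. hcoeff \<delta> p \<noteq> 0 \<longrightarrow> \<delta> \<in> vdeg V"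
    by (auto simp: poly_ring_def mdeg_vdeg_iff elim!: hcoeff_nonzeroE)
next
  assume l: "\<forall>\<delta>. hcoeff \<delta> p \<noteq> 0 \<longrightarrow> \<delta> \<in> vdeg V"
  have "keys e \<subseteq> V" if "e \<in> keys p" for e
    using l[rule_format, of "mdeg e"] that by (simp add: mdeg_vdeg_iff in_keys_iff)
  then show "p \<in> poly_ring V" by (simp add: poly_ring_def)
qed

text \<open>The span of the monomials with exponents in a given set; monomial ideals, \<open>{0}\<close> and the
  polynomial ring itself are all of this form.\<close>

definition mspan :: "'v expo set \<Rightarrow> ('v, 'k::field) mpoly set" where
  "mspan D = {p. keys p \<subseteq> D}"

definition up_closed :: "'v set \<Rightarrow> 'v expo set \<Rightarrow> bool" where
  "up_closed V D \<longleftrightarrow> (\<forall>e\<in>D. keys e \<subseteq> V \<and> (\<forall>t. keys t \<subseteq> V \<longrightarrow> e + t \<in> D))"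

lemma mspan_iff: "p \<in> mspan D \<longleftrightarrow> (\<forall>\<delta>. hcoeff \<delta> p \<noteq> 0 \<longrightarrow> \<delta> \<in> mdeg ` D)"
proof
  assume "p \<in> mspan D"
  then show "\<forall>\<delta>. hcoeff \<delta> p \<noteq> 0 \<longrightarrow> \<delta> \<in> mdeg ` D"
    by (auto simp: mspan_def elim!: hcoeff_nonzeroE)
next
  assume l: "\<forall>\<delta>. hcoeff \<delta> p \<noteq> 0 \<longrightarrow> \<delta> \<in> mdeg ` D"
  have "e \<in> D" if "e \<in> keys p" for e
    using l[rule_format, of "mdeg e"] that by (auto simp: in_keys_iff)
  then show "p \<in> mspan D" by (auto simp: mspan_def)
qed

lemma mspan_empty: "mspan {} = {0}"
  by (auto simp: mspan_def)

lemma mspan_poly_ring: "mspan {e. keys e \<subseteq> V} = poly_ring V"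
  by (auto simp: mspan_def poly_ring_def)

lemma up_closed_mdeg:
  assumes D: "up_closed V D" and "finite V"
  shows "mdeg ` D \<subseteq> vdeg V"
    and "\<alpha> \<in> mdeg ` D \<Longrightarrow> \<beta> \<in> vdeg V \<Longrightarrow> \<alpha> \<le> \<beta> \<Longrightarrow> \<beta> \<in> mdeg ` D"
proof -
  show "mdeg ` D \<subseteq> vdeg V" using D by (auto simp: up_closed_def mdeg_vdeg_iff)
  assume "\<alpha> \<in> mdeg ` D" and \<beta>: "\<beta> \<in> vdeg V" "\<alpha> \<le> \<beta>"
  then obtain e where e: "e \<in> D" "\<alpha> = mdeg e" by blast
  have "(\<lambda>_. 0) \<le> \<beta>" using mdeg_nonneg \<beta>(2) unfolding e by (rule order_trans)
  then obtain e' where e': "\<beta> = mdeg e'" using range_mdegI[OF assms(2) \<beta>(1)] by blast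
  then obtain t where t: "e' = e + t" using \<beta>(2) e(2) mdeg_le_iff by blast
  have "keys t \<subseteq> keys e'"
    by (auto simp: t in_keys_iff lookup_add)
  then have "keys t \<subseteq> V" using \<beta>(1) unfolding e' mdeg_vdeg_iff by blast
  then show "\<beta> \<in> mdeg ` D" using D e(1) unfolding e' t up_closed_def by blast
qed

section \<open>From graded complexes to scalars\<close>

text \<open>Only homogeneity is assumed here, so that the translation of exactness into scalars can
  be used in both directions: from a given resolution, and towards one that is still to be
  verified.\<close>

locale graded_complex =
  fixes V :: "'v set" and F :: "('v, 'k::field) free_complex"
  assumes finite_V: "finite V"
    and fdeg_vdeg: "b < frank F i \<Longrightarrow> fdeg F i b \<in> vdeg V"
    and fmat_hom: "a < frank F i \<Longrightarrow> b < frank F (Suc i) \<Longrightarrow>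
      homogeneous (\<lambda>v. fdeg F (Suc i) b v - fdeg F i a v) (fmat F i a b)"
    and faug_hom: "b < frank F 0 \<Longrightarrow> homogeneous (fdeg F 0 b) (faug F b)"
begin

definition smat :: "nat \<Rightarrow> nat \<Rightarrow> nat \<Rightarrow> 'k" where
  "smat i a b = (if a < frank F i \<and> b < frank F (Suc i)
     then hcoeff (\<lambda>v. fdeg F (Suc i) b v - fdeg F i a v) (fmat F i a b) else 0)"

definition saug :: "nat \<Rightarrow> 'k" where
  "saug b = (if b < frank F 0 then hcoeff (fdeg F 0 b) (faug F b) else 0)"

text \<open>In an element of degree \<alpha> the coefficient of the basis vector \<open>b\<close>
  has degree \<alpha> minus \<open>fdeg F i b\<close>. \<open>lift\<close> goes back from a strand
  to the free module, see \<open>comp_lift\<close>, and by \<open>free_ext\<close> an element is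
  determined by its components.\<close>

definition comp :: "nat \<Rightarrow> ('v \<Rightarrow> int) \<Rightarrow> (nat \<Rightarrow> ('v, 'k) mpoly) \<Rightarrow> nat \<Rightarrow> 'k" where
  "comp i \<alpha> X = (\<lambda>b. if b < frank F i then hcoeff (\<lambda>v. \<alpha> v - fdeg F i b v) (X b) else 0)"

definition lift :: "nat \<Rightarrow> ('v \<Rightarrow> int) \<Rightarrow> (nat \<Rightarrow> 'k) \<Rightarrow> nat \<Rightarrow> ('v, 'k) mpoly" where
  "lift i \<alpha> x = (\<lambda>b. if b < frank F i then hmono (\<lambda>v. \<alpha> v - fdeg F i b v) (x b) else 0)"

abbreviation str :: "nat \<Rightarrow> ('v \<Rightarrow> int) \<Rightarrow> (nat \<Rightarrow> 'k) set" where
  "str i \<equiv> strand {..<frank F i} (fdeg F i)"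

abbreviation bd :: "nat \<Rightarrow> (nat \<Rightarrow> 'k) \<Rightarrow> nat \<Rightarrow> 'k" where
  "bd i \<equiv> mv {..<frank F (Suc i)} (smat i)"

lemma comp_str: "comp i \<alpha> X \<in> str i \<alpha>"
proof (rule strandI)
  fix b assume "comp i \<alpha> X b \<noteq> 0"
  then have "b < frank F i" "(\<lambda>_. 0) \<le> (\<lambda>v. \<alpha> v - fdeg F i b v)"
    by (auto simp: comp_def dest: hcoeff_nonneg split: if_splits)
  then show "b \<in> {..<frank F i} \<and> fdeg F i b \<le> \<alpha>" by (auto simp: le_fun_def)
qed

lemma comp_fdiff: "comp i \<alpha> (fdiff F i X) = bd i (comp (Suc i) \<alpha> X)"
proof
  fix a
  show "comp i \<alpha> (fdiff F i X) a = bd i (comp (Suc i) \<alpha> X) a"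
  proof (cases "a < frank F i")
    case True
    have "comp i \<alpha> (fdiff F i X) a =
        (\<Sum>b<frank F (Suc i). hcoeff (\<lambda>v. \<alpha> v - fdeg F i a v) (X b * fmat F i a b))"
      using True by (simp add: comp_def fdiff_def hcoeff_sum)
    also have "\<dots> = (\<Sum>b<frank F (Suc i). smat i a b * comp (Suc i) \<alpha> X b)"
    proof (intro sum.cong refl)
      fix b assume b: "b \<in> {..<frank F (Suc i)}"
      then show "hcoeff (\<lambda>v. \<alpha> v - fdeg F i a v) (X b * fmat F i a b) = smat i a b * comp (Suc i) \<alpha> X b"
        using True hcoeff_mult[OF fmat_hom[of a i b]] by (simp add: comp_def smat_def)
    qed
    finally show ?thesis by (simp add: mv_def)
  next
    case False
    then show ?thesis by (simp add: comp_def mv_def smat_def)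
  qed
qed

lemma hcoeff_faugment: "hcoeff \<alpha> (faugment F X) = (\<Sum>b<frank F 0. saug b * comp 0 \<alpha> X b)"
  unfolding faugment_def hcoeff_sum
  by (intro sum.cong) (simp_all add: hcoeff_mult[OF faug_hom] comp_def saug_def)

lemma comp_lift:
  assumes \<alpha>: "\<alpha> \<in> vdeg V" and x: "x \<in> str i \<alpha>"
  shows "comp i \<beta> (lift i \<alpha> x) = (if \<beta> = \<alpha> then x else (\<lambda>_. 0))"
proof
  fix b
  show "comp i \<beta> (lift i \<alpha> x) b = (if \<beta> = \<alpha> then x else (\<lambda>_. 0)) b"
  proof (cases "x b = 0")
    case True
    then show ?thesis by (simp add: comp_def lift_def hcoeff_hmono)
  next
    case False
    then have b: "b < frank F i" "fdeg F i b \<le> \<alpha>" using strandD[OF x] by auto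
    have "(\<lambda>v. \<alpha> v - fdeg F i b v) \<in> vdeg V" "(\<lambda>_. 0) \<le> (\<lambda>v. \<alpha> v - fdeg F i b v)"
      using \<alpha> fdeg_vdeg[OF b(1)] b(2) by (auto simp: vdeg_def le_fun_def)
    from range_mdegI[OF finite_V this] have "(\<lambda>v. \<alpha> v - fdeg F i b v) \<in> range mdeg" by blast
    moreover have "(\<lambda>v. \<beta> v - fdeg F i b v) = (\<lambda>v. \<alpha> v - fdeg F i b v) \<longleftrightarrow> \<beta> = \<alpha>"
      by (simp add: fun_eq_iff)
    ultimately show ?thesis using b by (auto simp: comp_def lift_def hcoeff_hmono)
  qed
qed

lemma lift_free: "\<alpha> \<in> vdeg V \<Longrightarrow> lift i \<alpha> x \<in> free_mod V (frank F i)"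
  using fdeg_vdeg[of _ i]
  by (auto simp: free_mod_def lift_def poly_ring_iff hcoeff_hmono vdeg_def)

lemma free_ext:
  assumes "X \<in> free_mod V (frank F i)" "Y \<in> free_mod V (frank F i)" "\<And>\<alpha>. comp i \<alpha> X = comp i \<alpha> Y"
  shows "X = Y"
proof
  fix b
  show "X b = Y b"
  proof (cases "b < frank F i")
    case True
    show ?thesis
    proof (rule hcoeff_ext)
      fix \<delta>
      show "hcoeff \<delta> (X b) = hcoeff \<delta> (Y b)"
        using fun_cong[OF assms(3)[of "\<lambda>v. \<delta> v + fdeg F i b v"], of b] True by (simp add: comp_def)
    qed
  qed (use assms(1,2) in \<open>simp add: free_mod_def\<close>)
qed

lemma comp_vdeg: "X \<in> free_mod V (frank F i) \<Longrightarrow> comp i \<alpha> X \<noteq> (\<lambda>_. 0) \<Longrightarrow> \<alpha> \<in> vdeg V"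
proof -
  assume X: "X \<in> free_mod V (frank F i)" and "comp i \<alpha> X \<noteq> (\<lambda>_. 0)"
  then obtain b where "comp i \<alpha> X b \<noteq> 0" by auto
  then have b: "b < frank F i" "hcoeff (\<lambda>v. \<alpha> v - fdeg F i b v) (X b) \<noteq> 0"
    by (auto simp: comp_def split: if_splits)
  with X have "(\<lambda>v. \<alpha> v - fdeg F i b v) \<in> vdeg V" unfolding free_mod_def poly_ring_iff by blast
  then show "\<alpha> \<in> vdeg V" using fdeg_vdeg[OF b(1)] by (simp add: vdeg_def)
qed

lemma fdiff_free: "X \<in> free_mod V (frank F (Suc i)) \<Longrightarrow> fdiff F i X \<in> free_mod V (frank F i)"
proof -
  assume X: "X \<in> free_mod V (frank F (Suc i))"
  have "fdiff F i X a \<in> poly_ring V" if a: "a < frank F i" for a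
    unfolding poly_ring_iff
  proof (intro allI impI)
    fix \<delta> assume "hcoeff \<delta> (fdiff F i X a) \<noteq> 0"
    then have "comp i (\<lambda>v. \<delta> v + fdeg F i a v) (fdiff F i X) a \<noteq> 0" using a by (simp add: comp_def)
    then have "comp (Suc i) (\<lambda>v. \<delta> v + fdeg F i a v) X \<noteq> (\<lambda>_. 0)" unfolding comp_fdiff by auto
    from comp_vdeg[OF X this] show "\<delta> \<in> vdeg V" using fdeg_vdeg[OF a] by (simp add: vdeg_def)
  qed
  then show ?thesis by (simp add: free_mod_def fdiff_def)
qed

lemma finite_comp: "finite {\<alpha>. comp i \<alpha> X \<noteq> (\<lambda>_. 0)}"
proof (rule finite_subset)
  show "{\<alpha>. comp i \<alpha> X \<noteq> (\<lambda>_. 0)} \<subseteq>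
     (\<Union>b<frank F i. (\<lambda>e v. mdeg e v + fdeg F i b v) ` keys (X b))"
  proof
    fix \<alpha> assume "\<alpha> \<in> {\<alpha>. comp i \<alpha> X \<noteq> (\<lambda>_. 0)}"
    then obtain b where "comp i \<alpha> X b \<noteq> 0" by auto
    then have b: "b < frank F i" "hcoeff (\<lambda>v. \<alpha> v - fdeg F i b v) (X b) \<noteq> 0"
      by (auto simp: comp_def split: if_splits)
    then obtain e where e: "(\<lambda>v. \<alpha> v - fdeg F i b v) = mdeg e" using hcoeff_outside by blast
    with b have "e \<in> keys (X b)" by (simp add: in_keys_iff)
    moreover have "\<alpha> = (\<lambda>v. mdeg e v + fdeg F i b v)" using e by (simp add: fun_eq_iff algebra_simps)
    ultimately show "\<alpha> \<in> (\<Union>b<frank F i. (\<lambda>e v. mdeg e v + fdeg F i b v) ` keys (X b))"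
      using b(1) by blast
  qed
qed simp

lemma assemble:
  assumes "finite T" "T \<subseteq> vdeg V" "\<And>\<alpha>. \<alpha> \<in> T \<Longrightarrow> y \<alpha> \<in> str i \<alpha>"
  obtains Y where "Y \<in> free_mod V (frank F i)" "\<And>\<beta>. comp i \<beta> Y = (if \<beta> \<in> T then y \<beta> else (\<lambda>_. 0))"
proof
  let ?Y = "\<lambda>b. \<Sum>\<alpha>\<in>T. lift i \<alpha> (y \<alpha>) b"
  have lf: "lift i \<alpha> (y \<alpha>) \<in> free_mod V (frank F i)" if "\<alpha> \<in> T" for \<alpha>
    using lift_free assms(2) that by blast
  have "?Y b \<in> poly_ring V" if "b < frank F i" for b
    unfolding poly_ring_iff
  proof (intro allI impI)
    fix \<delta> assume "hcoeff \<delta> (?Y b) \<noteq> 0"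
    then obtain \<alpha> where \<alpha>: "\<alpha> \<in> T" "hcoeff \<delta> (lift i \<alpha> (y \<alpha>) b) \<noteq> 0"
      unfolding hcoeff_sum by (meson sum.neutral)
    then show "\<delta> \<in> vdeg V" using lf[OF \<alpha>(1)] that unfolding free_mod_def poly_ring_iff by blast
  qed
  then show "?Y \<in> free_mod V (frank F i)" by (simp add: free_mod_def lift_def)
  show "comp i \<beta> ?Y = (if \<beta> \<in> T then y \<beta> else (\<lambda>_. 0))" for \<beta>
  proof
    fix b
    have "comp i \<beta> ?Y b = (\<Sum>\<alpha>\<in>T. comp i \<beta> (lift i \<alpha> (y \<alpha>)) b)"
      by (simp add: comp_def hcoeff_sum)
    also have "\<dots> = (\<Sum>\<alpha>\<in>T. if \<alpha> = \<beta> then y \<beta> b else 0)"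
      using assms(2,3) by (intro sum.cong) (auto simp: comp_lift)
    also have "\<dots> = (if \<beta> \<in> T then y \<beta> else (\<lambda>_. 0)) b" using assms(1) by simp
    finally show "comp i \<beta> ?Y b = (if \<beta> \<in> T then y \<beta> else (\<lambda>_. 0)) b" .
  qed
qed

text \<open>An element has only finitely many nonzero components, so preimages chosen degree by
  degree can be summed with \<open>assemble\<close>. The condition \<open>P\<close>, tested by
  components, is kept abstract to cover the kernel of a differential as well as the preimage of an
  ideal under the augmentation.\<close>

lemma exactness_iff:
  fixes P :: "(nat \<Rightarrow> ('v, 'k) mpoly) \<Rightarrow> bool"
  assumes P: "\<And>X. X \<in> free_mod V (frank F i) \<Longrightarrow> P X \<longleftrightarrow> (\<forall>\<alpha>. p \<alpha> (comp i \<alpha> X))"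
    and p0: "\<And>\<alpha>. p \<alpha> (\<lambda>_. 0)"
  shows "(\<forall>X\<in>free_mod V (frank F i). P X \<longleftrightarrow> (\<exists>Y\<in>free_mod V (frank F (Suc i)). X = fdiff F i Y)) \<longleftrightarrow>
    (\<forall>\<alpha>\<in>vdeg V. \<forall>x\<in>str i \<alpha>. p \<alpha> x \<longleftrightarrow> (\<exists>y\<in>str (Suc i) \<alpha>. x = bd i y))" (is "?L \<longleftrightarrow> ?R")
proof
  assume L: ?L
  show ?R
  proof (intro ballI)
    fix \<alpha> x assume \<alpha>: "\<alpha> \<in> vdeg V" and x: "x \<in> str i \<alpha>"
    let ?X = "lift i \<alpha> x"
    have X: "?X \<in> free_mod V (frank F i)" using \<alpha> by (rule lift_free)
    have "P ?X \<longleftrightarrow> p \<alpha> x" unfolding P[OF X] comp_lift[OF \<alpha> x] using p0 by (metis)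
    moreover have "(\<exists>Y\<in>free_mod V (frank F (Suc i)). ?X = fdiff F i Y) \<longleftrightarrow> (\<exists>y\<in>str (Suc i) \<alpha>. x = bd i y)"
    proof
      assume "\<exists>Y\<in>free_mod V (frank F (Suc i)). ?X = fdiff F i Y"
      then obtain Y where "?X = fdiff F i Y" by blast
      then have "comp i \<alpha> ?X = bd i (comp (Suc i) \<alpha> Y)" by (simp add: comp_fdiff)
      then show "\<exists>y\<in>str (Suc i) \<alpha>. x = bd i y"
        using comp_str[of "Suc i" \<alpha> Y] by (intro bexI[of _ "comp (Suc i) \<alpha> Y"]) (simp_all add: comp_lift[OF \<alpha> x])
    next
      assume "\<exists>y\<in>str (Suc i) \<alpha>. x = bd i y"
      then obtain y where y: "y \<in> str (Suc i) \<alpha>" "x = bd i y" by blast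
      have "?X = fdiff F i (lift (Suc i) \<alpha> y)"
      proof (rule free_ext[OF X fdiff_free[OF lift_free[OF \<alpha>]]])
        show "comp i \<beta> ?X = comp i \<beta> (fdiff F i (lift (Suc i) \<alpha> y))" for \<beta>
          unfolding comp_fdiff comp_lift[OF \<alpha> x] comp_lift[OF \<alpha> y(1)] using y(2) by simp
      qed
      then show "\<exists>Y\<in>free_mod V (frank F (Suc i)). ?X = fdiff F i Y" using lift_free[OF \<alpha>] by blast
    qed
    ultimately show "p \<alpha> x \<longleftrightarrow> (\<exists>y\<in>str (Suc i) \<alpha>. x = bd i y)" using bspec[OF L X] by simp
  qed
next
  assume R: ?R
  show ?L
  proof
    fix X :: "nat \<Rightarrow> ('v, 'k) mpoly" assume X: "X \<in> free_mod V (frank F i)"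
    show "P X \<longleftrightarrow> (\<exists>Y\<in>free_mod V (frank F (Suc i)). X = fdiff F i Y)"
    proof
      assume "P X"
      let ?T = "{\<alpha>. comp i \<alpha> X \<noteq> (\<lambda>_. 0)}"
      have T: "?T \<subseteq> vdeg V" using comp_vdeg[OF X] by blast
      have "\<exists>y. y \<in> str (Suc i) \<alpha> \<and> comp i \<alpha> X = bd i y" if "\<alpha> \<in> ?T" for \<alpha>
      proof -
        have "p \<alpha> (comp i \<alpha> X)" using \<open>P X\<close> P[OF X] by blast
        then show ?thesis
          using bspec[OF bspec[OF R subsetD[OF T that]] comp_str[of i \<alpha> X]] by blast
      qed
      then have "\<forall>\<alpha>\<in>?T. \<exists>y. y \<in> str (Suc i) \<alpha> \<and> comp i \<alpha> X = bd i y" by blast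
      from bchoice[OF this] obtain y where
        y: "\<forall>\<alpha>\<in>?T. y \<alpha> \<in> str (Suc i) \<alpha> \<and> comp i \<alpha> X = bd i (y \<alpha>)" ..
      obtain Y where Y: "Y \<in> free_mod V (frank F (Suc i))"
        "\<And>\<beta>. comp (Suc i) \<beta> Y = (if \<beta> \<in> ?T then y \<beta> else (\<lambda>_. 0))"
        using assemble[OF finite_comp[of i X] T, of y "Suc i"] y by blast
      have "X = fdiff F i Y"
      proof (rule free_ext[OF X fdiff_free[OF Y(1)]])
        show "comp i \<beta> X = comp i \<beta> (fdiff F i Y)" for \<beta>
          unfolding comp_fdiff Y(2) using y by (cases "\<beta> \<in> ?T") simp_all
      qed
      with Y(1) show "\<exists>Y\<in>free_mod V (frank F (Suc i)). X = fdiff F i Y" by blast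
    next
      assume "\<exists>Y\<in>free_mod V (frank F (Suc i)). X = fdiff F i Y"
      then obtain Y where Y: "X = fdiff F i Y" by blast
      have "p \<alpha> (comp i \<alpha> X)" for \<alpha>
      proof (cases "comp i \<alpha> X = (\<lambda>_. 0)")
        case True
        then show ?thesis using p0 by simp
      next
        case False
        have "\<exists>y\<in>str (Suc i) \<alpha>. comp i \<alpha> X = bd i y"
          unfolding Y comp_fdiff using comp_str[of "Suc i" \<alpha> Y] by blast
        then show ?thesis using bspec[OF bspec[OF R comp_vdeg[OF X False]] comp_str[of i \<alpha> X]] by blast
      qed
      then show "P X" using P[OF X] by blast
    qed
  qed
qed

lemma exactness_Suc_iff:
  "(\<forall>X\<in>free_mod V (frank F (Suc i)). fdiff F i X = (\<lambda>_. 0) \<longleftrightarrow>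
       (\<exists>Y\<in>free_mod V (frank F (Suc (Suc i))). X = fdiff F (Suc i) Y)) \<longleftrightarrow>
   (\<forall>\<alpha>\<in>vdeg V. \<forall>x\<in>str (Suc i) \<alpha>. bd i x = (\<lambda>_. 0) \<longleftrightarrow> (\<exists>y\<in>str (Suc (Suc i)) \<alpha>. x = bd (Suc i) y))"
proof (rule exactness_iff)
  fix X :: "nat \<Rightarrow> ('v, 'k) mpoly" assume X: "X \<in> free_mod V (frank F (Suc i))"
  have z: "(\<lambda>_. 0) \<in> free_mod V (frank F i)" by (simp add: free_mod_def poly_ring_def)
  have c0: "comp i \<alpha> (\<lambda>_. 0) = (\<lambda>_. 0)" for \<alpha> by (simp add: comp_def fun_eq_iff)
  show "fdiff F i X = (\<lambda>_. 0) \<longleftrightarrow> (\<forall>\<alpha>. bd i (comp (Suc i) \<alpha> X) = (\<lambda>_. 0))"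
  proof
    assume "fdiff F i X = (\<lambda>_. 0)"
    then show "\<forall>\<alpha>. bd i (comp (Suc i) \<alpha> X) = (\<lambda>_. 0)" by (metis comp_fdiff c0)
  next
    assume "\<forall>\<alpha>. bd i (comp (Suc i) \<alpha> X) = (\<lambda>_. 0)"
    then show "fdiff F i X = (\<lambda>_. 0)"
      by (intro free_ext[OF fdiff_free[OF X] z]) (simp add: comp_fdiff c0)
  qed
qed simp

lemma exactness_0_iff:
  "(\<forall>X\<in>free_mod V (frank F 0). faugment F X \<in> mspan N \<longleftrightarrow>
       (\<exists>Y\<in>free_mod V (frank F (Suc 0)). X = fdiff F 0 Y)) \<longleftrightarrow>
   (\<forall>\<alpha>\<in>vdeg V. \<forall>x\<in>str 0 \<alpha>. (\<alpha> \<notin> mdeg ` N \<longrightarrow> (\<Sum>b<frank F 0. saug b * x b) = 0) \<longleftrightarrow>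
       (\<exists>y\<in>str (Suc 0) \<alpha>. x = bd 0 y))"
  by (rule exactness_iff) (auto simp: mspan_iff hcoeff_faugment)

text \<open>A preimage of each monomial, modulo \<open>N\<close>, suffices: it is scaled by the
  coefficient in \<open>f\<close>, and the finitely many results are summed.\<close>

lemma surjectivity_iff:
  assumes M: "\<And>e. e \<in> M \<Longrightarrow> keys e \<subseteq> V"
  shows "(\<forall>f\<in>mspan M. \<exists>X\<in>free_mod V (frank F 0). f - faugment F X \<in> mspan N) \<longleftrightarrow>
   (\<forall>\<alpha>. \<alpha> \<in> mdeg ` M \<longrightarrow> \<alpha> \<notin> mdeg ` N \<longrightarrow> (\<exists>x\<in>str 0 \<alpha>. (\<Sum>b<frank F 0. saug b * x b) = 1))" (is "?L \<longleftrightarrow> ?R")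
proof
  assume L: ?L
  show ?R
  proof (intro allI impI)
    fix \<alpha> assume \<alpha>: "\<alpha> \<in> mdeg ` M" "\<alpha> \<notin> mdeg ` N"
    then have "hmono \<alpha> 1 \<in> mspan M" by (auto simp: hmono_mdeg mspan_def)
    then obtain X where "hmono \<alpha> 1 - faugment F X \<in> mspan N" using L by blast
    then have "hcoeff \<alpha> (hmono \<alpha> 1 - faugment F X) = 0" using \<alpha>(2) unfolding mspan_iff by blast
    then have "(\<Sum>b<frank F 0. saug b * comp 0 \<alpha> X b) = 1"
      using \<alpha>(1) by (auto simp: hcoeff_diff hcoeff_hmono hcoeff_faugment)
    then show "\<exists>x\<in>str 0 \<alpha>. (\<Sum>b<frank F 0. saug b * x b) = 1" using comp_str by blast
  qed
next
  assume R: ?R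
  show ?L
  proof
    fix f :: "('v, 'k) mpoly" assume f: "f \<in> mspan M"
    let ?T = "mdeg ` keys f"
    have T: "?T \<subseteq> vdeg V" "finite ?T" using f M by (auto simp: mspan_def mdeg_vdeg_iff)
    have "\<exists>x. x \<in> str 0 \<alpha> \<and> (\<alpha> \<notin> mdeg ` N \<longrightarrow> (\<Sum>b<frank F 0. saug b * x b) = hcoeff \<alpha> f)"
      if "\<alpha> \<in> ?T" for \<alpha>
    proof (cases "\<alpha> \<in> mdeg ` N")
      case True
      then show ?thesis by (intro exI[of _ "\<lambda>_. 0"]) simp
    next
      case False
      have "\<alpha> \<in> mdeg ` M" using that f by (auto simp: mspan_def)
      then obtain x where x: "x \<in> str 0 \<alpha>" "(\<Sum>b<frank F 0. saug b * x b) = 1" using R False by blast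
      have "(\<Sum>b<frank F 0. saug b * (hcoeff \<alpha> f * x b)) = hcoeff \<alpha> f * (\<Sum>b<frank F 0. saug b * x b)"
        by (simp add: sum_distrib_left mult.left_commute)
      with x show ?thesis by (intro exI[of _ "\<lambda>b. hcoeff \<alpha> f * x b"]) (simp add: strand_scale)
    qed
    then have "\<forall>\<alpha>\<in>?T. \<exists>x. x \<in> str 0 \<alpha> \<and> (\<alpha> \<notin> mdeg ` N \<longrightarrow> (\<Sum>b<frank F 0. saug b * x b) = hcoeff \<alpha> f)" by blast
    from bchoice[OF this] obtain x where
      x: "\<forall>\<alpha>\<in>?T. x \<alpha> \<in> str 0 \<alpha> \<and> (\<alpha> \<notin> mdeg ` N \<longrightarrow> (\<Sum>b<frank F 0. saug b * x \<alpha> b) = hcoeff \<alpha> f)" ..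
    obtain X where X: "X \<in> free_mod V (frank F 0)" "\<And>\<beta>. comp 0 \<beta> X = (if \<beta> \<in> ?T then x \<beta> else (\<lambda>_. 0))"
      using assemble[OF T(2,1), of x 0] x by blast
    have "hcoeff \<beta> (f - faugment F X) = 0" if "\<beta> \<notin> mdeg ` N" for \<beta>
    proof (cases "\<beta> \<in> ?T")
      case True
      then show ?thesis using bspec[OF x True] that by (simp only: hcoeff_diff hcoeff_faugment X(2)) simp
    next
      case False
      then have "hcoeff \<beta> f = 0" by (blast elim: hcoeff_nonzeroE)
      with False show ?thesis by (simp add: hcoeff_diff hcoeff_faugment X(2))
    qed
    then have "f - faugment F X \<in> mspan N" unfolding mspan_iff by blast
    with X(1) show "\<exists>X\<in>free_mod V (frank F 0). f - faugment F X \<in> mspan N" by blast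
  qed
qed

end

section \<open>Betti numbers\<close>

lemma scalar_res_of_min_free_res:
  fixes F :: "('v, 'k::field) free_complex"
  assumes V: "finite V" and M: "up_closed V M" and N: "up_closed V N"
    and F: "min_free_res V (mspan M) (mspan N) F"
  shows "scalar_res V (mdeg ` M) (mdeg ` N) (\<lambda>i. {..<frank F i}) (fdeg F)
    (graded_complex.smat F) (graded_complex.saug F)"
proof -
  have res: "graded_free_res V (mspan M) (mspan N) F" using F by (simp add: min_free_res_def)
  note c = res[unfolded graded_free_res_def]
  note c2 = conjunct2[OF c] note c3 = conjunct2[OF c2] note c4 = conjunct2[OF c3]
  note c5 = conjunct2[OF c4]
  have deg: "fdeg F i b \<in> vdeg V" if "b < frank F i" for i b
    using conjunct1[OF c] that by (simp add: vdeg_def)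
  have mat: "fmat F i a b \<in> poly_ring V"
    "homogeneous (\<lambda>v. fdeg F (Suc i) b v - fdeg F i a v) (fmat F i a b)"
    if "a < frank F i" "b < frank F (Suc i)" for i a b
    using conjunct1[OF c2] that by simp_all
  have aug: "faug F b \<in> mspan M" "homogeneous (fdeg F 0 b) (faug F b)" if "b < frank F 0" for b
    using conjunct1[OF c3] that by simp_all
  have const: "lookup (fmat F i a b) 0 = 0" if "a < frank F i" "b < frank F (Suc i)" for i a b
    using conjunct2[OF F[unfolded min_free_res_def]] that by simp
  interpret graded_complex V F
    by unfold_locales (use V deg mat aug in simp_all)
  note surj = conjunct1[OF c4]
  note ex0 = conjunct1[OF c5, unfolded One_nat_def]
  note ex_Suc = conjunct2[OF c5, rule_format]
  show ?thesis
  proof unfold_locales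
    show "mdeg ` M \<subseteq> vdeg V" by (rule up_closed_mdeg(1)[OF M V])
    show "\<alpha> \<in> mdeg ` M \<Longrightarrow> \<beta> \<in> vdeg V \<Longrightarrow> \<alpha> \<le> \<beta> \<Longrightarrow> \<beta> \<in> mdeg ` M" for \<alpha> \<beta>
      by (rule up_closed_mdeg(2)[OF M V])
    show "\<alpha> \<in> mdeg ` N \<Longrightarrow> \<beta> \<in> vdeg V \<Longrightarrow> \<alpha> \<le> \<beta> \<Longrightarrow> \<beta> \<in> mdeg ` N" for \<alpha> \<beta>
      by (rule up_closed_mdeg(2)[OF N V])
    show "finite {..<frank F i}" for i by simp
    show "b \<in> {..<frank F i} \<Longrightarrow> fdeg F i b \<in> vdeg V" for i b using deg by simp
  next
    fix i a b assume nz: "smat i a b \<noteq> 0"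
    then have ab: "a < frank F i" "b < frank F (Suc i)" by (auto simp: smat_def split: if_splits)
    let ?\<delta> = "\<lambda>v. fdeg F (Suc i) b v - fdeg F i a v"
    have h: "hcoeff ?\<delta> (fmat F i a b) \<noteq> 0" using nz ab by (simp add: smat_def)
    have le: "fdeg F i a \<le> fdeg F (Suc i) b" using hcoeff_nonneg[OF h] by (simp add: le_fun_def)
    \<comment> \<open>Equal degrees would make the entry a constant, and minimality kills constant
      terms.\<close>
    have "fdeg F i a \<noteq> fdeg F (Suc i) b"
    proof
      assume "fdeg F i a = fdeg F (Suc i) b"
      then have "?\<delta> = mdeg 0" by (simp add: fun_eq_iff)
      then have "lookup (fmat F i a b) 0 \<noteq> 0" using h by (simp only: hcoeff_mdeg not_False_eq_True)
      then show False using const[OF ab] by simp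
    qed
    with le ab show "a \<in> {..<frank F i} \<and> b \<in> {..<frank F (Suc i)} \<and> fdeg F i a < fdeg F (Suc i) b"
      by auto
  next
    fix b assume nz: "saug b \<noteq> 0"
    then have b: "b < frank F 0" by (auto simp: saug_def split: if_splits)
    then show "b \<in> {..<frank F 0} \<and> fdeg F 0 b \<in> mdeg ` M"
      using nz aug(1)[OF b] unfolding mspan_iff by (simp add: saug_def)
  next
    have "\<forall>\<alpha>. \<alpha> \<in> mdeg ` M \<longrightarrow> \<alpha> \<notin> mdeg ` N \<longrightarrow> (\<exists>x\<in>str 0 \<alpha>. (\<Sum>b<frank F 0. saug b * x b) = 1)"
      by (rule surjectivity_iff[THEN iffD1, OF _ surj]) (use M in \<open>simp add: up_closed_def\<close>)
    then show "\<alpha> \<in> mdeg ` M \<Longrightarrow> \<alpha> \<notin> mdeg ` N \<Longrightarrow> \<exists>x\<in>str 0 \<alpha>. (\<Sum>b<frank F 0. saug b * x b) = 1" for \<alpha>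
      by blast
  next
    fix \<alpha> and x :: "nat \<Rightarrow> 'k" assume \<alpha>: "\<alpha> \<in> vdeg V" and x: "x \<in> str 0 \<alpha>"
    show "(\<alpha> \<notin> mdeg ` N \<longrightarrow> (\<Sum>b<frank F 0. saug b * x b) = 0) =
       (\<exists>y\<in>strand {..<frank F 1} (fdeg F 1) \<alpha>. x = mv {..<frank F 1} (smat 0) y)"
      using bspec[OF bspec[OF exactness_0_iff[THEN iffD1, OF ex0] \<alpha>] x] unfolding One_nat_def .
  next
    fix \<alpha> i and x :: "nat \<Rightarrow> 'k" assume \<alpha>: "\<alpha> \<in> vdeg V" and x: "x \<in> str (Suc i) \<alpha>"
    have "\<forall>\<alpha>\<in>vdeg V. \<forall>x\<in>str (Suc i) \<alpha>. bd i x = (\<lambda>_. 0) \<longleftrightarrow>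
        (\<exists>y\<in>str (Suc (Suc i)) \<alpha>. x = bd (Suc i) y)"
      by (rule exactness_Suc_iff[THEN iffD1]) (intro ballI ex_Suc)
    from bspec[OF bspec[OF this \<alpha>] x]
    show "(bd i x = (\<lambda>_. 0)) = (\<exists>y\<in>str (Suc (Suc i)) \<alpha>. x = bd (Suc i) y)" .
  qed
qed

definition complex_of_scalars ::
    "(nat \<Rightarrow> nat) \<Rightarrow> (nat \<Rightarrow> nat \<Rightarrow> 'v \<Rightarrow> int) \<Rightarrow> (nat \<Rightarrow> nat \<Rightarrow> nat \<Rightarrow> 'k::field) \<Rightarrow> (nat \<Rightarrow> 'k) \<Rightarrow>
     ('v, 'k) free_complex" where
  "complex_of_scalars r deg d \<epsilon> = \<lparr>frank = r, fdeg = deg,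
     fmat = (\<lambda>i a b. hmono (\<lambda>v. deg (Suc i) b v - deg i a v) (d i a b)),
     faug = (\<lambda>b. hmono (deg 0 b) (\<epsilon> b))\<rparr>"

lemma min_free_res_of_scalar_res:
  fixes d :: "nat \<Rightarrow> nat \<Rightarrow> nat \<Rightarrow> 'k::field"
  assumes V: "finite V" and M: "up_closed V M" and N: "up_closed V N"
    and "scalar_res V (mdeg ` M) (mdeg ` N) (\<lambda>i. {..<r i}) deg d \<epsilon>"
  shows "min_free_res V (mspan M) (mspan N) (complex_of_scalars r deg d \<epsilon>)"
proof -
  interpret scalar_res V "mdeg ` M" "mdeg ` N" "\<lambda>i. {..<r i}" deg d \<epsilon> by fact
  let ?F = "complex_of_scalars r deg d \<epsilon>"
  have F: "frank ?F = r" "fdeg ?F = deg" "fmat ?F i a b = hmono (\<lambda>v. deg (Suc i) b v - deg i a v) (d i a b)"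
    "faug ?F b = hmono (deg 0 b) (\<epsilon> b)" for i a b
    by (simp_all add: complex_of_scalars_def)
  have deg: "deg i b \<in> vdeg V" if "b < r i" for i b using deg_vdeg[of b i] that by simp
  have mat: "fmat ?F i a b \<in> poly_ring V" if "a < r i" "b < r (Suc i)" for i a b
    using deg[OF that(1)] deg[OF that(2)] by (auto simp: F poly_ring_iff hcoeff_hmono vdeg_def)
  have hom: "homogeneous (\<lambda>v. deg (Suc i) b v - deg i a v) (fmat ?F i a b)" for i a b
    by (simp add: F homogeneous_hmono)
  have aug: "faug ?F b \<in> mspan M" for b
    using \<epsilon>_nz[of b] by (auto simp: F mspan_iff hcoeff_hmono split: if_splits)
  interpret G: graded_complex V ?F
    by unfold_locales (use V deg mat hom in \<open>simp_all add: F homogeneous_hmono\<close>)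
  have smat: "G.smat = d"
  proof (intro ext)
    fix i a b
    show "G.smat i a b = d i a b"
    proof (cases "d i a b = 0")
      case False
      then have ab: "a < r i" "b < r (Suc i)" "deg i a \<le> deg (Suc i) b" using d_nz[of i a b] by auto
      \<comment> \<open>A nonzero scalar has a nonnegative degree difference supported in
        \<open>V\<close>. This is the exponent of an actual monomial, so \<open>hmono\<close> does
        not lose the scalar.\<close>
      have "(\<lambda>v. deg (Suc i) b v - deg i a v) \<in> vdeg V" "(\<lambda>_. 0) \<le> (\<lambda>v. deg (Suc i) b v - deg i a v)"
        using deg[OF ab(1)] deg[OF ab(2)] ab(3) by (auto simp: vdeg_def le_fun_def)
      from range_mdegI[OF V this] have "(\<lambda>v. deg (Suc i) b v - deg i a v) \<in> range mdeg" by blast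
      with ab show ?thesis by (simp add: G.smat_def F hcoeff_hmono)
    qed (simp add: G.smat_def F hcoeff_hmono)
  qed
  have saug: "G.saug = \<epsilon>"
  proof
    fix b
    show "G.saug b = \<epsilon> b"
      using \<epsilon>_nz[of b] by (cases "\<epsilon> b = 0") (auto simp: G.saug_def F hcoeff_hmono)
  qed
  have "\<forall>\<alpha>\<in>vdeg V. \<forall>x\<in>G.str 0 \<alpha>. (\<alpha> \<notin> mdeg ` N \<longrightarrow> (\<Sum>b<frank ?F 0. G.saug b * x b) = 0) \<longleftrightarrow>
       (\<exists>y\<in>G.str (Suc 0) \<alpha>. x = G.bd 0 y)"
    using exact0 unfolding F smat saug One_nat_def by (intro ballI)
  from G.exactness_0_iff[THEN iffD2, OF this]
  have ex0: "\<forall>X\<in>free_mod V (frank ?F 0). faugment ?F X \<in> mspan N \<longleftrightarrow>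
       (\<exists>Y\<in>free_mod V (frank ?F 1). X = fdiff ?F 0 Y)" unfolding One_nat_def .
  have "\<forall>\<alpha>\<in>vdeg V. \<forall>x\<in>G.str (Suc i) \<alpha>. G.bd i x = (\<lambda>_. 0) \<longleftrightarrow> (\<exists>y\<in>G.str (Suc (Suc i)) \<alpha>. x = G.bd (Suc i) y)"
    for i using exact_Suc unfolding F smat by (intro ballI)
  from G.exactness_Suc_iff[THEN iffD2, OF this]
  have ex_Suc: "\<forall>X\<in>free_mod V (frank ?F (Suc i)). fdiff ?F i X = (\<lambda>_. 0) \<longleftrightarrow>
       (\<exists>Y\<in>free_mod V (frank ?F (Suc (Suc i))). X = fdiff ?F (Suc i) Y)" for i .
  have "\<forall>\<alpha>. \<alpha> \<in> mdeg ` M \<longrightarrow> \<alpha> \<notin> mdeg ` N \<longrightarrow> (\<exists>x\<in>G.str 0 \<alpha>. (\<Sum>b<frank ?F 0. G.saug b * x b) = 1)"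
    using surj unfolding F saug by (intro allI impI)
  then have sur: "\<forall>f\<in>mspan M. \<exists>X\<in>free_mod V (frank ?F 0). f - faugment ?F X \<in> mspan N"
    by (rule G.surjectivity_iff[THEN iffD2, rotated]) (use M in \<open>simp add: up_closed_def\<close>)
  have "lookup (fmat ?F i a b) 0 = 0" for i a b
  proof (rule ccontr)
    assume "lookup (fmat ?F i a b) 0 \<noteq> 0"
    then have "hcoeff (mdeg 0) (fmat ?F i a b) \<noteq> 0" by (simp only: hcoeff_mdeg not_False_eq_True)
    then have "(\<lambda>_. 0) = (\<lambda>v. deg (Suc i) b v - deg i a v)" "d i a b \<noteq> 0"
      by (auto simp: F hcoeff_hmono split: if_splits)
    then have "deg i a = deg (Suc i) b" by (simp add: fun_eq_iff)
    with d_nz[OF \<open>d i a b \<noteq> 0\<close>] show False by simp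
  qed
  moreover have "graded_free_res V (mspan M) (mspan N) ?F"
    unfolding graded_free_res_def
  proof (intro conjI)
    show "\<forall>i. \<forall>b<frank ?F i. \<forall>v. v \<notin> V \<longrightarrow> fdeg ?F i b v = 0"
      using deg by (simp add: F vdeg_def)
    show "\<forall>i. \<forall>a<frank ?F i. \<forall>b<frank ?F (Suc i). fmat ?F i a b \<in> poly_ring V \<and>
        homogeneous (\<lambda>v. fdeg ?F (Suc i) b v - fdeg ?F i a v) (fmat ?F i a b)"
      using mat hom by (simp add: F(1,2))
    show "\<forall>b<frank ?F 0. faug ?F b \<in> mspan M \<and> homogeneous (fdeg ?F 0 b) (faug ?F b)"
      using aug by (simp add: F homogeneous_hmono)
    show "\<forall>i. \<forall>X\<in>free_mod V (frank ?F (Suc i)). (fdiff ?F i X = (\<lambda>_. 0)) =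
       (\<exists>Y\<in>free_mod V (frank ?F (Suc (Suc i))). X = fdiff ?F (Suc i) Y)"
      by (rule allI) (rule ex_Suc)
  qed (rule sur ex0)+
  ultimately show ?thesis by (simp add: min_free_res_def)
qed

text \<open>The complex built from the scalars witnesses existence, and
  \<open>scalar_res_card_eq\<close> gives uniqueness, as the definite description in
  \<open>betti\<close> requires.\<close>

lemma betti_eq:
  fixes d :: "nat \<Rightarrow> nat \<Rightarrow> nat \<Rightarrow> 'k::field"
  assumes V: "finite V" and M: "up_closed V M" and N: "up_closed V N"
    and res: "scalar_res V (mdeg ` M) (mdeg ` N) (\<lambda>i. {..<r i}) deg d \<epsilon>"
  shows "betti V (mspan M :: ('v, 'k) mpoly set) (mspan N) i \<alpha> = card {b. b < r i \<and> deg i b = \<alpha>}"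
  unfolding betti_def
proof (rule the_equality)
  have "min_free_res V (mspan M) (mspan N) (complex_of_scalars r deg d \<epsilon>)"
    by (rule min_free_res_of_scalar_res[OF assms])
  then show "\<exists>F :: ('v, 'k) free_complex. min_free_res V (mspan M) (mspan N) F \<and>
      card {b. b < r i \<and> deg i b = \<alpha>} = card {b. b < frank F i \<and> fdeg F i b = \<alpha>}"
    by (intro exI[of _ "complex_of_scalars r deg d \<epsilon>"]) (simp add: complex_of_scalars_def)
next
  fix k assume "\<exists>F :: ('v, 'k) free_complex. min_free_res V (mspan M) (mspan N) F \<and>
      k = card {b. b < frank F i \<and> fdeg F i b = \<alpha>}"
  then obtain F :: "('v, 'k) free_complex" where F: "min_free_res V (mspan M) (mspan N) F"
    "k = card {b. b < frank F i \<and> fdeg F i b = \<alpha>}" by blast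
  show "k = card {b. b < r i \<and> deg i b = \<alpha>}"
    using scalar_res_card_eq[OF scalar_res_of_min_free_res[OF V M N F(1)] res, of i \<alpha>] F(2) by simp
qed

text \<open>It forces every minimal exponent in \<open>D\<close> to divide \<open>N\<close>, since
  the infimum divides it and lies in \<open>D\<close>. This form is the one that a graded family
  needs.\<close>

definition bounded_gens :: "'v expo set \<Rightarrow> ('v \<Rightarrow> int) \<Rightarrow> bool" where
  "bounded_gens D N \<longleftrightarrow> (\<forall>e\<in>D. inf (mdeg e) N \<in> mdeg ` D)"

lemma up_closed_empty: "up_closed V {}"
  by (simp add: up_closed_def)

lemma min_scalar_res:
  assumes V: "finite V" and D: "up_closed V D" and N: "N \<in> vdeg V" "(\<lambda>_. 0) \<le> N" "bounded_gens D N"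
  shows "\<exists>(r :: nat \<Rightarrow> nat) deg (d :: nat \<Rightarrow> nat \<Rightarrow> nat \<Rightarrow> 'k::field) \<epsilon>.
    scalar_res V (mdeg ` D) {} (\<lambda>i. {..<r i}) deg d \<epsilon> \<and>
    (\<forall>i b. b < r i \<longrightarrow> deg i b \<le> N \<and> deg i b \<in> mdeg ` D)"
proof (rule scalar_res_exists[OF V up_closed_mdeg(1)[OF D V] _ N(1,2)])
  show "(\<lambda>_. 0) \<le> \<alpha> \<and> inf \<alpha> N \<in> mdeg ` D" if "\<alpha> \<in> mdeg ` D" for \<alpha>
    using that N(3) mdeg_nonneg by (auto simp: bounded_gens_def)
next
  fix r :: "nat \<Rightarrow> nat" and deg and d :: "nat \<Rightarrow> nat \<Rightarrow> nat \<Rightarrow> 'k" and \<epsilon>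
  assume res: "scalar_res V (mdeg ` D) {} (\<lambda>i. {..<r i}) deg d \<epsilon>"
    and le: "\<And>i b. b < r i \<Longrightarrow> deg i b \<le> N"
  have "deg i b \<in> mdeg ` D" if "b < r i" for i b
    using scalar_res.deg_in_A[OF res refl, of b i] that by simp
  with res le show ?thesis by (intro exI conjI allI impI)
qed (rule up_closed_mdeg(2)[OF D V])

text \<open>\<open>betti\<close> refers to bases indexed by numbers, whereas the basis of a cone is
  a sum type. A numbered resolution from \<open>min_scalar_res\<close> mediates, since graded ranks
  agree across index types.\<close>

lemma betti_ideal_eq:
  fixes d :: "nat \<Rightarrow> 'b \<Rightarrow> 'b \<Rightarrow> 'k::field"
  assumes V: "finite V" and D: "up_closed V D" and N: "N \<in> vdeg V" "(\<lambda>_. 0) \<le> N" "bounded_gens D N"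
    and res: "scalar_res V (mdeg ` D) {} B deg d \<epsilon>"
  shows "betti_ideal V (mspan D :: ('v, 'k) mpoly set) i \<alpha> = card {b\<in>B i. deg i b = \<alpha>}"
proof -
  obtain r :: "nat \<Rightarrow> nat" and deg' and d' :: "nat \<Rightarrow> nat \<Rightarrow> nat \<Rightarrow> 'k" and \<epsilon>' where
    res': "scalar_res V (mdeg ` D) {} (\<lambda>i. {..<r i}) deg' d' \<epsilon>'"
    using min_scalar_res[OF V D N] by blast
  have "betti V (mspan D :: ('v, 'k) mpoly set) (mspan {}) i \<alpha> = card {b. b < r i \<and> deg' i b = \<alpha>}"
    by (rule betti_eq[OF V D up_closed_empty]) (use res' in simp)
  with scalar_res_card_eq[OF res' res, of i \<alpha>] show ?thesis by (simp add: mspan_empty)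
qed

lemma betti_quot_eq:
  assumes V: "finite V" and D: "up_closed V D" and N: "N \<in> vdeg V" "(\<lambda>_. 0) \<le> N" "bounded_gens D N"
    and proper: "0 \<notin> D"
  shows "betti_quot V (mspan D :: ('v, 'k::field) mpoly set) 0 \<alpha> = (if \<alpha> = (\<lambda>_. 0) then 1 else 0)"
    and "betti_quot V (mspan D :: ('v, 'k) mpoly set) (Suc i) \<alpha> = betti_ideal V (mspan D :: ('v, 'k) mpoly set) i \<alpha>"
proof -
  obtain r :: "nat \<Rightarrow> nat" and deg and d :: "nat \<Rightarrow> nat \<Rightarrow> nat \<Rightarrow> 'k" and \<epsilon> where
    res: "scalar_res V (mdeg ` D) {} (\<lambda>i. {..<r i}) deg d \<epsilon>"
    using min_scalar_res[OF V D N] by blast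
  let ?r = "\<lambda>i. case i of 0 \<Rightarrow> 1 | Suc j \<Rightarrow> r j"
  let ?deg = "\<lambda>i b. case i of 0 \<Rightarrow> (\<lambda>_. 0) | Suc j \<Rightarrow> deg j b"
  have B: "(\<lambda>i. case i of 0 \<Rightarrow> {0} | Suc j \<Rightarrow> {..<r j}) = (\<lambda>i. {..<?r i})"
    by (auto simp: fun_eq_iff split: nat.split)
  have R: "{\<alpha> \<in> vdeg V. (\<lambda>_. 0) \<le> \<alpha>} = mdeg ` {e. keys e \<subseteq> V}"
  proof (intro equalityI subsetI)
    fix \<beta> :: "'v \<Rightarrow> int" assume \<beta>: "\<beta> \<in> {\<alpha> \<in> vdeg V. (\<lambda>_. 0) \<le> \<alpha>}"
    then obtain e where e: "\<beta> = mdeg e" using range_mdegI[OF V] by auto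
    with \<beta> have "keys e \<subseteq> V" by (simp add: mdeg_vdeg_iff)
    with e show "\<beta> \<in> mdeg ` {e. keys e \<subseteq> V}" by blast
  next
    fix \<beta> :: "'v \<Rightarrow> int" assume "\<beta> \<in> mdeg ` {e. keys e \<subseteq> V}"
    then show "\<beta> \<in> {\<alpha> \<in> vdeg V. (\<lambda>_. 0) \<le> \<alpha>}" by (auto simp: mdeg_vdeg_iff mdeg_nonneg)
  qed
  have "(\<lambda>_. 0) \<notin> mdeg ` D"
  proof
    assume "(\<lambda>_. 0) \<in> mdeg ` D"
    then obtain e where e: "e \<in> D" "(\<lambda>_. 0) = mdeg e" by blast
    then have "mdeg e = mdeg 0" by (simp only: mdeg_zero)
    with e(1) proper show False by (simp only: mdeg_eq_iff)
  qed
  moreover have "(\<lambda>_. 0) \<le> \<alpha>" if "\<alpha> \<in> mdeg ` D" for \<alpha>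
    using that mdeg_nonneg by blast
  ultimately have "scalar_res V (mdeg ` {e. keys e \<subseteq> V}) (mdeg ` D) (\<lambda>i. {..<?r i}) ?deg
      (\<lambda>i a b. case i of 0 \<Rightarrow> if a = 0 then \<epsilon> b else 0 | Suc j \<Rightarrow> d j a b) (\<lambda>b. if b = 0 then 1 else 0)"
    unfolding B[symmetric] R[symmetric] by (intro scalar_res_quotient[OF res])
  moreover have "up_closed V {e. keys e \<subseteq> V}"
    using keys_add by (fastforce simp: up_closed_def)
  ultimately have b: "betti_quot V (mspan D :: ('v, 'k) mpoly set) i \<alpha> = card {b. b < ?r i \<and> ?deg i b = \<alpha>}" for i
    unfolding mspan_poly_ring[symmetric] by (intro betti_eq[OF V _ D])
  show "betti_quot V (mspan D :: ('v, 'k) mpoly set) 0 \<alpha> = (if \<alpha> = (\<lambda>_. 0) then 1 else 0)"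
    unfolding b by auto
  show "betti_quot V (mspan D :: ('v, 'k) mpoly set) (Suc i) \<alpha> = betti_ideal V (mspan D :: ('v, 'k) mpoly set) i \<alpha>"
    unfolding b betti_ideal_eq[OF V D N res] by simp
qed

lemma bounded_gens_mono:
  assumes "finite V" "up_closed V D" "bounded_gens D N" "N \<le> N'" "N' \<in> vdeg V"
  shows "bounded_gens D N'"
  unfolding bounded_gens_def
proof
  fix e assume e: "e \<in> D"
  have "inf (mdeg e) N' \<in> vdeg V"
    using assms(2,5) e by (intro inf_vdeg) (auto simp: mdeg_vdeg_iff up_closed_def)
  moreover have "inf (mdeg e) N \<in> mdeg ` D" using assms(3) e by (simp add: bounded_gens_def)
  ultimately show "inf (mdeg e) N' \<in> mdeg ` D"
    using up_closed_mdeg(2)[OF assms(2,1)] assms(4) by (meson inf_mono order_refl)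
qed

lemma up_closed_Un: "up_closed V D \<Longrightarrow> up_closed V D' \<Longrightarrow> up_closed V (D \<union> D')"
  by (auto simp: up_closed_def)

lemma up_closed_Int: "up_closed V D \<Longrightarrow> up_closed V D' \<Longrightarrow> up_closed V (D \<inter> D')"
  by (auto simp: up_closed_def)

text \<open>The degrees occurring in the minimal resolution of \<open>J \<inter> K\<close> lie in \<open>J \<inter> K\<close>, those occurring for
  \<open>J\<close> and \<open>K\<close> divide the bounds, so the comparison maps in the mapping cone have no unit entries.\<close>

lemma betti_splitting_numbers:
  assumes V: "finite V" and D: "up_closed V D" and N: "N \<in> vdeg V" "(\<lambda>_. 0) \<le> N" "bounded_gens D N"
    and D': "up_closed V D'" and N': "N' \<in> vdeg V" "(\<lambda>_. 0) \<le> N'" "bounded_gens D' N'"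
    and sep: "N \<notin> mdeg ` D'" "N' \<notin> mdeg ` D"
  shows "betti_ideal V (mspan (D \<union> D') :: ('v, 'k::field) mpoly set) i \<alpha> =
    betti_ideal V (mspan D :: ('v, 'k) mpoly set) i \<alpha> + betti_ideal V (mspan D' :: ('v, 'k) mpoly set) i \<alpha> +
    (if i = 0 then 0 else betti_ideal V (mspan (D \<inter> D') :: ('v, 'k) mpoly set) (i - 1) \<alpha>)"
proof -
  \<comment> \<open>The sum needs a bound valid for both ideals, and generators of the intersection
    are lcms of generators of the two.\<close>
  let ?N = "sup N N'"
  have N0: "?N \<in> vdeg V" "(\<lambda>_. 0) \<le> ?N"
    using N(1,2) N'(1) by (auto simp: vdeg_def le_supI1)
  have b: "bounded_gens D ?N" "bounded_gens D' ?N"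
    using bounded_gens_mono[OF V D N(3) _ N0(1)] bounded_gens_mono[OF V D' N'(3) _ N0(1)] by simp_all
  then have bU: "bounded_gens (D \<union> D') ?N" by (auto simp: bounded_gens_def)
  have bI: "bounded_gens (D \<inter> D') ?N"
    using b by (simp add: bounded_gens_def image_Int[OF inj_mdeg])
  note U = up_closed_Un[OF D D'] and I = up_closed_Int[OF D D']
  obtain r :: "nat \<Rightarrow> nat" and deg and d :: "nat \<Rightarrow> nat \<Rightarrow> nat \<Rightarrow> 'k" and \<epsilon> where
    G: "scalar_res V (mdeg ` D) {} (\<lambda>i. {..<r i}) deg d \<epsilon>"
    and degG: "\<And>i b. b < r i \<Longrightarrow> deg i b \<le> N" using min_scalar_res[OF V D N] by blast
  obtain r' :: "nat \<Rightarrow> nat" and deg' and d' :: "nat \<Rightarrow> nat \<Rightarrow> nat \<Rightarrow> 'k" and \<epsilon>' where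
    H: "scalar_res V (mdeg ` D') {} (\<lambda>i. {..<r' i}) deg' d' \<epsilon>'"
    and degH: "\<And>i b. b < r' i \<Longrightarrow> deg' i b \<le> N'" using min_scalar_res[OF V D' N'] by blast
  obtain q :: "nat \<Rightarrow> nat" and e and f :: "nat \<Rightarrow> nat \<Rightarrow> nat \<Rightarrow> 'k" and \<eta> where
    F: "scalar_res V (mdeg ` (D \<inter> D')) {} (\<lambda>i. {..<q i}) e f \<eta>"
    and degF: "\<And>i b. b < q i \<Longrightarrow> e i b \<in> mdeg ` (D \<inter> D')" using min_scalar_res[OF V I N0 bI] by blast
  have 1: "deg i a \<noteq> e i b" if "a \<in> {..<r i}" "b \<in> {..<q i}" for i a b
  proof
    assume "deg i a = e i b"
    then have "e i b \<le> N" using degG[of a i] that by simp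
    moreover have "e i b \<in> mdeg ` D'" using degF[of b i] that by auto
    ultimately show False using sep(1) up_closed_mdeg(2)[OF D' V _ N(1)] by blast
  qed
  have 2: "deg' i a \<noteq> e i b" if "a \<in> {..<r' i}" "b \<in> {..<q i}" for i a b
  proof
    assume "deg' i a = e i b"
    then have "e i b \<le> N'" using degH[of a i] that by simp
    moreover have "e i b \<in> mdeg ` D" using degF[of b i] that by auto
    ultimately show False using sep(2) up_closed_mdeg(2)[OF D V _ N'(1)] by blast
  qed
  have F': "scalar_res V (mdeg ` D \<inter> mdeg ` D') {} (\<lambda>i. {..<q i}) e f \<eta>"
    using F by (simp add: image_Int[OF inj_mdeg])
  let ?C = "cone_basis (\<lambda>i. {..<r i}) (\<lambda>i. {..<r' i}) (\<lambda>i. {..<q i})" and ?c = "cone_deg deg deg' e"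
  obtain dC :: "nat \<Rightarrow> nat + nat + nat \<Rightarrow> nat + nat + nat \<Rightarrow> 'k" and \<epsilon>C where
    C: "scalar_res V (mdeg ` (D \<union> D')) {} ?C ?c dC \<epsilon>C"
    using scalar_res_cone[OF G H F' 1 2] unfolding image_Un by blast
  have "{b \<in> ?C i. ?c i b = \<alpha>} = {b\<in>{..<r i}. deg i b = \<alpha>} <+> ({b\<in>{..<r' i}. deg' i b = \<alpha>} <+>
      (case i of 0 \<Rightarrow> {} | Suc j \<Rightarrow> {b\<in>{..<q j}. e j b = \<alpha>}))"
    by (cases i) (auto simp: cone_basis_def cone_deg_def)
  then have "card {b \<in> ?C i. ?c i b = \<alpha>} = card {b\<in>{..<r i}. deg i b = \<alpha>} + (card {b\<in>{..<r' i}. deg' i b = \<alpha>} +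
      card (case i of 0 \<Rightarrow> {} | Suc j \<Rightarrow> {b\<in>{..<q j}. e j b = \<alpha>}))"
    by (cases i) (simp_all add: card_Plus)
  then show ?thesis
    unfolding betti_ideal_eq[OF V U N0 bU C] betti_ideal_eq[OF V D N G] betti_ideal_eq[OF V D' N' H]
      betti_ideal_eq[OF V I N0 bI F]
    by (cases i) simp_all
qed

section \<open>Extension of monomial ideals\<close>

definition restr :: "'v set \<Rightarrow> 'v expo \<Rightarrow> 'v expo" where
  "restr W e = Poly_Mapping.mapp (\<lambda>v c. if v \<in> W then c else 0) e"

lemma lookup_restr [simp]: "lookup (restr W e) v = (if v \<in> W then lookup e v else 0)"
  by (simp add: restr_def lookup_mapp when_def in_keys_iff)

lemma keys_restr: "keys (restr W e) = keys e \<inter> W"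
  by (auto simp: in_keys_iff split: if_splits)

text \<open>Exponents of \<open>u I R\<close>, where \<open>I\<close> is an ideal of the ring in the variables \<open>W\<close>, \<open>D\<close> is its set of
  exponents, \<open>R\<close> is the ring in the variables \<open>V\<close>, and \<open>u\<close> is a monomial in the variables \<open>V - W\<close>.\<close>

definition ext :: "'v set \<Rightarrow> 'v set \<Rightarrow> 'v expo \<Rightarrow> 'v expo set \<Rightarrow> 'v expo set" where
  "ext V W u D = {e. keys e \<subseteq> V \<and>
     (\<forall>v. lookup u v \<le> lookup e v) \<and> restr W e \<in> D}"

lemma restr_add: "restr W (e + e') = restr W e + restr W e'"
  by (rule poly_mapping_eqI) (simp add: lookup_add)

lemma up_closed_ext:
  assumes "up_closed W D"
  shows "up_closed V (ext V W u D)"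
  unfolding up_closed_def
proof (intro ballI conjI allI impI)
  fix e assume e: "e \<in> ext V W u D"
  then show "keys e \<subseteq> V" by (simp add: ext_def)
  fix t :: "'a expo" assume t: "keys t \<subseteq> V"
  have "restr W e + restr W t \<in> D"
    using assms e unfolding up_closed_def ext_def by (simp add: keys_restr)
  moreover have "keys (e + t) \<subseteq> V" using e t keys_add[of e t] by (auto simp: ext_def)
  ultimately show "e + t \<in> ext V W u D"
    using e by (simp add: ext_def restr_add lookup_add trans_le_add1)
qed

text \<open>The right side has the shape of the set \<open>A'\<close> in
  \<open>scalar_res_extend\<close>. Such degrees are nonnegative on \<open>W\<close> by the last
  condition and on \<open>V - W\<close> by the middle one, hence are exponents.\<close>

lemma mdeg_ext:
  assumes "finite V" "W \<subseteq> V" "keys u \<subseteq> V - W"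
  shows "mdeg ` ext V W u D = {\<alpha> \<in> vdeg V. (\<forall>v\<in>V - W. mdeg u v \<le> \<alpha> v) \<and> vrestr W \<alpha> \<in> mdeg ` D}"
proof -
  have vr: "vrestr W (mdeg e) = mdeg (restr W e)" for e
    by (simp add: vrestr_def mdeg_def fun_eq_iff)
  have u: "lookup u v = 0" if "v \<notin> V - W" for v
    using assms(3) that by (auto simp: in_keys_iff)
  have le: "(\<forall>v. lookup u v \<le> lookup e v) \<longleftrightarrow> (\<forall>v\<in>V - W. mdeg u v \<le> mdeg e v)" for e
    using u by (auto simp: mdeg_def) (metis DiffI zero_le)
  have in_D: "restr W e \<in> D \<longleftrightarrow> vrestr W (mdeg e) \<in> mdeg ` D" for e
    unfolding vr by auto
  have "\<exists>e. \<alpha> = mdeg e"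
    if "\<alpha> \<in> vdeg V" "\<forall>v\<in>V - W. mdeg u v \<le> \<alpha> v" "vrestr W \<alpha> \<in> mdeg ` D" for \<alpha>
  proof -
    have "0 \<le> \<alpha> v" for v
    proof -
      have "0 \<le> vrestr W \<alpha> v" using that(3) by (auto simp: mdeg_def)
      moreover have "0 \<le> \<alpha> v" if "v \<in> V - W"
        using \<open>\<forall>v\<in>V - W. mdeg u v \<le> \<alpha> v\<close> that by (auto simp: mdeg_def intro: order_trans[rotated])
      ultimately show ?thesis using that(1) by (cases "v \<in> W"; cases "v \<in> V") (auto simp: vrestr_def vdeg_def)
    qed
    then show ?thesis using range_mdegI[OF assms(1) that(1)] by (auto simp: le_fun_def)
  qed
  then show ?thesis unfolding ext_def le in_D mdeg_vdeg_iff[symmetric] by blast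
qed

lemma bounded_gens_ext:
  assumes V: "finite V" "W \<subseteq> V" and u: "keys u \<subseteq> V - W"
    and N: "N \<in> vdeg W" "bounded_gens D N"
  shows "bounded_gens (ext V W u D) (\<lambda>v. N v + mdeg u v)"
  unfolding bounded_gens_def
proof
  have u0: "mdeg u v = 0" if "v \<in> W \<or> v \<notin> V" for v
    using u that by (auto simp: mdeg_def in_keys_iff)
  fix e assume "e \<in> ext V W u D"
  then have "mdeg e \<in> mdeg ` ext V W u D" by blast
  then have e: "mdeg e \<in> vdeg V" "\<forall>v\<in>V - W. mdeg u v \<le> mdeg e v" "vrestr W (mdeg e) \<in> mdeg ` D"
    unfolding mdeg_ext[OF V u] by auto
  let ?m = "inf (mdeg e) (\<lambda>v. N v + mdeg u v)"
  from e(3) obtain e' where e': "e' \<in> D" "vrestr W (mdeg e) = mdeg e'" by blast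
  have "vrestr W ?m = inf (mdeg e') N"
    unfolding e'(2)[symmetric] using N(1) u0 by (auto simp: vrestr_def vdeg_def fun_eq_iff)
  then have "vrestr W ?m \<in> mdeg ` D" using N(2) e'(1) by (simp add: bounded_gens_def)
  moreover have "?m \<in> vdeg V" using e(1) N(1) u0 V(2) by (auto simp: vdeg_def)
  moreover have "\<forall>v\<in>V - W. mdeg u v \<le> ?m v" using e(2) N(1) by (auto simp: vdeg_def)
  ultimately show "?m \<in> mdeg ` ext V W u D" unfolding mdeg_ext[OF V u] by blast
qed

lemma betti_ideal_ext:
  assumes V: "finite V" "W \<subseteq> V" and u: "keys u \<subseteq> V - W"
    and D: "up_closed W D" and N: "N \<in> vdeg W" "(\<lambda>_. 0) \<le> N" "bounded_gens D N"
  shows "betti_ideal V (mspan (ext V W u D) :: ('v, 'k::field) mpoly set) i \<alpha> =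
    betti_ideal W (mspan D :: ('v, 'k) mpoly set) i (\<lambda>v. \<alpha> v - mdeg u v)"
proof -
  have W: "finite W" using V finite_subset by blast
  obtain r :: "nat \<Rightarrow> nat" and deg and d :: "nat \<Rightarrow> nat \<Rightarrow> nat \<Rightarrow> 'k" and \<epsilon> where
    res: "scalar_res W (mdeg ` D) {} (\<lambda>i. {..<r i}) deg d \<epsilon>"
    using min_scalar_res[OF W D N] by blast
  have u': "mdeg u \<in> vdeg (V - W)" using u by (simp add: mdeg_vdeg_iff)
  note res' = scalar_res_extend[OF res V(2) u' mdeg_ext[OF V u]]
  have N': "(\<lambda>v. N v + mdeg u v) \<in> vdeg V" "(\<lambda>_. 0) \<le> (\<lambda>v. N v + mdeg u v)"
    using N(1,2) u' V(2) by (auto simp: vdeg_def le_fun_def mdeg_def)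
  have eq: "(\<lambda>v. deg i b v + mdeg u v) = \<alpha> \<longleftrightarrow> deg i b = (\<lambda>v. \<alpha> v - mdeg u v)" for b
    by (auto simp: fun_eq_iff algebra_simps)
  show ?thesis
    unfolding betti_ideal_eq[OF W D N res]
      betti_ideal_eq[OF V(1) up_closed_ext[OF D] N' bounded_gens_ext[OF V u N(1,3)] res'] eq ..
qed

section \<open>Monomial ideals and their minimal generators\<close>

lemma expo_dvd_iff:
  fixes e m :: "'v expo"
  shows "(\<exists>t. e = m + t) \<longleftrightarrow> (\<forall>v. lookup m v \<le> lookup e v)"
  unfolding mdeg_le_iff[symmetric] by (simp add: mdeg_def le_fun_def)

lemma keys_add_expo: "keys (e + t) = keys e \<union> keys (t :: 'v expo)"
  by (auto simp: in_keys_iff lookup_add)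

lemma mon_in_mspan [simp]: "mon e \<in> mspan D \<longleftrightarrow> e \<in> D"
  by (simp add: mon_def mspan_def)

lemma mspan_eq_iff [simp]: "(mspan D :: ('v, 'k::field) mpoly set) = mspan D' \<longleftrightarrow> D = D'"
  using mon_in_mspan[where 'a = 'v and 'b = 'k] by blast

lemma mspan_Int: "mspan D \<inter> mspan D' = mspan (D \<inter> D')"
  by (auto simp: mspan_def)

lemma mspan_Un: "{f + g | f g. f \<in> mspan D \<and> g \<in> mspan D'} = (mspan (D \<union> D') :: ('v, 'k::field) mpoly set)"
proof (intro equalityI subsetI)
  fix p :: "('v, 'k) mpoly" assume "p \<in> {f + g | f g. f \<in> mspan D \<and> g \<in> mspan D'}"
  then obtain f g where "p = f + g" "keys f \<subseteq> D" "keys g \<subseteq> D'"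
    by (auto simp: mspan_def)
  then show "p \<in> mspan (D \<union> D')" using keys_add[of f g] by (auto simp: mspan_def)
next
  fix p :: "('v, 'k) mpoly" assume p: "p \<in> mspan (D \<union> D')"
  define f where "f = Poly_Mapping.mapp (\<lambda>e c. if e \<in> D then c else 0) p"
  have lf: "lookup f e = (if e \<in> D then lookup p e else 0)" for e
    by (simp add: f_def lookup_mapp when_def in_keys_iff)
  have "f \<in> mspan D" by (auto simp: mspan_def in_keys_iff lf split: if_splits)
  moreover have "p - f \<in> mspan D'"
    using p by (auto simp: mspan_def in_keys_iff lf lookup_minus split: if_splits)
  moreover have "p = f + (p - f)" by simp
  ultimately show "p \<in> {f + g | f g. f \<in> mspan D \<and> g \<in> mspan D'}" by blast
qed

section \<open>Monomial ideals as spans of upward closed sets of exponents\<close>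

definition upset :: "'v set \<Rightarrow> 'v expo set \<Rightarrow> 'v expo set" where
  "upset V M = {e. keys e \<subseteq> V \<and>
     (\<exists>m\<in>M. \<forall>v. lookup m v \<le> lookup e v)}"

lemma up_closed_upset: "up_closed V (upset V M)"
  by (auto simp: up_closed_def upset_def keys_add_expo lookup_add intro: trans_le_add1)

lemma upset_up_closed:
  assumes "up_closed V D"
  shows "upset V D = D"
proof (intro equalityI subsetI)
  fix e assume "e \<in> upset V D"
  then obtain m t where "keys e \<subseteq> V" "m \<in> D" "e = m + t"
    unfolding upset_def using expo_dvd_iff by blast
  then show "e \<in> D" using assms by (auto simp: up_closed_def keys_add_expo)
qed (use assms in \<open>auto simp: upset_def up_closed_def\<close>)

lemma ideal_gen_mon:
  assumes M: "\<And>m. m \<in> M \<Longrightarrow> keys m \<subseteq> V"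
  shows "ideal_gen V (mon ` M :: ('v, 'k::field) mpoly set) = mspan (upset V M)"
proof (intro equalityI subsetI)
  fix p :: "('v, 'k) mpoly" assume "p \<in> ideal_gen V (mon ` M)"
  then obtain c T where p: "p = (\<Sum>s\<in>T. c s * s)" "T \<subseteq> mon ` M" "\<forall>s\<in>T. c s \<in> poly_ring V"
    unfolding ideal_gen_def by blast
  have "e \<in> upset V M" if "e \<in> keys p" for e
  proof -
    have "e \<in> (\<Union>s\<in>T. keys (c s * s))"
      using that keys_sum[of "\<lambda>s. c s * s" T] unfolding p(1) by blast
    then obtain s where s: "s \<in> T" "e \<in> keys (c s * s)" by blast
    then obtain m where m: "m \<in> M" "s = mon m" using p(2) by blast
    obtain a b where ab: "e = a + b" "a \<in> keys (c s)" "b \<in> keys s"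
      using keys_mult s(2) by blast
    from ab(3) have "b = m" by (simp add: m(2) mon_def)
    moreover have "keys a \<subseteq> V" using ab(2) p(3) s(1) by (auto simp: poly_ring_def)
    ultimately show ?thesis using M[OF m(1)] m(1) ab(1)
      by (auto simp: upset_def keys_add_expo lookup_add intro!: bexI[of _ m])
  qed
  then show "p \<in> mspan (upset V M)" by (auto simp: mspan_def)
next
  fix p :: "('v, 'k) mpoly" assume "p \<in> mspan (upset V M)"
  then have p: "e \<in> upset V M" if "e \<in> keys p" for e using that by (auto simp: mspan_def)
  have "\<exists>m t. m \<in> M \<and> e = m + t \<and> keys t \<subseteq> V" if "e \<in> keys p" for e
  proof -
    from p[OF that] obtain m t where "m \<in> M" "e = m + t" "keys e \<subseteq> V"
      unfolding upset_def using expo_dvd_iff by blast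
    then show ?thesis by (auto simp: keys_add_expo)
  qed
  then obtain m t where mt: "\<And>e. e \<in> keys p \<Longrightarrow> m e \<in> M"
    "\<And>e. e \<in> keys p \<Longrightarrow> e = m e + t e"
    "\<And>e. e \<in> keys p \<Longrightarrow> keys (t e) \<subseteq> V" by metis
  let ?K = "keys p" and ?g = "\<lambda>e. mon (m e) :: ('v, 'k) mpoly"
  let ?h = "\<lambda>e. Poly_Mapping.single (t e) (lookup p e)"
  \<comment> \<open>\<open>ideal_gen\<close> allows one coefficient per generator, so the terms of
    \<open>p\<close> assigned to the same generator are grouped.\<close>
  define c where "c = (\<lambda>s. \<Sum>e\<in>{e\<in>?K. ?g e = s}. ?h e)"
  have "p = (\<Sum>e\<in>?K. Poly_Mapping.single e (lookup p e))"
    by (rule poly_mapping_eqI) (simp add: lookup_sum lookup_single when_def in_keys_iff)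
  also have "\<dots> = (\<Sum>e\<in>?K. ?h e * ?g e)"
  proof (intro sum.cong refl)
    fix e assume e: "e \<in> ?K"
    show "Poly_Mapping.single e (lookup p e) = ?h e * ?g e"
      using mt(2)[OF e] by (simp add: mon_def mult_single add.commute)
  qed
  also have "\<dots> = (\<Sum>s\<in>?g ` ?K. \<Sum>e\<in>{e\<in>?K. ?g e = s}. ?h e * ?g e)"
    by (rule sum.image_gen) simp
  also have "\<dots> = (\<Sum>s\<in>?g ` ?K. c s * s)"
    unfolding c_def sum_distrib_right by (intro sum.cong) auto
  finally have "p = (\<Sum>s\<in>?g ` ?K. c s * s)" .
  moreover have "c s \<in> poly_ring V" for s
  proof -
    have "keys (c s) \<subseteq> t ` ?K"
      unfolding c_def using keys_sum[of ?h "{e\<in>?K. ?g e = s}"] by (auto split: if_splits)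
    then show ?thesis using mt(3) by (auto simp: poly_ring_def)
  qed
  moreover have "?g ` ?K \<subseteq> mon ` M" using mt(1) by blast
  ultimately show "p \<in> ideal_gen V (mon ` M)"
    unfolding ideal_gen_def by (intro CollectI exI[of _ c] exI[of _ "?g ` ?K"]) auto
qed

lemma monomial_ideal_iff: "monomial_ideal V I \<longleftrightarrow> (\<exists>D. up_closed V D \<and> I = mspan D)"
proof
  assume "monomial_ideal V I"
  then show "\<exists>D. up_closed V D \<and> I = mspan D"
    unfolding monomial_ideal_def using ideal_gen_mon up_closed_upset by metis
next
  assume "\<exists>D. up_closed V D \<and> I = mspan D"
  then obtain D where D: "up_closed V D" "I = mspan D" by blast
  have "ideal_gen V (mon ` D) = I"
    using ideal_gen_mon[of D V] D by (simp add: upset_up_closed up_closed_def)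
  then show "monomial_ideal V I" using D(1) unfolding monomial_ideal_def up_closed_def by blast
qed

definition min_expos :: "'v expo set \<Rightarrow> 'v expo set" where
  "min_expos D = {e \<in> D. \<forall>e' t. e = e' + t \<and> e' \<in> D \<longrightarrow> e' = e}"

lemma min_gens_mspan: "min_gens (mspan D :: ('v, 'k::field) mpoly set) = min_expos D"
  by (auto simp: min_gens_def min_expos_def)

text \<open>Descent on the total degree: an exponent that is not minimal has a proper divisor in
  \<open>D\<close>.\<close>

lemma min_expos_below:
  assumes V: "finite V" and D: "up_closed V D" and e: "e \<in> D"
  shows "\<exists>g\<in>min_expos D. \<exists>t. e = g + t"
  using e
proof (induction "\<Sum>v\<in>V. lookup e v" arbitrary: e rule: less_induct)
  case less
  show ?case
  proof (cases "e \<in> min_expos D")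
    case True
    then show ?thesis by (metis add.right_neutral)
  next
    case False
    then obtain e' t where e': "e = e' + t" "e' \<in> D" "e' \<noteq> e"
      using less.prems by (auto simp: min_expos_def)
    then have "t \<noteq> 0" by auto
    then obtain v where v: "lookup t v \<noteq> 0" by (metis lookup_zero poly_mapping_eqI)
    then have "v \<in> keys e" by (simp add: e'(1) in_keys_iff lookup_add)
    then have "v \<in> V" using D less.prems unfolding up_closed_def by blast
    then have "(\<Sum>v\<in>V. lookup t v) > 0" using V v by (metis gr0I sum_eq_0_iff)
    then have "(\<Sum>v\<in>V. lookup e' v) < (\<Sum>v\<in>V. lookup e v)"
      by (simp add: e'(1) lookup_add sum.distrib)
    from less.hyps[OF this e'(2)] obtain g t' where "g \<in> min_expos D" "e' = g + t'" by blast
    then show ?thesis using e'(1) by (metis add.assoc)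
  qed
qed

text \<open>\<open>N\<close> is the lcm of the minimal generators, so it is supported wherever all
  of them are; this is how the support condition on \<open>S\<close> reaches the bound.\<close>

lemma bounded_gens_exists:
  assumes V: "finite V" and D: "up_closed V D" and fin: "finite (min_expos D)"
    and S: "\<And>g. g \<in> min_expos D \<Longrightarrow> keys g \<subseteq> S"
  obtains N where "N \<in> vdeg V" "N \<in> vdeg S" "(\<lambda>_. 0) \<le> N" "bounded_gens D N"
proof
  let ?l = "mon_lcm (min_expos D)" and ?N = "mdeg (mon_lcm (min_expos D))"
  have vd: "?N \<in> vdeg T" if T: "\<And>g. g \<in> min_expos D \<Longrightarrow> keys g \<subseteq> T" for T
    unfolding mdeg_vdeg_iff
  proof
    fix v assume "v \<in> keys ?l"
    then have "Max (insert 0 ((\<lambda>e. lookup e v) ` min_expos D)) \<noteq> 0"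
      by (simp add: in_keys_iff lookup_mon_lcm[OF fin])
    moreover have "Max (insert 0 ((\<lambda>e. lookup e v) ` min_expos D))
        \<in> insert 0 ((\<lambda>e. lookup e v) ` min_expos D)" using fin by (intro Max_in) auto
    ultimately obtain g where "g \<in> min_expos D" "lookup g v \<noteq> 0" by auto
    then have "v \<in> keys g" by (simp add: in_keys_iff)
    with T[OF \<open>g \<in> min_expos D\<close>] show "v \<in> T" by blast
  qed
  have sub: "min_expos D \<subseteq> D" by (auto simp: min_expos_def)
  then show NV: "?N \<in> vdeg V" using D by (intro vd) (auto simp: up_closed_def)
  show "?N \<in> vdeg S" using S by (rule vd)
  show "(\<lambda>_. 0) \<le> ?N" by (rule mdeg_nonneg)
  show "bounded_gens D ?N"
    unfolding bounded_gens_def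
  proof
    fix e assume e: "e \<in> D"
    obtain g t where g: "g \<in> min_expos D" "e = g + t" using min_expos_below[OF V D e] by blast
    have "lookup g v \<le> lookup ?l v" for v
      unfolding lookup_mon_lcm[OF fin] using fin g(1) by (intro Max_ge) auto
    then have "mdeg g \<le> inf (mdeg e) ?N"
      by (simp add: le_fun_def mdeg_def g(2) lookup_add)
    moreover have "inf (mdeg e) ?N \<in> vdeg V"
      using D e NV by (intro inf_vdeg) (auto simp: mdeg_vdeg_iff up_closed_def)
    ultimately show "inf (mdeg e) ?N \<in> mdeg ` D"
      using up_closed_mdeg(2)[OF D V, of "mdeg g"] g(1) sub by blast
  qed
qed

text \<open>The supports keep the lcm of the generators of either ideal out of the other one.\<close>

lemma betti_splittingI:
  assumes V: "finite V" and D: "up_closed V D" "finite (min_expos D)"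
    and D': "up_closed V D'" "finite (min_expos D')"
    and S: "\<And>g. g \<in> min_expos D \<Longrightarrow> keys g \<subseteq> S" "\<And>e. e \<in> D' \<Longrightarrow> \<not> keys e \<subseteq> S"
    and S': "\<And>g. g \<in> min_expos D' \<Longrightarrow> keys g \<subseteq> S'" "\<And>e. e \<in> D \<Longrightarrow> \<not> keys e \<subseteq> S'"
  shows "betti_splitting V (mspan (D \<union> D') :: ('v, 'k::field) mpoly set) (mspan D) (mspan D')"
proof -
  obtain N where N: "N \<in> vdeg V" "N \<in> vdeg S" "(\<lambda>_. 0) \<le> N" "bounded_gens D N"
    using bounded_gens_exists[OF V D S(1)] by blast
  obtain N' where N': "N' \<in> vdeg V" "N' \<in> vdeg S'" "(\<lambda>_. 0) \<le> N'" "bounded_gens D' N'"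
    using bounded_gens_exists[OF V D' S'(1)] by blast
  have sep: "N \<notin> mdeg ` D'" "N' \<notin> mdeg ` D"
    using N(2) N'(2) S(2) S'(2) by (auto simp: mdeg_vdeg_iff)
  have sub: "min_expos D \<subseteq> D" "min_expos D' \<subseteq> D'" by (auto simp: min_expos_def)
  have "min_expos (D \<union> D') = min_expos D \<union> min_expos D'"
  proof (intro equalityI subsetI)
    fix g assume g: "g \<in> min_expos D \<union> min_expos D'"
    have "e' = g" if "g = e' + t" "e' \<in> D \<union> D'" for e' t
    proof -
      \<comment> \<open>Divisors have smaller support, so the separation of supports also stops an
        element of one ideal from dividing a generator of the other.\<close>
      have "keys e' \<subseteq> keys g" by (simp add: that(1) keys_add_expo)
      then have "g \<in> min_expos D \<and> e' \<in> D \<or> g \<in> min_expos D' \<and> e' \<in> D'"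
        using g that(2) S S' by blast
      then show ?thesis using that(1) by (auto simp: min_expos_def)
    qed
    then show "g \<in> min_expos (D \<union> D')" using g sub by (auto simp: min_expos_def)
  qed (auto simp: min_expos_def)
  moreover have "min_expos D \<inter> min_expos D' = {}" using S sub(2) by blast
  moreover have "monomial_ideal V (mspan (D \<union> D') :: ('v, 'k) mpoly set)"
    "monomial_ideal V (mspan D :: ('v, 'k) mpoly set)" "monomial_ideal V (mspan D' :: ('v, 'k) mpoly set)"
    unfolding monomial_ideal_iff using D(1) D'(1) up_closed_Un by blast+
  ultimately show ?thesis
    unfolding betti_splitting_def mspan_Un mspan_Int min_gens_mspan
    by (intro conjI allI refl betti_splitting_numbers[OF V D(1) N(1,3,4) D'(1) N'(1,3,4) sep])
qed

text \<open>Finiteness of the generating set comes from the list in the base case, and splittings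
  take unions.\<close>

lemma admits_min_prunedD:
  assumes "admits_min_pruned V (I :: ('v, 'k::field) mpoly set)"
  shows "\<exists>D. up_closed V D \<and> I = mspan D \<and> finite (min_expos D)"
proof -
  have "monomial_ideal V I \<and> finite (min_gens I)"
    using assms
  proof induction
    case (order I ms)
    then have "min_gens I = set ms" by (simp add: min_pruned_order_def)
    with order show ?case by simp
  next
    case (splitting I J K)
    then have "monomial_ideal V I" "min_gens I = min_gens J \<union> min_gens K"
      unfolding betti_splitting_def by blast+
    with splitting.IH show ?case by (simp only: finite_Un simp_thms)
  qed
  then show ?thesis unfolding monomial_ideal_iff using min_gens_mspan by metis
qed

lemma admits_min_pruned_mspanD:
  assumes "admits_min_pruned V (mspan D :: ('v, 'k::field) mpoly set)"
  shows "up_closed V D" "finite (min_expos D)"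
  using admits_min_prunedD[OF assms] by auto

section \<open>Pruned resolutions and multiplication by a monomial\<close>

lemma mon_lcm_empty: "mon_lcm {} = 0"
  by (rule poly_mapping_eqI) (simp add: lookup_mon_lcm)

lemma mon_lcm_single: "mon_lcm {m} = m"
  by (rule poly_mapping_eqI) (simp add: lookup_mon_lcm)

text \<open>The empty set is excluded because its lcm is the monomial 1, which does not move with
  \<open>u\<close>.\<close>

lemma mon_lcm_shift:
  assumes "finite M" "M \<noteq> {}"
  shows "mon_lcm ((\<lambda>m. m + u) ` M) = mon_lcm M + u"
proof (rule poly_mapping_eqI)
  fix v
  have max0: "Max (insert 0 (f ` M)) = Max (f ` M)" for f :: "'a expo \<Rightarrow> nat"
    using assms by simp
  show "lookup (mon_lcm ((\<lambda>m. m + u) ` M)) v = lookup (mon_lcm M + u) v"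
    using assms by (simp add: lookup_mon_lcm lookup_add image_image max0
        Max_add_commute[of M "\<lambda>m. lookup m v"])
qed

lemma face_lcm_shift:
  assumes "\<sigma> \<subseteq> {..<length ms}" "\<sigma> \<noteq> {}"
  shows "face_lcm (map (\<lambda>m. m + u) ms) \<sigma> = face_lcm ms \<sigma> + u"
proof -
  have fin: "finite \<sigma>" using assms(1) finite_subset by blast
  have "(!) (map (\<lambda>m. m + u) ms) ` \<sigma> = (\<lambda>m. m + u) ` (!) ms ` \<sigma>"
    using assms(1) by (auto simp: image_image intro!: image_cong)
  then show ?thesis using fin assms(2) by (simp add: face_lcm_def mon_lcm_shift)
qed

lemma face_lcm_eq_empty:
  assumes "0 \<notin> set ms" "j < length ms"
  shows "face_lcm ms {} \<noteq> face_lcm ms (insert j {})"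
proof -
  have "ms ! j \<noteq> 0" using assms nth_mem[OF assms(2)] by metis
  then show ?thesis by (simp add: face_lcm_def mon_lcm_empty mon_lcm_single)
qed

text \<open>Equality of lcms of nonempty faces is unaffected by a common factor. The empty face,
  whose lcm does not move, is never matched on either side, since no generator is 1; hence the same
  edges are selected.\<close>

lemma pruned_edges_shift:
  assumes "0 \<notin> set ms" "j \<le> length ms"
  shows "pruned_edges (map (\<lambda>m. m + u) ms) j = pruned_edges ms j"
  using assms(2)
proof (induction j)
  case (Suc j)
  have 0: "0 \<notin> set (map (\<lambda>m. m + u) ms)"
  proof
    assume "0 \<in> set (map (\<lambda>m. m + u) ms)"
    then obtain m where "m \<in> set ms" "m + u = 0" by auto
    moreover have "m = 0" if "m + u = 0"
      using that by (intro poly_mapping_eqI) (metis add_is_0 lookup_add lookup_zero)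
    ultimately show False using assms(1) by simp
  qed
  have "face_lcm (map (\<lambda>m. m + u) ms) \<sigma> = face_lcm (map (\<lambda>m. m + u) ms) (insert j \<sigma>) \<longleftrightarrow>
      face_lcm ms \<sigma> = face_lcm ms (insert j \<sigma>)" if "\<sigma> \<subseteq> {..<length ms}" for \<sigma>
  proof (cases "\<sigma> = {}")
    case True
    then show ?thesis
      using face_lcm_eq_empty[OF 0, of j] face_lcm_eq_empty[OF assms(1), of j] Suc.prems by simp
  next
    case False
    then show ?thesis
      using that Suc.prems face_lcm_shift[of \<sigma> ms u] face_lcm_shift[of "insert j \<sigma>" ms u] by simp
  qed
  then show ?case using Suc by (auto simp: Suc_le_eq)
qed simp

lemma empty_face_critical:
  assumes "0 \<notin> set ms"
  shows "{} \<in> critical_faces ms"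
proof -
  have "{} \<notin> edge_ends (pruned_edges ms j)" if "j \<le> length ms" for j
    using that
  proof (induction j)
    case (Suc j)
    then show ?case using face_lcm_eq_empty[OF assms, of j]
      by (auto simp: edge_ends_def image_Un)
  qed (simp add: edge_ends_def)
  then show ?thesis by (simp add: critical_faces_def)
qed

lemma pruned_rank_0:
  assumes "0 \<notin> set ms"
  shows "pruned_rank ms 0 \<alpha> = (if \<alpha> = (\<lambda>_. 0) then 1 else 0)"
proof -
  have "{\<sigma> \<in> critical_faces ms. card \<sigma> = 0 \<and> mdeg (face_lcm ms \<sigma>) = \<alpha>} =
      (if \<alpha> = (\<lambda>_. 0) then {{}} else {})"
    using empty_face_critical[OF assms] finite_subset[of _ "{..<length ms}"]
    by (auto simp: critical_faces_def face_lcm_def mon_lcm_empty)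
  then show ?thesis by (simp add: pruned_rank_def)
qed

text \<open>Restricted to positive homological degree because the empty face keeps multidegree
  0.\<close>

lemma pruned_rank_shift:
  assumes "0 \<notin> set ms"
  shows "pruned_rank (map (\<lambda>m. m + u) ms) (Suc i) \<alpha> = pruned_rank ms (Suc i) (\<lambda>v. \<alpha> v - mdeg u v)"
proof -
  have crit: "critical_faces (map (\<lambda>m. m + u) ms) = critical_faces ms"
    using pruned_edges_shift[OF assms, of "length ms" u] by (simp add: critical_faces_def)
  have "mdeg (face_lcm (map (\<lambda>m. m + u) ms) \<sigma>) = \<alpha> \<longleftrightarrow> mdeg (face_lcm ms \<sigma>) = (\<lambda>v. \<alpha> v - mdeg u v)"
    if "\<sigma> \<in> critical_faces ms" "card \<sigma> = Suc i" for \<sigma>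
  proof -
    have "\<sigma> \<subseteq> {..<length ms}" "\<sigma> \<noteq> {}" using that by (auto simp: critical_faces_def)
    then show ?thesis by (auto simp: face_lcm_shift mdeg_add fun_eq_iff algebra_simps)
  qed
  then have "{\<sigma> \<in> critical_faces ms. card \<sigma> = Suc i \<and> mdeg (face_lcm (map (\<lambda>m. m + u) ms) \<sigma>) = \<alpha>} =
      {\<sigma> \<in> critical_faces ms. card \<sigma> = Suc i \<and> mdeg (face_lcm ms \<sigma>) = (\<lambda>v. \<alpha> v - mdeg u v)}"
    by blast
  then show ?thesis by (simp add: pruned_rank_def crit)
qed

section \<open>Closure properties of ideals admitting minimal pruned resolutions\<close>

lemma ext_Un: "ext V W u (D \<union> D') = ext V W u D \<union> ext V W u D'"
  by (auto simp: ext_def)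

lemma ext_Int: "ext V W u (D \<inter> D') = ext V W u D \<inter> ext V W u D'"
  by (auto simp: ext_def)

lemma zero_notin_ext: "0 \<notin> D \<Longrightarrow> 0 \<notin> ext V W u D"
proof -
  have "restr W 0 = 0" by (rule poly_mapping_eqI) simp
  then show "0 \<notin> D \<Longrightarrow> 0 \<notin> ext V W u D" by (simp add: ext_def)
qed

text \<open>Every \<open>e\<close> in the extension is divisible by \<open>restr W e + u\<close>,
  which lies in the extension too; a minimal \<open>e\<close> therefore carries exactly
  \<open>u\<close> outside \<open>W\<close> and a minimal exponent of \<open>D\<close>
  inside.\<close>

lemma min_expos_ext:
  assumes WV: "W \<subseteq> V" and u: "keys u \<subseteq> V - W" and D: "up_closed W D"
  shows "min_expos (ext V W u D) = (\<lambda>m. m + u) ` min_expos D"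
proof -
  have u0: "lookup u v = 0" if "v \<in> W" for v using u that by (auto simp: in_keys_iff)
  have r: "restr W (g + u) = g" if "g \<in> D" for g
  proof (rule poly_mapping_eqI)
    fix v
    have "keys g \<subseteq> W" using D that by (simp add: up_closed_def)
    then have "v \<in> W \<or> lookup g v = 0" by (auto simp: in_keys_iff)
    then show "lookup (restr W (g + u)) v = lookup g v"
      using u0 by (auto simp: lookup_add)
  qed
  have mem: "g + u \<in> ext V W u D" if "g \<in> D" for g
  proof -
    have "keys g \<subseteq> W" using D that by (simp add: up_closed_def)
    then have "keys (g + u) \<subseteq> V" using u WV by (auto simp: keys_add_expo)
    then show ?thesis using r[OF that] that by (simp add: ext_def lookup_add)
  qed
  have dvd: "\<exists>t. e = (restr W e + u) + t" if "e \<in> ext V W u D" for e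
    unfolding expo_dvd_iff using that u0 by (auto simp: lookup_add ext_def)
  have restr_mem: "restr W e \<in> D" if "e \<in> ext V W u D" for e using that by (simp add: ext_def)
  show ?thesis
  proof (intro equalityI subsetI)
    fix e assume e: "e \<in> min_expos (ext V W u D)"
    then have eD: "e \<in> ext V W u D" by (simp add: min_expos_def)
    have eq: "restr W e + u = e"
      using dvd[OF eD] mem[OF restr_mem[OF eD]] e unfolding min_expos_def by blast
    have "g' = restr W e" if "restr W e = g' + t" "g' \<in> D" for g' t
    proof -
      have "e = (g' + u) + t" using eq that(1) by (simp add: ac_simps)
      then have "g' + u = e" using mem[OF that(2)] e unfolding min_expos_def by blast
      then have "g' + u = restr W e + u" using eq by simp
      then show ?thesis by simp
    qed
    then have "restr W e \<in> min_expos D" using restr_mem[OF eD] by (auto simp: min_expos_def)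
    then show "e \<in> (\<lambda>m. m + u) ` min_expos D" using eq by (intro image_eqI[of _ _ "restr W e"]) simp_all
  next
    fix e assume "e \<in> (\<lambda>m. m + u) ` min_expos D"
    then obtain g where g: "g \<in> min_expos D" "e = g + u" by blast
    then have gD: "g \<in> D" by (simp add: min_expos_def)
    have "e' = e" if "e = e' + t" "e' \<in> ext V W u D" for e' t
    proof -
      have "restr W (e' + t) = g" using r[OF gD] g(2) that(1) by simp
      then have "g = restr W e' + restr W t" by (simp add: restr_add)
      then have "restr W e' = g" using g(1) restr_mem[OF that(2)] unfolding min_expos_def by blast
      then have "\<exists>t'. e' = e + t'" using dvd[OF that(2)] g(2) by simp
      then obtain t' where "e' = e + t'" ..
      then have "e' + (t' + t) = e' + 0" using that(1) by (simp add: ac_simps)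
      then have "t' + t = 0" by (simp only: add_left_cancel)
      then have "t = 0" by (intro poly_mapping_eqI) (metis add_is_0 lookup_add lookup_zero)
      then show ?thesis using that(1) by simp
    qed
    then show "e \<in> min_expos (ext V W u D)" using mem[OF gD] g(2) by (auto simp: min_expos_def)
  qed
qed

text \<open>By induction on the derivation. A good order stays good after multiplying all generators
  by \<open>u\<close>, since pruned ranks and Betti numbers shift alike; a Betti splitting stays one
  because \<open>ext\<close> commutes with unions and intersections and shifts all Betti numbers in
  the same way.\<close>

lemma admits_min_pruned_ext:
  assumes "admits_min_pruned W (mspan D :: ('v, 'k::field) mpoly set)"
    and V: "finite V" "W \<subseteq> V" and u: "keys u \<subseteq> V - W" and "0 \<notin> D"
  shows "admits_min_pruned V (mspan (ext V W u D) :: ('v, 'k) mpoly set)"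
proof -
  have W: "finite W" using V finite_subset by blast
  have bound: "\<exists>N. N \<in> vdeg W \<and> (\<lambda>_. 0) \<le> N \<and> bounded_gens D N"
    if "up_closed W D" "finite (min_expos D)" for D
  proof -
    have "keys g \<subseteq> W" if "g \<in> min_expos D" for g
      using that \<open>up_closed W D\<close> by (auto simp: min_expos_def up_closed_def)
    from bounded_gens_exists[OF W that this] show ?thesis by blast
  qed
  have num: "betti_ideal V (mspan (ext V W u D) :: ('v, 'k) mpoly set) i \<alpha> =
    betti_ideal W (mspan D :: ('v, 'k) mpoly set) i (\<lambda>v. \<alpha> v - mdeg u v)"
    if "up_closed W D" "finite (min_expos D)" for D i \<alpha>
    using bound[OF that] betti_ideal_ext[OF V u that(1)] by blast
  have "admits_min_pruned V (mspan (ext V W u D) :: ('v, 'k) mpoly set)"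
    if "admits_min_pruned W I" "I = (mspan D :: ('v, 'k) mpoly set)" "0 \<notin> D" for I D
    using that
  proof (induction arbitrary: D)
    case (order I ms)
    have ms: "distinct ms" "set ms = min_expos D" "\<And>i \<alpha>. pruned_rank ms i \<alpha> = betti_quot W I i \<alpha>"
      using order.hyps(2) unfolding min_pruned_order_def order.prems(1) min_gens_mspan by auto
    have D: "up_closed W D" using order.hyps(1) unfolding monomial_ideal_iff order.prems(1) by simp
    have fin: "finite (min_expos D)" unfolding ms(2)[symmetric] by simp
    obtain N where N: "N \<in> vdeg W" "(\<lambda>_. 0) \<le> N" "bounded_gens D N" using bound[OF D fin] by blast
    have uD: "up_closed V (ext V W u D)" using D by (rule up_closed_ext)
    have N': "(\<lambda>v. N v + mdeg u v) \<in> vdeg V" "(\<lambda>_. 0) \<le> (\<lambda>v. N v + mdeg u v)"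
      using N(1,2) u V(2) mdeg_vdeg_iff[of u "V - W"] by (auto simp: vdeg_def le_fun_def mdeg_def)
    have nz: "0 \<notin> set ms" using order.prems(2) ms(2) by (simp add: min_expos_def)
    have nz': "0 \<notin> set (map (\<lambda>m. m + u) ms)"
      using zero_notin_ext[OF order.prems(2), of V W u] min_expos_ext[OF V(2) u D] ms(2)
      by (auto simp: min_expos_def)
    have "min_pruned_order V (mspan (ext V W u D) :: ('v, 'k) mpoly set) (map (\<lambda>m. m + u) ms)"
      unfolding min_pruned_order_def min_gens_mspan
    proof (intro conjI allI)
      show "distinct (map (\<lambda>m. m + u) ms)" using ms(1) by (simp add: distinct_map inj_on_def)
      show "set (map (\<lambda>m. m + u) ms) = min_expos (ext V W u D)"
        using min_expos_ext[OF V(2) u D] ms(2) by simp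
      fix i \<alpha>
      show "pruned_rank (map (\<lambda>m. m + u) ms) i \<alpha> = betti_quot V (mspan (ext V W u D) :: ('v, 'k) mpoly set) i \<alpha>"
      proof (cases i)
        case 0
        show ?thesis
          unfolding 0 pruned_rank_0[OF nz']
            betti_quot_eq(1)[OF V(1) uD N' bounded_gens_ext[OF V u N(1,3)] zero_notin_ext[OF order.prems(2)]] ..
      next
        case (Suc j)
        have "pruned_rank ms (Suc j) \<beta> = betti_ideal W (mspan D :: ('v, 'k) mpoly set) j \<beta>" for \<beta>
          using ms(3)[of "Suc j" \<beta>] betti_quot_eq(2)[OF W D N order.prems(2), of j \<beta>]
          unfolding order.prems(1) by simp
        then show ?thesis
          unfolding Suc pruned_rank_shift[OF nz]
            betti_quot_eq(2)[OF V(1) uD N' bounded_gens_ext[OF V u N(1,3)] zero_notin_ext[OF order.prems(2)]]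
            num[OF D fin] by simp
      qed
    qed
    moreover have "monomial_ideal V (mspan (ext V W u D) :: ('v, 'k) mpoly set)"
      unfolding monomial_ideal_iff using uD by blast
    ultimately show ?case by (intro admits_min_pruned.order)
  next
    case (splitting I J K)
    obtain D1 where D1: "up_closed W D1" "J = mspan D1" "finite (min_expos D1)"
      using admits_min_prunedD[OF splitting.hyps(2)] by blast
    obtain D2 where D2: "up_closed W D2" "K = mspan D2" "finite (min_expos D2)"
      using admits_min_prunedD[OF splitting.hyps(3)] by blast
    have D12: "up_closed W (D1 \<inter> D2)" "finite (min_expos (D1 \<inter> D2))"
      using admits_min_pruned_mspanD[of W "D1 \<inter> D2"] splitting.hyps(4)
      unfolding D1(2) D2(2) mspan_Int by blast+
    note sp = splitting.hyps(1)[unfolded betti_splitting_def D1(2) D2(2) mspan_Un splitting.prems(1)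
        mspan_eq_iff min_gens_mspan mspan_Int]
    have D: "D = D1 \<union> D2" using sp by blast
    have Dup: "up_closed W D" unfolding D using D1(1) D2(1) by (rule up_closed_Un)
    have m: "min_expos D = min_expos D1 \<union> min_expos D2" "min_expos D1 \<inter> min_expos D2 = {}"
      using sp by blast+
    have fin: "finite (min_expos D)" unfolding m using D1(3) D2(3) by blast
    have b: "betti_ideal W (mspan D :: ('v, 'k) mpoly set) i \<alpha> =
        betti_ideal W (mspan D1 :: ('v, 'k) mpoly set) i \<alpha> + betti_ideal W (mspan D2 :: ('v, 'k) mpoly set) i \<alpha> +
        (if i = 0 then 0 else betti_ideal W (mspan (D1 \<inter> D2) :: ('v, 'k) mpoly set) (i - 1) \<alpha>)" for i \<alpha>
      using sp by blast
    let ?e = "ext V W u"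
    have sp': "betti_splitting V (mspan (?e D) :: ('v, 'k) mpoly set) (mspan (?e D1)) (mspan (?e D2))"
      unfolding betti_splitting_def mspan_Un min_gens_mspan mspan_Int
    proof (intro conjI allI)
      show "monomial_ideal V (mspan (?e D) :: ('v, 'k) mpoly set)"
        "monomial_ideal V (mspan (?e D1) :: ('v, 'k) mpoly set)"
        "monomial_ideal V (mspan (?e D2) :: ('v, 'k) mpoly set)"
        unfolding monomial_ideal_iff using up_closed_ext Dup D1(1) D2(1) by blast+
      show "(mspan (?e D) :: ('v, 'k) mpoly set) = mspan (?e D1 \<union> ?e D2)" by (simp add: D ext_Un)
      show "min_expos (?e D) = min_expos (?e D1) \<union> min_expos (?e D2)"
        unfolding min_expos_ext[OF V(2) u Dup] min_expos_ext[OF V(2) u D1(1)]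
          min_expos_ext[OF V(2) u D2(1)] m(1) by blast
      show "min_expos (?e D1) \<inter> min_expos (?e D2) = {}"
        unfolding min_expos_ext[OF V(2) u D1(1)] min_expos_ext[OF V(2) u D2(1)] using m(2) by auto
      show "betti_ideal V (mspan (?e D) :: ('v, 'k) mpoly set) i \<alpha> =
        betti_ideal V (mspan (?e D1) :: ('v, 'k) mpoly set) i \<alpha> + betti_ideal V (mspan (?e D2) :: ('v, 'k) mpoly set) i \<alpha> +
        (if i = 0 then 0 else betti_ideal V (mspan (?e D1 \<inter> ?e D2) :: ('v, 'k) mpoly set) (i - 1) \<alpha>)" for i \<alpha>
        unfolding ext_Int[symmetric] num[OF Dup fin] num[OF D1(1,3)] num[OF D2(1,3)] num[OF D12] by (rule b)
    qed
    have 0: "0 \<notin> D1" "0 \<notin> D2" "0 \<notin> D1 \<inter> D2" using splitting.prems(2) D by auto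
    have "admits_min_pruned V (mspan (?e D1) :: ('v, 'k) mpoly set)"
      "admits_min_pruned V (mspan (?e D2) :: ('v, 'k) mpoly set)"
      "admits_min_pruned V (mspan (?e D1) \<inter> mspan (?e D2) :: ('v, 'k) mpoly set)"
      using splitting.IH(1)[OF D1(2) 0(1)] splitting.IH(2)[OF D2(2) 0(2)] splitting.IH(3)[OF _ 0(3)]
      unfolding D1(2) D2(2) mspan_Int ext_Int by simp_all
    with sp' show ?case by (rule admits_min_pruned.splitting)
  qed
  then show ?thesis using assms(1,5) by simp
qed

text \<open>For a proper ideal the ranks in homological degree 0 agree automatically, both coming
  from the single generator of R, and the Betti numbers of R/I in degree \<open>Suc i\<close> are
  those of I in degree \<open>i\<close>.\<close>

lemma admits_min_pruned_order:
  assumes V: "finite V" and D: "up_closed V D" and "0 \<notin> D"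
    and ms: "distinct ms" "set ms = min_expos D"
    and rank: "\<And>i \<alpha>. pruned_rank ms (Suc i) \<alpha> = betti_ideal V (mspan D :: ('v, 'k::field) mpoly set) i \<alpha>"
  shows "admits_min_pruned V (mspan D :: ('v, 'k) mpoly set)"
proof (rule admits_min_pruned.order)
  show "monomial_ideal V (mspan D :: ('v, 'k) mpoly set)" using D monomial_ideal_iff by blast
  have "finite (min_expos D)" unfolding ms(2)[symmetric] by simp
  moreover have "keys g \<subseteq> V" if "g \<in> min_expos D" for g
    using D that by (auto simp: min_expos_def up_closed_def)
  ultimately obtain N where N: "N \<in> vdeg V" "(\<lambda>_. 0) \<le> N" "bounded_gens D N"
    using bounded_gens_exists[OF V D] by blast
  have "0 \<notin> set ms" using assms(3) ms(2) by (simp add: min_expos_def)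
  have "pruned_rank ms i \<alpha> = betti_quot V (mspan D :: ('v, 'k) mpoly set) i \<alpha>" for i \<alpha>
  proof (cases i)
    case 0
    show ?thesis unfolding 0 pruned_rank_0[OF \<open>0 \<notin> set ms\<close>] betti_quot_eq(1)[OF V D N assms(3)] ..
  next
    case (Suc j)
    show ?thesis unfolding Suc rank betti_quot_eq(2)[OF V D N assms(3)] ..
  qed
  then show "min_pruned_order V (mspan D :: ('v, 'k) mpoly set) ms"
    using ms by (simp add: min_pruned_order_def min_gens_mspan)
qed

text \<open>Starts the induction over sums; it is also the value of x_n J when x_n is
  isolated.\<close>

lemma admits_min_pruned_zero:
  assumes "finite V"
  shows "admits_min_pruned V (mspan {} :: ('v, 'k::field) mpoly set)"
proof (rule admits_min_pruned_order[where ms = "[]"])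
  have N: "(\<lambda>_. 0) \<in> vdeg V" "(\<lambda>_. 0) \<le> (\<lambda>_. 0 :: int)" "bounded_gens {} (\<lambda>_. 0)"
    by (simp_all add: vdeg_def bounded_gens_def)
  obtain r :: "nat \<Rightarrow> nat" and deg and d :: "nat \<Rightarrow> nat \<Rightarrow> nat \<Rightarrow> 'k" and \<epsilon> where
    res: "scalar_res V (mdeg ` {}) {} (\<lambda>i. {..<r i}) deg d \<epsilon>" "\<forall>i b. b < r i \<longrightarrow> deg i b \<in> mdeg ` {}"
    using min_scalar_res[OF assms up_closed_empty N] by blast
  fix i and \<alpha> :: "'v \<Rightarrow> int"
  have "pruned_rank [] (Suc i) \<alpha> = 0"
    by (auto simp: pruned_rank_def critical_faces_def)
  then show "pruned_rank [] (Suc i) \<alpha> = betti_ideal V (mspan {} :: ('v, 'k) mpoly set) i \<alpha>"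
    using res(2) unfolding betti_ideal_eq[OF assms up_closed_empty N res(1)] by simp
qed (use assms in \<open>auto simp: up_closed_def min_expos_def\<close>)

lemma admits_min_pruned_principal:
  assumes V: "finite V" and m: "keys m \<subseteq> V" "m \<noteq> 0"
  shows "admits_min_pruned V (mspan (upset V {m}) :: ('v, 'k::field) mpoly set)"
proof (rule admits_min_pruned_order[where ms = "[m]"])
  let ?D = "upset V {m}"
  have dvd: "e \<in> ?D \<longleftrightarrow> keys e \<subseteq> V \<and> (\<exists>t. e = m + t)" for e
    unfolding expo_dvd_iff by (simp add: upset_def)
  have antisym: "t = 0" if "m = m + t' + t" for t t' :: "'v expo"
  proof (rule poly_mapping_eqI)
    fix v
    have "lookup m v = lookup (m + t' + t) v" using that by simp
    then show "lookup t v = lookup 0 v" by (simp add: lookup_add)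
  qed
  have mD: "m \<in> ?D" using m(1) by (simp add: upset_def)
  have "e = m" if "e \<in> min_expos ?D" for e
    using that mD dvd unfolding min_expos_def by blast
  moreover have "m \<in> min_expos ?D"
    unfolding min_expos_def
  proof (intro CollectI conjI mD allI impI)
    fix e' t assume a: "m = e' + t \<and> e' \<in> ?D"
    then obtain t' where "e' = m + t'" using dvd by blast
    with a have "m = m + t' + t" by simp
    then have "t = 0" by (rule antisym)
    with a show "e' = m" by simp
  qed
  ultimately show me: "set [m] = min_expos ?D" by auto
  show "up_closed V ?D" by (rule up_closed_upset)
  then have N: "mdeg m \<in> vdeg V" "(\<lambda>_. 0) \<le> mdeg m" "bounded_gens ?D (mdeg m)"
  proof -
    show "mdeg m \<in> vdeg V" using m(1) by (simp add: mdeg_vdeg_iff)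
    show "(\<lambda>_. 0) \<le> mdeg m" by (rule mdeg_nonneg)
    have "inf (mdeg e) (mdeg m) = mdeg m" if "e \<in> ?D" for e
      using that dvd mdeg_le_iff[of m e] by (intro inf_absorb2) blast
    then show "bounded_gens ?D (mdeg m)" using mD by (simp add: bounded_gens_def)
  qed
  show "0 \<notin> ?D"
  proof
    assume "0 \<in> ?D"
    then have "m = 0" by (intro poly_mapping_eqI) (simp add: upset_def)
    with m(2) show False by simp
  qed
  have eq: "mdeg ` ?D = {\<alpha> \<in> vdeg V. mdeg m \<le> \<alpha>}"
  proof (intro equalityI subsetI)
    fix \<alpha> assume \<alpha>: "\<alpha> \<in> {\<alpha> \<in> vdeg V. mdeg m \<le> \<alpha>}"
    then show "\<alpha> \<in> mdeg ` ?D"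
      using up_closed_mdeg(2)[OF up_closed_upset V, of "mdeg m" "{m}" \<alpha>] mD by blast
  next
    fix \<alpha> assume "\<alpha> \<in> mdeg ` ?D"
    then show "\<alpha> \<in> {\<alpha> \<in> vdeg V. mdeg m \<le> \<alpha>}"
      unfolding upset_def by (auto simp: mdeg_vdeg_iff le_fun_def mdeg_def vdeg_def in_keys_iff)
  qed
  fix i and \<alpha> :: "'v \<Rightarrow> int"
  have betti: "betti_ideal V (mspan ?D :: ('v, 'k) mpoly set) i \<alpha> = (if i = 0 \<and> mdeg m = \<alpha> then 1 else 0)"
    unfolding betti_ideal_eq[OF V up_closed_upset N scalar_res_principal[OF N(1), folded eq]] by simp
  have "face_lcm [m] {} \<noteq> face_lcm [m] {0}"
    using m(2) by (simp add: face_lcm_def mon_lcm_empty mon_lcm_single)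
  moreover have "\<sigma> = {}" if "\<sigma> \<subseteq> {..<length [m]}" "0 \<notin> \<sigma>" for \<sigma>
    using that by (auto simp: lessThan_Suc)
  ultimately have edges: "pruned_edges [m] (Suc 0) = {}" by auto
  have len: "length [m] = Suc 0" by simp
  have crit: "critical_faces [m] = {{}, {0}}"
    unfolding critical_faces_def len edges edge_ends_def
    by (simp add: lessThan_Suc Pow_insert insert_commute)
  have "{\<sigma> \<in> critical_faces [m]. card \<sigma> = Suc i \<and> mdeg (face_lcm [m] \<sigma>) = \<alpha>} =
      (if i = 0 \<and> mdeg m = \<alpha> then {{0}} else {})"
    unfolding crit by (auto simp: face_lcm_def mon_lcm_single)
  then show "pruned_rank [m] (Suc i) \<alpha> = betti_ideal V (mspan ?D :: ('v, 'k) mpoly set) i \<alpha>"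
    unfolding betti by (simp add: pruned_rank_def)
qed (use V in simp_all)

section \<open>Sums of ideals multiplied by distinct new variables\<close>

lemma lookup_xvar: "lookup (xvar i) v = (if v = i then 1 else 0)"
  by (simp add: xvar_def lookup_single when_def)

lemma keys_xvar: "keys (xvar i) = {i}"
  by (simp add: xvar_def)

lemma ext_xvar_iff:
  "e \<in> ext V W (xvar i) D \<longleftrightarrow> keys e \<subseteq> V \<and> lookup e i \<ge> 1 \<and> restr W e \<in> D"
proof -
  have "(\<forall>v. lookup (xvar i) v \<le> lookup e v) \<longleftrightarrow> lookup e i \<ge> 1"
    by (auto simp: lookup_xvar)
  then show ?thesis by (simp only: ext_def mem_Collect_eq)
qed

lemma restr_restr: "W \<subseteq> W' \<Longrightarrow> restr W (restr W' e) = restr W e"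
  by (rule poly_mapping_eqI) auto

text \<open>Sums \<open>\<Sum>\<^sub>i x\<^sub>i L\<^sub>i\<close> are built up one variable at a time. The intersection of \<open>x L\<^sub>x\<close> with
  \<open>\<Sum>\<^sub>i x\<^sub>i L\<^sub>i\<close> is again of this form, namely \<open>\<Sum>\<^sub>i x\<^sub>i (x (L\<^sub>x \<inter> L\<^sub>i))\<close>.\<close>

lemma admits_min_pruned_sum:
  fixes L :: "'v \<Rightarrow> 'v expo set"
  assumes V: "finite V" and "finite X" and "X \<subseteq> V" "W \<subseteq> V" "X \<inter> W = {}"
    and "\<And>T. T \<subseteq> X \<Longrightarrow> T \<noteq> {} \<Longrightarrow> admits_min_pruned W (mspan (\<Inter>i\<in>T. L i) :: ('v, 'k::field) mpoly set)"
    and "\<And>i. i \<in> X \<Longrightarrow> 0 \<notin> L i"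
  shows "admits_min_pruned V (mspan (\<Union>i\<in>X. ext V W (xvar i) (L i)) :: ('v, 'k) mpoly set)"
  using assms(2-)
proof (induction X arbitrary: W L rule: finite_induct)
  case empty
  show ?case using admits_min_pruned_zero[OF V] by simp
next
  case (insert x X)
  let ?D = "ext V W (xvar x) (L x)" and ?D' = "\<Union>i\<in>X. ext V W (xvar i) (L i)"
  \<comment> \<open>In the intersection the variable \<open>x\<close> no longer indexes a summand:
    it moves into the base ring, and the factor \<open>x\<close> becomes part of the ideals.\<close>
  let ?W = "insert x W" and ?L = "\<lambda>i. ext (insert x W) W (xvar x) (L x \<inter> L i)"
  have x: "x \<in> V" "x \<notin> W" "X \<subseteq> V" "X \<inter> W = {}" using insert.prems by auto
  have Lx: "admits_min_pruned W (mspan (L x) :: ('v, 'k) mpoly set)" using insert.prems(4)[of "{x}"] by simp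
  have Li: "admits_min_pruned W (mspan (L i) :: ('v, 'k) mpoly set)" if "i \<in> X" for i
    using insert.prems(4)[of "{i}"] that by simp
  have AD: "admits_min_pruned V (mspan ?D :: ('v, 'k) mpoly set)"
    by (rule admits_min_pruned_ext[OF Lx V insert.prems(2)]) (use x insert.prems in \<open>auto simp: keys_xvar\<close>)
  have AD': "admits_min_pruned V (mspan ?D' :: ('v, 'k) mpoly set)"
  proof (rule insert.IH)
    show "admits_min_pruned W (mspan (\<Inter>i\<in>T. L i) :: ('v, 'k) mpoly set)" if "T \<subseteq> X" "T \<noteq> {}" for T
      using that by (intro insert.prems(4)) auto
  qed (use x insert.prems in auto)
  have "?D \<inter> ?D' = (\<Union>i\<in>X. ext V ?W (xvar i) (?L i))"
  proof -
    have "e \<in> ?D \<inter> ext V W (xvar i) (L i) \<longleftrightarrow> e \<in> ext V ?W (xvar i) (?L i)" for e i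
      by (auto simp: ext_xvar_iff keys_restr restr_restr[OF subset_insertI])
    then show ?thesis by blast
  qed
  moreover have "admits_min_pruned V (mspan (\<Union>i\<in>X. ext V ?W (xvar i) (?L i)) :: ('v, 'k) mpoly set)"
  proof (rule insert.IH)
    fix T assume T: "T \<subseteq> X" "T \<noteq> {}"
    \<comment> \<open>Intersections of the new ideals are multiples of intersections that include
      \<open>L x\<close>, which is why the assumption ranges over all nonempty subsets and not just
      single indices.\<close>
    have eq: "(\<Inter>i\<in>T. ?L i) = ext ?W W (xvar x) (\<Inter>i\<in>insert x T. L i)"
      using T(2) by (auto simp: ext_def)
    have "admits_min_pruned W (mspan (\<Inter>i\<in>insert x T. L i) :: ('v, 'k) mpoly set)"
      using T by (intro insert.prems(4)) auto
    moreover have "finite ?W" using V insert.prems(2) finite_subset by auto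
    ultimately show "admits_min_pruned ?W (mspan (\<Inter>i\<in>T. ?L i) :: ('v, 'k) mpoly set)"
      unfolding eq by (rule admits_min_pruned_ext) (use x insert.prems(5) in \<open>auto simp: keys_xvar\<close>)
  next
    fix i assume "i \<in> X"
    then show "0 \<notin> ?L i" by (intro zero_notin_ext) (use insert.prems(5) in auto)
  qed (use x insert.prems insert.hyps in auto)
  ultimately have AI: "admits_min_pruned V (mspan ?D \<inter> mspan ?D' :: ('v, 'k) mpoly set)"
    by (simp only: mspan_Int)
  have "betti_splitting V (mspan (?D \<union> ?D') :: ('v, 'k) mpoly set) (mspan ?D) (mspan ?D')"
  \<comment> \<open>Generators of x L_x involve only \<open>x\<close> and \<open>W\<close>, those of
    the remaining sum only \<open>X\<close> and \<open>W\<close>, while an element of either ideal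
    is divisible by a variable that the other support omits.\<close>
  proof (rule betti_splittingI[where S = "insert x W" and S' = "X \<union> W"])
    have minL: "keys g \<subseteq> insert i W"
      if "i \<in> insert x X" "g \<in> min_expos (ext V W (xvar i) (L i))" for g i
    proof -
      have up: "up_closed W (L i)" using that(1) Lx Li admits_min_pruned_mspanD(1) by blast
      have i: "i \<in> V" "i \<notin> W" using that(1) insert.prems by auto
      have "min_expos (ext V W (xvar i) (L i)) = (\<lambda>m. m + xvar i) ` min_expos (L i)"
        by (rule min_expos_ext[OF insert.prems(2) _ up]) (use i in \<open>simp add: keys_xvar\<close>)
      with that(2) have "\<exists>m. m \<in> L i \<and> g = m + xvar i" unfolding min_expos_def by blast
      then obtain m where m: "m \<in> L i" "g = m + xvar i" by blast
      have "keys m \<subseteq> W" using m(1) up by (simp add: up_closed_def)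
      then show ?thesis by (auto simp: m(2) keys_add_expo keys_xvar)
    qed
    show "keys g \<subseteq> insert x W" if "g \<in> min_expos ?D" for g using minL[of x g] that by simp
    show "keys g \<subseteq> X \<union> W" if g: "g \<in> min_expos ?D'" for g
    proof -
      obtain i where i: "i \<in> X" "g \<in> min_expos (ext V W (xvar i) (L i))"
        using g unfolding min_expos_def by blast
      then show ?thesis using minL[of i g] by auto
    qed
    show "\<not> keys e \<subseteq> insert x W" if e: "e \<in> ?D'" for e
    proof -
      obtain i where "i \<in> X" "lookup e i \<ge> 1" using e by (auto simp: ext_xvar_iff)
      then have "i \<in> keys e" "i \<notin> insert x W"
        using x(4) insert.hyps(2) by (auto simp: in_keys_iff)
      then show ?thesis by blast
    qed
    show "\<not> keys e \<subseteq> X \<union> W" if "e \<in> ?D" for e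
    proof -
      have "x \<in> keys e" using that by (auto simp: ext_xvar_iff in_keys_iff)
      then show ?thesis using x(2) insert.hyps(2) by blast
    qed
  qed (use V admits_min_pruned_mspanD[OF AD] admits_min_pruned_mspanD[OF AD'] in simp_all)
  then have "admits_min_pruned V (mspan (?D \<union> ?D') :: ('v, 'k) mpoly set)"
    using AD AD' AI by (rule admits_min_pruned.splitting)
  then show ?case by simp
qed

section \<open>Edge ideals\<close>

lemma edge_dvd_iff:
  assumes "i \<noteq> j"
  shows "(\<forall>v. lookup (xvar i + xvar j) v \<le> lookup e v) \<longleftrightarrow>
    lookup e i \<ge> 1 \<and> lookup e j \<ge> 1"
  using assms by (auto simp: lookup_add lookup_xvar)

lemma edge_ideal_eq:
  assumes "simple_graph V E"
  shows "edge_ideal V E = (mspan {e. keys e \<subseteq> V \<and>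
    (\<exists>i j. {i, j} \<in> E \<and> lookup e i \<ge> 1 \<and> lookup e j \<ge> 1)} :: ('v, 'k::field) mpoly set)"
proof -
  let ?M = "{xvar i + xvar j | i j. {i, j} \<in> E}"
  have edge: "i \<noteq> j \<and> i \<in> V \<and> j \<in> V" if "{i, j} \<in> E" for i j
    using assms that by (force simp: simple_graph_def)
  have "edge_ideal V E = (ideal_gen V (mon ` ?M) :: ('v, 'k) mpoly set)"
    unfolding edge_ideal_def by (rule arg_cong[of _ _ "ideal_gen V"]) blast
  also have "\<dots> = mspan (upset V ?M)"
    by (rule ideal_gen_mon) (use edge in \<open>auto simp: keys_add_expo keys_xvar\<close>)
  also have "upset V ?M = {e. keys e \<subseteq> V \<and>
    (\<exists>i j. {i, j} \<in> E \<and> lookup e i \<ge> 1 \<and> lookup e j \<ge> 1)}"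
  proof -
    have "(\<exists>m\<in>?M. \<forall>v. lookup m v \<le> lookup e v) \<longleftrightarrow>
      (\<exists>i j. {i, j} \<in> E \<and> lookup e i \<ge> 1 \<and> lookup e j \<ge> 1)" for e :: "'v expo"
    proof -
      have "(\<exists>m\<in>?M. \<forall>v. lookup m v \<le> lookup e v) \<longleftrightarrow>
        (\<exists>i j. {i, j} \<in> E \<and> (\<forall>v. lookup (xvar i + xvar j) v \<le> lookup e v))" by blast
      moreover have "({i, j} \<in> E \<and> (\<forall>v. lookup (xvar i + xvar j) v \<le> lookup e v)) \<longleftrightarrow>
        ({i, j} \<in> E \<and> lookup e i \<ge> 1 \<and> lookup e j \<ge> 1)" for i j
        using edge[of i j] edge_dvd_iff[of i j e] by blast
      ultimately show ?thesis by simp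
    qed
    then show ?thesis by (simp only: upset_def)
  qed
  finally show ?thesis .
qed

text \<open>Edges meeting \<open>\<Inter>k\<in>ks. nbrs E k\<close> may be included among the generators, since the vertices of this
  intersection are generators themselves.\<close>

lemma H_ideal_eq:
  assumes ks: "finite ks" and nb: "\<And>k. k \<in> ks \<Longrightarrow> nbrs E k - {u} \<subseteq> W" and u: "u \<notin> W"
    and loop: "\<And>i. {i, i} \<notin> E"
  shows "H_ideal W E u ks = (mspan {e. keys e \<subseteq> W \<and>
    ((\<forall>k\<in>ks. \<exists>l\<in>nbrs E k - {u}. lookup e l \<ge> 1) \<or>
     (\<exists>i j. {i, j} \<in> E \<and> i \<in> W \<and> j \<in> W \<and> lookup e i \<ge> 1 \<and> lookup e j \<ge> 1))}
    :: ('v, 'k::field) mpoly set)"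
proof -
  let ?edge = "\<lambda>i j. {i, j} \<in> E \<and> i \<in> W \<and> j \<in> W"
  let ?I = "\<Inter>k\<in>ks. nbrs E k"
  let ?A = "{xvar i + xvar j | i j. {i, j} \<in> E \<and> i \<in> W \<and> j \<in> W \<and> i \<notin> ?I \<and> j \<notin> ?I}"
  let ?B = "{mon_lcm ((\<lambda>k. xvar (l k)) ` ks) | l. \<forall>k\<in>ks. l k \<in> nbrs E k - {u}}"
  let ?P = "\<lambda>e :: 'v expo. \<forall>k\<in>ks. \<exists>l\<in>nbrs E k - {u}. lookup e l \<ge> 1"
  have lcm_le: "(\<forall>v. lookup (mon_lcm ((\<lambda>k. xvar (l k)) ` ks)) v \<le> lookup e v) \<longleftrightarrow>
    (\<forall>k\<in>ks. lookup e (l k) \<ge> 1)" for l and e :: "'v expo"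
  proof -
    have "lookup (mon_lcm ((\<lambda>k. xvar (l k)) ` ks)) v \<le> lookup e v \<longleftrightarrow>
       (\<forall>k\<in>ks. lookup (xvar (l k)) v \<le> lookup e v)" for v
      using ks by (simp add: lookup_mon_lcm)
    then show ?thesis by (auto simp: lookup_xvar)
  qed
  have keysA: "keys m \<subseteq> W" if "m \<in> ?A" for m
    using that by (auto simp: keys_add_expo keys_xvar)
  have keysB: "keys m \<subseteq> W" if "m \<in> ?B" for m
  proof
    fix v assume v: "v \<in> keys m"
    from \<open>m \<in> ?B\<close> obtain l where l: "m = mon_lcm ((\<lambda>k. xvar (l k)) ` ks)" "\<forall>k\<in>ks. l k \<in> nbrs E k - {u}" by blast
    let ?S = "insert 0 ((\<lambda>e. lookup e v) ` (\<lambda>k. xvar (l k)) ` ks)"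
    have "Max ?S \<noteq> 0" using v ks by (simp only: l in_keys_iff lookup_mon_lcm finite_imageI not_False_eq_True)
    moreover have "Max ?S \<in> ?S" using ks by (intro Max_in) auto
    ultimately obtain k where "k \<in> ks" "lookup (xvar (l k)) v \<noteq> 0" by auto
    then have "k \<in> ks" "v = l k" by (auto simp: lookup_xvar split: if_splits)
    then show "v \<in> W" using l(2) nb by blast
  qed
  have "H_ideal W E u ks = (ideal_gen W (mon ` (?A \<union> ?B)) :: ('v, 'k) mpoly set)"
    unfolding H_ideal_def by (rule arg_cong[of _ _ "ideal_gen W"]) blast
  also have "\<dots> = mspan (upset W (?A \<union> ?B))"
    by (rule ideal_gen_mon) (use keysA keysB in blast)
  also have "upset W (?A \<union> ?B) = {e. keys e \<subseteq> W \<and> (?P e \<or>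
     (\<exists>i j. {i, j} \<in> E \<and> i \<in> W \<and> j \<in> W \<and> lookup e i \<ge> 1 \<and> lookup e j \<ge> 1))}"
  proof -
    have "(\<exists>m\<in>?A \<union> ?B. \<forall>v. lookup m v \<le> lookup e v) \<longleftrightarrow>
      ?P e \<or> (\<exists>i j. {i, j} \<in> E \<and> i \<in> W \<and> j \<in> W \<and> lookup e i \<ge> 1 \<and> lookup e j \<ge> 1)"
      (is "?L \<longleftrightarrow> ?R") for e :: "'v expo"
    proof -
      have B: "(\<exists>m\<in>?B. \<forall>v. lookup m v \<le> lookup e v) \<longleftrightarrow> ?P e"
      proof
        assume "\<exists>m\<in>?B. \<forall>v. lookup m v \<le> lookup e v"
        then obtain l where l: "\<forall>k\<in>ks. l k \<in> nbrs E k - {u}"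
          "\<forall>v. lookup (mon_lcm ((\<lambda>k. xvar (l k)) ` ks)) v \<le> lookup e v" by blast
        from l(2) have "\<forall>k\<in>ks. lookup e (l k) \<ge> 1" unfolding lcm_le .
        with l(1) show "?P e" by blast
      next
        assume "?P e"
        then have "\<forall>k\<in>ks. \<exists>l. l \<in> nbrs E k - {u} \<and> lookup e l \<ge> 1" by blast
        from bchoice[OF this] obtain l where
          l: "\<forall>k\<in>ks. l k \<in> nbrs E k - {u} \<and> lookup e (l k) \<ge> 1" ..
        then have "\<forall>v. lookup (mon_lcm ((\<lambda>k. xvar (l k)) ` ks)) v \<le> lookup e v"
          unfolding lcm_le by blast
        with l show "\<exists>m\<in>?B. \<forall>v. lookup m v \<le> lookup e v" by blast
      qed
      have A: "(\<exists>m\<in>?A. \<forall>v. lookup m v \<le> lookup e v) \<longleftrightarrow>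
        (\<exists>i j. {i, j} \<in> E \<and> i \<in> W \<and> j \<in> W \<and> i \<notin> ?I \<and> j \<notin> ?I \<and>
          lookup e i \<ge> 1 \<and> lookup e j \<ge> 1)"
      proof -
        have "(\<exists>m\<in>?A. \<forall>v. lookup m v \<le> lookup e v) \<longleftrightarrow>
          (\<exists>i j. {i, j} \<in> E \<and> i \<in> W \<and> j \<in> W \<and> i \<notin> ?I \<and> j \<notin> ?I \<and>
          (\<forall>v. lookup (xvar i + xvar j) v \<le> lookup e v))" by blast
        moreover have "(\<forall>v. lookup (xvar i + xvar j) v \<le> lookup e v) \<longleftrightarrow>
          lookup e i \<ge> 1 \<and> lookup e j \<ge> 1" if "{i, j} \<in> E" for i j
          by (rule edge_dvd_iff) (use that loop in auto)
        ultimately show ?thesis by blast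
      qed
      have I: "?P e" if "i \<in> ?I" "i \<in> W" "lookup e i \<ge> 1" for i
        using that u by blast
      have gen: "(\<exists>i j. {i, j} \<in> E \<and> i \<in> W \<and> j \<in> W \<and> i \<notin> J \<and> j \<notin> J \<and> c i \<and> c j) \<or> p \<longleftrightarrow>
        p \<or> (\<exists>i j. {i, j} \<in> E \<and> i \<in> W \<and> j \<in> W \<and> c i \<and> c j)"
        if "\<And>i. i \<in> J \<Longrightarrow> i \<in> W \<Longrightarrow> c i \<Longrightarrow> p" for J c p
        using that by blast
      show ?thesis unfolding bex_Un A B by (rule gen) (rule I)
    qed
    then show ?thesis by (simp only: upset_def)
  qed
  finally show ?thesis .
qed

theorem theorem4:
  fixes n s :: nat and E :: "nat set set"
    and I K :: "(nat, 'k::field) mpoly set"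
  assumes "n \<ge> 1"
    and "simple_graph {1..n} E"
    and "I = edge_ideal {1..n} E"
    and "nbrs E n = {1..s}"
    and "\<forall>i\<in>{1..s}. \<forall>j\<in>{1..s}. {i, j} \<notin> E"
    and "K = edge_ideal {1..n - 1} (delete_vertex E n)"
    and "admits_min_pruned {1..n - 1} K"
    and "\<forall>ks. ks \<subseteq> {1..s} \<and> ks \<noteq> {} \<longrightarrow>
           admits_min_pruned {s + 1..n - 1} (H_ideal {s + 1..n - 1} E n ks :: (nat, 'k) mpoly set)"
  shows "admits_min_pruned {1..n} I"
proof -
  let ?V = "{1..n}" and ?U = "{1..n - 1}" and ?X = "{1..s}" and ?W = "{s + 1..n - 1}" and ?W' = "{s + 1..n}"
  let ?pos = "\<lambda>(e :: nat expo) i. lookup e i \<ge> 1"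
  have edge: "i \<noteq> j \<and> i \<in> ?V \<and> j \<in> ?V" if "{i, j} \<in> E" for i j
    using assms(2) that by (force simp: simple_graph_def)
  have loop: "{i, i} \<notin> E" for i using edge by blast
  have nX: "{i, n} \<in> E \<longleftrightarrow> i \<in> ?X" for i
    using assms(4) by (auto simp: nbrs_def insert_commute)
  have sn: "s < n"
  proof (rule ccontr)
    assume "\<not> s < n"
    then have "n \<in> ?X" using assms(1) by simp
    then show False using nX loop by blast
  qed
  have edge_W: "i \<in> ?W \<or> j \<in> ?W" if "{i, j} \<in> E" "i \<noteq> n" "j \<noteq> n" for i j
  proof -
    have "i \<in> ?X \<or> i \<in> ?W" "j \<in> ?X \<or> j \<in> ?W" using edge[OF that(1)] that(2,3) by auto
    then show ?thesis using assms(5) that(1) by blast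
  qed
  have nb: "nbrs E k - {n} \<subseteq> ?W" if "k \<in> ?X" for k
  proof
    fix l assume l: "l \<in> nbrs E k - {n}"
    then have "{k, l} \<in> E" by (simp add: nbrs_def)
    moreover have "k \<noteq> n" "k \<notin> ?W" using that sn by auto
    ultimately show "l \<in> ?W" using edge_W[of k l] l by blast
  qed
  have WW': "?W \<subseteq> ?W'" by auto
  define H where "H = (\<lambda>ks. {e :: nat expo. keys e \<subseteq> ?W \<and>
    ((\<forall>k\<in>ks. \<exists>l\<in>nbrs E k - {n}. ?pos e l) \<or> (\<exists>i j. {i, j} \<in> E \<and> i \<in> ?W \<and> j \<in> ?W \<and> ?pos e i \<and> ?pos e j))})"
  have AH: "admits_min_pruned ?W (mspan (H ks) :: (nat, 'k) mpoly set)" if "ks \<subseteq> ?X" "ks \<noteq> {}" for ks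
  proof -
    have "H_ideal ?W E n ks = (mspan (H ks) :: (nat, 'k) mpoly set)"
      unfolding H_def
    proof (rule H_ideal_eq)
      show "finite ks" using that(1) finite_subset by blast
      show "nbrs E k - {n} \<subseteq> ?W" if "k \<in> ks" for k using nb \<open>ks \<subseteq> ?X\<close> that by blast
    qed (use sn loop in auto)
    with assms(8) that show ?thesis by metis
  qed
  have H0: "0 \<notin> H ks" if "ks \<noteq> {}" for ks using that by (auto simp: H_def)
  \<comment> \<open>The edge condition is common to all \<open>k\<close>, so the intersection only
    conjoins the neighbor conditions. This identifies intersections of the ideals I(H_k) with
    I(H_{k_1,...,k_m}).\<close>
  have H_Int: "(\<Inter>k\<in>T. H {k}) = H T" if "T \<noteq> {}" for T using that unfolding H_def by blast
  \<comment> \<open>The ideal (x_n) in the variables x_{s+1}, ..., x_n: the base ring has to omit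
    the variables x_1, ..., x_s that index the summands.\<close>
  define P where "P = upset ?W' {xvar n}"
  define D where "D = (\<Union>i\<in>?X. ext ?V ?W' (xvar i) P)"
  define DK where "DK = {e :: nat expo. keys e \<subseteq> ?U \<and> (\<exists>i j. {i, j} \<in> E \<and> i \<noteq> n \<and> j \<noteq> n \<and> ?pos e i \<and> ?pos e j)}"
  \<comment> \<open>K read in the larger ring with x_n adjoined, so the monomial factor is 1, that
    is, exponent 0.\<close>
  define D' where "D' = ext ?V ?U 0 DK"
  let ?L = "\<lambda>i. ext ?W' ?W (xvar n) (H {i})"
  have P_iff: "e \<in> P \<longleftrightarrow> keys e \<subseteq> ?W' \<and> ?pos e n" for e
  proof -
    have "(\<forall>v. lookup (xvar n) v \<le> lookup e v) \<longleftrightarrow> ?pos e n"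
      by (auto simp: lookup_xvar)
    then show ?thesis by (simp add: P_def upset_def)
  qed
  have D_iff: "e \<in> D \<longleftrightarrow> keys e \<subseteq> ?V \<and> ?pos e n \<and> (\<exists>i\<in>?X. ?pos e i)" for e
    using sn by (auto simp: D_def ext_xvar_iff P_iff keys_restr)
  have D'_iff: "e \<in> D' \<longleftrightarrow> keys e \<subseteq> ?V \<and> (\<exists>i j. {i, j} \<in> E \<and> i \<noteq> n \<and> j \<noteq> n \<and> ?pos e i \<and> ?pos e j)" for e
  proof -
    have r: "?pos (restr ?U e) i \<longleftrightarrow> ?pos e i" if "{i, j} \<in> E" "i \<noteq> n" for i j
      using edge[OF that(1)] that(2) by auto
    have "({i, j} \<in> E \<and> i \<noteq> n \<and> j \<noteq> n \<and> ?pos (restr ?U e) i \<and> ?pos (restr ?U e) j) \<longleftrightarrow>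
      ({i, j} \<in> E \<and> i \<noteq> n \<and> j \<noteq> n \<and> ?pos e i \<and> ?pos e j)" for i j
      using r[of i j] r[of j i] insert_commute[of i j "{}"] by argo
    then show ?thesis unfolding D'_def ext_def DK_def mem_Collect_eq by (simp only: keys_restr) simp
  qed
  have K: "K = mspan DK"
  proof -
    have del: "{i, j} \<in> delete_vertex E n \<longleftrightarrow> {i, j} \<in> E \<and> i \<noteq> n \<and> j \<noteq> n" for i j
      by (auto simp: delete_vertex_def)
    have "simple_graph ?U (delete_vertex E n)"
      unfolding simple_graph_def
    proof
      fix e assume "e \<in> delete_vertex E n"
      then have "e \<subseteq> ?V" "card e = 2" "n \<notin> e" using assms(2) by (auto simp: delete_vertex_def simple_graph_def)
      moreover have "?V - {n} \<subseteq> ?U" by auto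
      ultimately show "e \<subseteq> ?U \<and> card e = 2" by blast
    qed
    from edge_ideal_eq[OF this] show ?thesis unfolding assms(6) DK_def del by (simp only: conj_assoc)
  qed
  have I: "I = mspan (D \<union> D')"
  proof -
    have gen: "(\<exists>i j. R i j \<and> c i \<and> c j) \<longleftrightarrow>
      c n \<and> (\<exists>i\<in>X. c i) \<or> (\<exists>i j. R i j \<and> i \<noteq> n \<and> j \<noteq> n \<and> c i \<and> c j)"
      if R: "\<And>i. R i n \<longleftrightarrow> i \<in> X" "\<And>i. R n i \<longleftrightarrow> i \<in> X" for R c and X :: "nat set"
    proof
      assume "\<exists>i j. R i j \<and> c i \<and> c j"
      then obtain i j where ij: "R i j" "c i" "c j" by blast
      then show "c n \<and> (\<exists>i\<in>X. c i) \<or> (\<exists>i j. R i j \<and> i \<noteq> n \<and> j \<noteq> n \<and> c i \<and> c j)"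
        using R(1)[of i] R(2)[of j] by (cases "i = n"; cases "j = n") blast+
    qed (use R(1) in blast)
    have vertex: "(\<exists>i j. {i, j} \<in> E \<and> ?pos e i \<and> ?pos e j) \<longleftrightarrow>
      ?pos e n \<and> (\<exists>i\<in>?X. ?pos e i) \<or> (\<exists>i j. {i, j} \<in> E \<and> i \<noteq> n \<and> j \<noteq> n \<and> ?pos e i \<and> ?pos e j)" for e
      by (rule gen) (use nX in \<open>simp_all add: insert_commute[of n]\<close>)
    have "{e. keys e \<subseteq> ?V \<and> (\<exists>i j. {i, j} \<in> E \<and> ?pos e i \<and> ?pos e j)} = D \<union> D'"
      unfolding set_eq_iff mem_Collect_eq Un_iff D_iff D'_iff vertex by (intro allI) argo
    then show ?thesis unfolding assms(3) edge_ideal_eq[OF assms(2)] by (rule arg_cong)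
  qed
  have AD: "admits_min_pruned ?V (mspan D :: (nat, 'k) mpoly set)"
    unfolding D_def
  proof (rule admits_min_pruned_sum)
    have xn: "xvar n \<noteq> 0" using lookup_xvar[of n n] by auto
    show "admits_min_pruned ?W' (mspan (\<Inter>i\<in>T. P) :: (nat, 'k) mpoly set)" if "T \<noteq> {}" for T :: "nat set"
      using that sn xn admits_min_pruned_principal[of ?W' "xvar n"] by (simp add: P_def keys_xvar)
  qed (use sn P_iff in auto)
  have DK0: "0 \<notin> DK" by (simp add: DK_def)
  have AD': "admits_min_pruned ?V (mspan D' :: (nat, 'k) mpoly set)"
    unfolding D'_def by (rule admits_min_pruned_ext[OF assms(7)[unfolded K]]) (use DK0 in auto)
  have "D \<inter> D' = (\<Union>i\<in>?X. ext ?V ?W' (xvar i) (?L i))"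
  proof -
    have HL: "restr ?W e \<in> H {i} \<longleftrightarrow> (\<exists>l\<in>nbrs E i - {n}. ?pos e l) \<or>
       (\<exists>i j. {i, j} \<in> E \<and> i \<in> ?W \<and> j \<in> ?W \<and> ?pos e i \<and> ?pos e j)" if "i \<in> ?X" for e i
    proof -
      have p: "lookup (restr ?W e) l = lookup e l" if "l \<in> ?W" for l
        using that by simp
      have 1: "(\<exists>l\<in>nbrs E i - {n}. ?pos (restr ?W e) l) \<longleftrightarrow> (\<exists>l\<in>nbrs E i - {n}. ?pos e l)"
        by (intro bex_cong refl) (simp only: p subsetD[OF nb[OF that]])
      have 2: "({i, j} \<in> E \<and> i \<in> ?W \<and> j \<in> ?W \<and> ?pos (restr ?W e) i \<and> ?pos (restr ?W e) j) \<longleftrightarrow>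
         ({i, j} \<in> E \<and> i \<in> ?W \<and> j \<in> ?W \<and> ?pos e i \<and> ?pos e j)" for i j
        by (intro conj_cong refl) (simp_all only: p)
      show ?thesis
        unfolding H_def mem_Collect_eq 2 by (simp only: 1 keys_restr Int_lower2 ball_simps simp_thms)
    qed
    have "e \<in> D \<inter> D' \<longleftrightarrow> (\<exists>i\<in>?X. e \<in> ext ?V ?W' (xvar i) (?L i))" for e
    proof -
      have mem: "e \<in> ext ?V ?W' (xvar i) (?L i) \<longleftrightarrow> keys e \<subseteq> ?V \<and> ?pos e i \<and> ?pos e n \<and> restr ?W e \<in> H {i}"
        if "i \<in> ?X" for i
      proof -
        have "lookup (restr ?W' e) n = lookup e n" using sn by simp
        then show ?thesis
          by (simp only: ext_xvar_iff restr_restr[OF WW'] keys_restr Int_lower2 simp_thms)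
      qed
      show ?thesis
      proof
        assume e: "e \<in> D \<inter> D'"
        then obtain i a b where i: "i \<in> ?X" "?pos e i" and ab: "{a, b} \<in> E" "a \<noteq> n" "b \<noteq> n" "?pos e a" "?pos e b"
          and e': "keys e \<subseteq> ?V" "?pos e n"
          using D_iff D'_iff by blast
        \<comment> \<open>An edge within \<open>?W\<close> lies in every I(H_i). An edge with an end
          in \<open>?X\<close> selects the summand of that end, whose other end is the required
          neighbor.\<close>
        consider "a \<in> ?W" "b \<in> ?W" | "a \<in> ?X" | "b \<in> ?X"
          using edge[OF ab(1)] ab(2,3) by fastforce
        then show "\<exists>i\<in>?X. e \<in> ext ?V ?W' (xvar i) (?L i)"
        proof cases
          case 1
          then have "restr ?W e \<in> H {i}" using HL[OF i(1)] ab by blast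
          then show ?thesis using mem[OF i(1)] i e' by blast
        next
          case 2
          have "b \<in> nbrs E a - {n}" using ab by (simp add: nbrs_def)
          then have "restr ?W e \<in> H {a}" using HL[OF 2] ab by blast
          then show ?thesis using mem[OF 2] 2 ab e' by blast
        next
          case 3
          have "a \<in> nbrs E b - {n}" using ab by (simp add: nbrs_def insert_commute)
          then have "restr ?W e \<in> H {b}" using HL[OF 3] ab by blast
          then show ?thesis using mem[OF 3] 3 ab e' by blast
        qed
      next
        assume "\<exists>i\<in>?X. e \<in> ext ?V ?W' (xvar i) (?L i)"
        then obtain i where i: "i \<in> ?X" "e \<in> ext ?V ?W' (xvar i) (?L i)" by blast
        then have e: "keys e \<subseteq> ?V" "?pos e i" "?pos e n" "restr ?W e \<in> H {i}" using mem by blast+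
        have "\<exists>a b. {a, b} \<in> E \<and> a \<noteq> n \<and> b \<noteq> n \<and> ?pos e a \<and> ?pos e b"
        proof -
          have "i \<noteq> n" "n \<notin> ?W" using i(1) sn by auto
          then show ?thesis using e(4) e(2) unfolding HL[OF i(1)] nbrs_def by blast
        qed
        then show "e \<in> D \<inter> D'" using e i(1) D_iff D'_iff by blast
      qed
    qed
    then show ?thesis by blast
  qed
  moreover have "admits_min_pruned ?V (mspan (\<Union>i\<in>?X. ext ?V ?W' (xvar i) (?L i)) :: (nat, 'k) mpoly set)"
  proof (rule admits_min_pruned_sum)
    fix T assume T: "T \<subseteq> ?X" "T \<noteq> {}"
    have "(\<Inter>i\<in>T. ?L i) = ext ?W' ?W (xvar n) (\<Inter>i\<in>T. H {i})" using T(2) by (auto simp: ext_def)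
    then have eq: "(\<Inter>i\<in>T. ?L i) = ext ?W' ?W (xvar n) (H T)" unfolding H_Int[OF T(2)] .
    show "admits_min_pruned ?W' (mspan (\<Inter>i\<in>T. ?L i) :: (nat, 'k) mpoly set)"
      unfolding eq by (rule admits_min_pruned_ext[OF AH[OF T]]) (use sn H0[OF T(2)] in \<open>auto simp: keys_xvar\<close>)
  next
    fix i assume "i \<in> ?X"
    show "0 \<notin> ?L i" by (rule zero_notin_ext) (use H0 in simp)
  qed (use sn in auto)
  ultimately have AI: "admits_min_pruned ?V (mspan D \<inter> mspan D' :: (nat, 'k) mpoly set)"
    by (simp only: mspan_Int)
  have "betti_splitting ?V (mspan (D \<union> D') :: (nat, 'k) mpoly set) (mspan D) (mspan D')"
  proof (rule betti_splittingI[where S = "insert n ?X" and S' = ?U])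
    show "keys g \<subseteq> insert n ?X" if g: "g \<in> min_expos D" for g
    proof -
      have gD: "g \<in> D" using g by (simp add: min_expos_def)
      then obtain i where i: "i \<in> ?X" "?pos g i" "?pos g n" using D_iff by blast
      have ne: "n \<noteq> i" using i(1) sn by auto
      have "\<exists>t. g = (xvar n + xvar i) + t" unfolding expo_dvd_iff edge_dvd_iff[OF ne] using i by blast
      then obtain t where t: "g = (xvar n + xvar i) + t" ..
      \<comment> \<open>The monomial x_n x_i divides \<open>g\<close> and itself lies in
        \<open>D\<close>, so by minimality it is \<open>g\<close>, whose support is then
        visible.\<close>
      have "xvar n + xvar i \<in> D"
        unfolding D_iff using i(1) sn by (auto simp: keys_add_expo keys_xvar lookup_add lookup_xvar)
      with g t have "xvar n + xvar i = g" unfolding min_expos_def by blast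
      then show ?thesis using i(1) keys_add_expo[of "xvar n" "xvar i"] by (auto simp: keys_xvar)
    qed
    show "\<not> keys e \<subseteq> insert n ?X" if e: "e \<in> D'" for e
    proof -
      obtain i j where ij: "{i, j} \<in> E" "i \<noteq> n" "j \<noteq> n" "?pos e i" "?pos e j" using e D'_iff by blast
      then have "i \<in> keys e" "j \<in> keys e" by (auto simp: in_keys_iff)
      moreover have "i \<notin> insert n ?X \<or> j \<notin> insert n ?X" using edge_W[OF ij(1-3)] ij(2,3) by auto
      ultimately show ?thesis by blast
    qed
    show "keys g \<subseteq> ?U" if "g \<in> min_expos D'" for g
    proof -
      have up: "up_closed ?U DK" using admits_min_pruned_mspanD(1) assms(7) unfolding K by blast
      have "min_expos D' = (\<lambda>m. m + 0) ` min_expos DK"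
        unfolding D'_def by (rule min_expos_ext[OF _ _ up]) auto
      then show ?thesis using that by (auto simp: min_expos_def DK_def)
    qed
    show "\<not> keys e \<subseteq> ?U" if "e \<in> D" for e
    proof -
      have "n \<in> keys e" "n \<notin> ?U" using that assms(1) D_iff by (auto simp: in_keys_iff)
      then show ?thesis by blast
    qed
  qed (use admits_min_pruned_mspanD[OF AD] admits_min_pruned_mspanD[OF AD'] in simp_all)
  then show ?thesis unfolding I using AD AD' AI by (rule admits_min_pruned.splitting)
qed

end
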